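(* Let $\mathbf f=(f_1,\ldots,f_L):[0,1]^2\to\mathbb R^L$ be linearly independent with $\mathbf f\in\mathcal C$, let $\boldsymbol\theta_0\in\mathbb R^L$, and for each $n$ let $\pi$ be a random permutation in $S_n$ with law $\mathbb P_{n,\boldsymbol\theta_0}$. Then, as $n\to\infty$: (a) With probability tending to $1$, the equation $\mathbf T(\pi)=\nabla Z_n(\boldsymbol\theta)$ (in $\boldsymbol\theta\in\mathbb R^L$) has a unique root $\hat{\boldsymbol\theta}_{ML}$, which satisfies $\hat{\boldsymbol\theta}_{ML}\xrightarrow{P}\boldsymbol\theta_0$. (b) If $\boldsymbol\theta_0=\mathbf 0$, then $$\frac{\mathbf T(\pi)-\nabla Z_n(\mathbf 0)}{\sqrt n}\xrightarrow{D}N(\mathbf 0,\Gamma),\qquad \Gamma_{p,q}:=\int_{[0,1]^2}f_p(x,y)f_q(x,y)\,dx\,dy.$$ (c) If $\boldsymbol\theta_0=\mathbf 0$, then $\sqrt n\,\hat{\boldsymbol\theta}_{ML}\xrightarrow{D}N(\mathbf 0,\Gamma^{-1})$.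
   Context: $[n]=\{1,\ldots,n\}$ and $S_n$ is the set of permutations of $[n]$. Class $\mathcal C$: the set of continuous $F:[0,1]^2\to\mathbb R$, not almost everywhere $0$, such that $\int_0^1F(x,z)\,dz=0$ for all $x$ and $\int_0^1F(z,y)\,dz=0$ for all $y$. For a vector function, $\mathbf f\in\mathcal C$ means $f_r\in\mathcal C$ for every $r\in[L]$. $\mathbf f$ is linearly independent if there is no nonzero $\mathbf d\in\mathbb R^L$ with $\mathbf d^\top\mathbf f=0$ Lebesgue-a.e. on $[0,1]^2$. Model: for $\boldsymbol\theta\in\mathbb R^L$, $\mathbb P_{n,\boldsymbol\theta}$ is the probability on $S_n$ with mass function $\mathbb P_{n,\boldsymbol\theta}(\pi)=\exp(\boldsymbol\theta^\top\mathbf T(\pi)-Z_n(\boldsymbol\theta))$, where $\mathbf T(\pi)=\sum_{i=1}^n\mathbf f(i/n,\pi(i)/n)$ and $Z_n(\boldsymbol\theta)=\log\sum_{\pi\in S_n}\exp(\boldsymbol\theta^\top\mathbf T(\pi))$. $\hat{\boldsymbol\theta}_{ML}$ is the maximum likelihood estimator. *)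

theory Defs
  imports "HOL-Probability.Probability"
begin

definition unit_square :: "(real \<times> real) set" where
  "unit_square = {0..1} \<times> {0..1}"

definition class_C :: "(real \<times> real \<Rightarrow> real) set" where
  "class_C = {F. continuous_on unit_square F \<and>
                 \<not> (AE p in lebesgue_on unit_square. F p = 0) \<and>
                 (\<forall>x\<in>{0..1}. integral {0..1} (\<lambda>z. F (x, z)) = 0) \<and>
                 (\<forall>y\<in>{0..1}. integral {0..1} (\<lambda>z. F (z, y)) = 0)}"

definition lin_indep :: "(real \<times> real \<Rightarrow> real ^ 'l) \<Rightarrow> bool" where
  "lin_indep f \<longleftrightarrow>
     \<not> (\<exists>d. d \<noteq> 0 \<and> (AE p in lebesgue_on unit_square. d \<bullet> f p = 0))"

text \<open>
  The symmetric group on \<open>{1..n}\<close> is \<open>{\<pi>. \<pi> permutes {1..n}}\<close>: its elements are functions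
  on \<open>nat\<close> that are the identity outside \<open>{1..n}\<close>.
\<close>

definition suff_stat :: "(real \<times> real \<Rightarrow> real ^ 'l) \<Rightarrow> nat \<Rightarrow> (nat \<Rightarrow> nat) \<Rightarrow> real ^ 'l" where
  "suff_stat f n \<pi> = (\<Sum>i=1..n. f (real i / real n, real (\<pi> i) / real n))"

definition log_partition :: "(real \<times> real \<Rightarrow> real ^ 'l) \<Rightarrow> nat \<Rightarrow> real ^ 'l \<Rightarrow> real" where
  "log_partition f n \<theta> = ln (\<Sum>\<pi> | \<pi> permutes {1..n}. exp (\<theta> \<bullet> suff_stat f n \<pi>))"

definition perm_pmf :: "(real \<times> real \<Rightarrow> real ^ 'l) \<Rightarrow> nat \<Rightarrow> real ^ 'l \<Rightarrow> (nat \<Rightarrow> nat) pmf" where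
  "perm_pmf f n \<theta> = embed_pmf (\<lambda>\<pi>. if \<pi> permutes {1..n}
     then exp (\<theta> \<bullet> suff_stat f n \<pi> - log_partition f n \<theta>) else 0)"

lemma partition_pos:
  "(\<Sum>\<pi> | \<pi> permutes {1..n}. exp (\<theta> \<bullet> suff_stat f n \<pi>)) > 0"
proof (rule sum_pos)
  show "finite {\<pi>. \<pi> permutes {1..n}}" by (rule finite_permutations) simp
  show "{\<pi>. \<pi> permutes {1..n}} \<noteq> {}" using permutes_id by blast
qed simp

lemma pmf_perm_pmf:
  "pmf (perm_pmf f n \<theta>) \<pi> = (if \<pi> permutes {1..n}
     then exp (\<theta> \<bullet> suff_stat f n \<pi> - log_partition f n \<theta>) else 0)"
  unfolding perm_pmf_def
proof (rule pmf_embed_pmf)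
  let ?S = "{\<pi>. \<pi> permutes {1..n}}"
  let ?g = "\<lambda>\<pi>. if \<pi> permutes {1..n}
     then exp (\<theta> \<bullet> suff_stat f n \<pi> - log_partition f n \<theta>) else 0"
  have fin: "finite ?S" by (rule finite_permutations) simp
  have "(\<integral>\<^sup>+x. ennreal (?g x) \<partial>count_space UNIV) = (\<Sum>x\<in>?S. ennreal (?g x))"
    by (rule nn_integral_count_space'[OF fin]) auto
  also have "\<dots> = ennreal (\<Sum>x\<in>?S. ?g x)" by (rule sum_ennreal) simp
  also have "(\<Sum>x\<in>?S. ?g x) = (\<Sum>x\<in>?S. exp (\<theta> \<bullet> suff_stat f n x)) / exp (log_partition f n \<theta>)"
    by (simp add: exp_diff sum_divide_distrib)
  also have "\<dots> = 1"
    using partition_pos[where f=f and n=n and \<theta>=\<theta>] by (simp add: log_partition_def)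
  finally show "(\<integral>\<^sup>+x. ennreal (?g x) \<partial>count_space UNIV) = 1" by simp
qed simp

definition gradient :: "('a::real_inner \<Rightarrow> real) \<Rightarrow> 'a \<Rightarrow> 'a" where
  "gradient g x = (THE D. GDERIV g x :> D)"

lemma gradient_eqI:
  fixes g :: "'a::real_inner \<Rightarrow> real"
  assumes "GDERIV g x :> D"
  shows "gradient g x = D"
  unfolding gradient_def
proof (rule the_equality[where P = "\<lambda>D. GDERIV g x :> D", OF assms])
  fix E assume "GDERIV g x :> E"
  then have "(\<lambda>h. inner h E) = (\<lambda>h. inner h D)"
    using assms unfolding gderiv_def by (rule has_derivative_unique)
  then have "inner (E - D) E = inner (E - D) D" by (rule fun_cong)
  then have "inner (E - D) (E - D) = 0" by (simp add: inner_diff_right)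
  then show "E = D" by simp
qed

lemma GDERIV_log_partition:
  "GDERIV (log_partition f n) \<theta> :> gradient (log_partition f n) \<theta>"
proof -
  let ?S = "{\<pi>. \<pi> permutes {1..n}}"
  let ?W = "\<lambda>\<theta>. \<Sum>\<pi>\<in>?S. exp (\<theta> \<bullet> suff_stat f n \<pi>)"
  have 1: "GDERIV ?W \<theta> :> (\<Sum>\<pi>\<in>?S. exp (\<theta> \<bullet> suff_stat f n \<pi>) *\<^sub>R suff_stat f n \<pi>)"
    unfolding gderiv_def inner_sum_right inner_scaleR_right
    by (intro has_derivative_sum)
       (rule has_derivative_eq_rhs[OF has_derivative_exp[OF bounded_linear_imp_has_derivative[OF bounded_linear_inner_left]]],
        simp add: mult.commute)
  have "GDERIV (\<lambda>\<theta>. ln (?W \<theta>)) \<theta> :>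
      inverse (?W \<theta>) *\<^sub>R (\<Sum>\<pi>\<in>?S. exp (\<theta> \<bullet> suff_stat f n \<pi>) *\<^sub>R suff_stat f n \<pi>)"
    by (rule GDERIV_DERIV_compose[OF 1 DERIV_ln[OF partition_pos]])
  then have D: "GDERIV (log_partition f n) \<theta> :>
      inverse (?W \<theta>) *\<^sub>R (\<Sum>\<pi>\<in>?S. exp (\<theta> \<bullet> suff_stat f n \<pi>) *\<^sub>R suff_stat f n \<pi>)"
    unfolding log_partition_def[abs_def] .
  show ?thesis unfolding gradient_eqI[OF D] by (rule D)
qed

text \<open>The maximum likelihood estimator; an arbitrary value if the likelihood has no maximizer.\<close>

definition theta_ML :: "(real \<times> real \<Rightarrow> real ^ 'l) \<Rightarrow> nat \<Rightarrow> (nat \<Rightarrow> nat) \<Rightarrow> real ^ 'l" where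
  "theta_ML f n \<pi> = arg_max (\<lambda>\<theta>. pmf (perm_pmf f n \<theta>) \<pi>) (\<lambda>_. True)"

definition tendsto_in_prob ::
  "(nat \<Rightarrow> 'b measure) \<Rightarrow> (nat \<Rightarrow> 'b \<Rightarrow> 'a::metric_space) \<Rightarrow> 'a \<Rightarrow> bool" where
  "tendsto_in_prob M X c \<longleftrightarrow>
     (\<forall>\<epsilon>>0. (\<lambda>n. measure (M n) {\<omega> \<in> space (M n). dist (X n \<omega>) c > \<epsilon>}) \<longlonglongrightarrow> 0)"

text \<open>
  The library's \<open>weak_conv_m\<close> is defined through distribution functions and only covers
  measures on the reals.
\<close>

definition tendsto_in_distr ::
  "(nat \<Rightarrow> 'b measure) \<Rightarrow> (nat \<Rightarrow> 'b \<Rightarrow> 'a::euclidean_space) \<Rightarrow> 'a measure \<Rightarrow> bool" where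
  "tendsto_in_distr M X N \<longleftrightarrow>
     (\<forall>g :: 'a \<Rightarrow> real. continuous_on UNIV g \<and> bounded (range g) \<longrightarrow>
        (\<lambda>n. \<integral>\<omega>. g (X n \<omega>) \<partial>M n) \<longlonglongrightarrow> (\<integral>x. g x \<partial>N))"

text \<open>
  The multivariate normal distribution given by its Lebesgue density, for positive definite \<open>\<Sigma>\<close>.
\<close>

definition mv_normal :: "real ^ 'l \<Rightarrow> real ^ 'l ^ 'l \<Rightarrow> (real ^ 'l) measure" where
  "mv_normal \<mu> \<Sigma> = density lborel (\<lambda>x. ennreal
     (exp (- ((x - \<mu>) \<bullet> (matrix_inv \<Sigma> *v (x - \<mu>))) / 2) / sqrt ((2 * pi) ^ CARD('l) * det \<Sigma>)))"

definition Gam :: "(real \<times> real \<Rightarrow> real ^ 'l) \<Rightarrow> real ^ 'l ^ 'l" where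
  "Gam f = (\<chi> p q. integral unit_square (\<lambda>z. f z $ p * f z $ q))"

lemma Gam_pos_def:
  fixes f :: "real \<times> real \<Rightarrow> real ^ 'l"
  assumes f: "lin_indep f" "\<forall>r. (\<lambda>z. f z $ r) \<in> class_C" and d: "d \<noteq> 0"
  shows "d \<bullet> (Gam f *v d) > 0"
proof -
  let ?S = "cbox (0, 0) (1, 1) :: (real \<times> real) set"
  have S: "unit_square = ?S" by (auto simp: unit_square_def cbox_Pair_eq)
  have cont: "continuous_on ?S (\<lambda>z. f z $ r)" for r
    using f(2) by (auto simp: class_C_def S)
  have contd: "continuous_on ?S (\<lambda>z. (d \<bullet> f z)\<^sup>2)"
    unfolding inner_vec_def by (intro continuous_intros cont)
  have int: "(\<lambda>z. f z $ p * f z $ q) integrable_on ?S" for p q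
    by (intro integrable_continuous continuous_intros cont)
  have int': "(\<lambda>z. d $ p * d $ q * (f z $ p * f z $ q)) integrable_on ?S" for p q
    by (intro integrable_continuous continuous_intros cont)
  have "d \<bullet> (Gam f *v d) =
      (\<Sum>p\<in>UNIV. \<Sum>q\<in>UNIV. integral ?S (\<lambda>z. d $ p * d $ q * (f z $ p * f z $ q)))"
    by (simp add: inner_vec_def matrix_vector_mult_def Gam_def S sum_distrib_left mult_ac)
  also have "\<dots> = integral ?S (\<lambda>z. \<Sum>p\<in>UNIV. \<Sum>q\<in>UNIV. d $ p * d $ q * (f z $ p * f z $ q))"
    by (subst integral_sum, simp, intro integrable_sum int', simp)
       (rule sum.cong[OF refl], rule integral_sum[symmetric], auto intro: int')
  also have "(\<lambda>z. \<Sum>p\<in>UNIV. \<Sum>q\<in>UNIV. d $ p * d $ q * (f z $ p * f z $ q)) = (\<lambda>z. (d \<bullet> f z)\<^sup>2)"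
    by (simp add: inner_vec_def power2_eq_square sum_product mult_ac)
  finally have eq: "d \<bullet> (Gam f *v d) = integral ?S (\<lambda>z. (d \<bullet> f z)\<^sup>2)" .
  have "integral ?S (\<lambda>z. (d \<bullet> f z)\<^sup>2) \<noteq> 0"
  proof
    assume "integral ?S (\<lambda>z. (d \<bullet> f z)\<^sup>2) = 0"
    then have "((\<lambda>z. (d \<bullet> f z)\<^sup>2) has_integral 0) ?S"
      using integrable_continuous[OF contd] by (simp add: has_integral_iff)
    moreover have "box (0, 0) (1, 1) \<noteq> ({} :: (real \<times> real) set)"
      by (auto simp: box_ne_empty Basis_prod_def)
    ultimately have "d \<bullet> f z = 0" if "z \<in> unit_square" for z
      using has_integral_0_cbox_imp_0[OF contd _ _ _ that[unfolded S]] by simp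
    then have "AE z in lebesgue_on unit_square. d \<bullet> f z = 0"
      by (intro AE_I2) (auto simp: space_restrict_space)
    then show False using f(1) d by (auto simp: lin_indep_def)
  qed
  moreover have "integral ?S (\<lambda>z. (d \<bullet> f z)\<^sup>2) \<ge> 0"
    by (intro integral_nonneg integrable_continuous contd) auto
  ultimately show ?thesis using eq by simp
qed

lemma invertible_Gam:
  fixes f :: "real \<times> real \<Rightarrow> real ^ 'l"
  assumes "lin_indep f" "\<forall>r. (\<lambda>z. f z $ r) \<in> class_C"
  shows "invertible (Gam f)"
proof -
  have "d = 0" if "Gam f *v d = 0" for d
    using Gam_pos_def[OF assms, of d] that by force
  then show ?thesis
    unfolding invertible_left_inverse matrix_left_invertible_ker by blast
qed

end

theory Submission
  imports Defs
begin

text \<open>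
  The laws form an exponential family, so the gradient of \<open>log_partition\<close> at \<open>\<theta>\<close> is the
  mean of the sufficient statistic \<open>T\<close> under the law with parameter \<open>\<theta>\<close>, and the derivative
  of \<open>d \<bullet> gradient\<close> in direction \<open>d\<close> is the variance of \<open>d \<bullet> T\<close>.  The theorem follows from two
  facts about these variances: they are of exact order \<open>n\<close>, uniformly for \<open>\<theta>\<close> in a ball, and
  for \<open>\<theta>\<close> of order \<open>1 / sqrt n\<close> the gradient is asymptotically linear with slope \<open>n * Gam f\<close>.
  Both are obtained by comparing a permutation with its composition with a transposition, which
  changes \<open>d \<bullet> T\<close> only by the bounded amount \<open>xdiff\<close>.

  \<^bold>\<open>Order of the variance.\<close>  A transposition changes the weight of a permutation by at most a
  factor \<open>R\<close> that does not depend on \<open>n\<close>.  A coupling argument by induction on the number of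
  permutations left (\<open>cyl_mean_gap\<close>) shows that the value prescribed at one more position moves the
  mean of a statistic by at most \<open>R\<close> times its largest change under a transposition; the law of
  total variance then gives the upper bound \<open>variance_bounded_differences\<close>.  For the lower bound
  \<open>lin_stat_variance_lower\<close>, Cauchy--Schwarz is applied to \<open>d \<bullet> T\<close> and a statistic that is
  antisymmetric for the weighted law: its mean vanishes, its covariance with \<open>d \<bullet> T\<close> dominates a sum of
  squares, and its variance is controlled by the upper bound.  The sum of squares is a Riemann
  sum, which the vanishing marginals of the class turn into \<open>d \<bullet> (Gam f *v d)\<close>
  (\<open>xprod_dir_mat_limit\<close>), and linear independence makes this positive.

  \<^bold>\<open>Consistency.\<close>  Thus the gradient is strongly monotone with a constant of order \<open>n\<close>, while
  \<open>T\<close> deviates from its mean only by \<open>sqrt n\<close>.  On a small sphere around \<open>\<theta>\<^sub>0\<close> monotonicity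
  therefore wins, which forces a root of the likelihood equation inside the sphere (\<open>mle_near\<close>);
  strict convexity makes it unique and identifies it with the maximum likelihood estimator.

  \<^bold>\<open>Limit laws at \<open>0\<close>.\<close>  Under the uniform law, Stein's exchangeable pair method gives
  \<open>E (S\<^sub>b exp (s * S\<^sub>a)) \<approx> s * Cov(a, b) * E (exp (s * S\<^sub>a))\<close> for normalised linear statistics and
  complex \<open>s\<close> (\<open>stein_identity\<close>).  For \<open>s = \<i> t\<close> this is an approximate differential equation
  for the characteristic function and yields its Gaussian limit; the continuity theorem
  \<open>levy_continuity\<close> turns it into convergence in distribution.  For \<open>s = 1\<close> it computes the
  gradient at \<open>h / sqrt n\<close>, which, centred and divided by \<open>sqrt n\<close>, tends to \<open>Gam f *v h\<close>
  (\<open>rescaled_gradient\<close>).  Monotonicity of the gradient converts this pointwise limit into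
  \<open>sqrt n * theta_ML \<approx> matrix_inv (Gam f) *v score\<close> in probability (\<open>linearization_in_prob\<close>),
  so that the limit law of the estimator is the linear image of that of the score.
\<close>

section \<open>Linear statistics and transpositions\<close>

definition lin_stat :: "'a set \<Rightarrow> ('a \<Rightarrow> 'a \<Rightarrow> real) \<Rightarrow> ('a \<Rightarrow> 'a) \<Rightarrow> real" where
  "lin_stat I g \<pi> = (\<Sum>i\<in>I. g i (\<pi> i))"

text \<open>
  The amount by which a linear statistic drops when the values \<open>k\<close> and \<open>l\<close> at \<open>i\<close> and \<open>j\<close> are
  exchanged.  It does not see matrices that depend on one index only.
\<close>

definition xdiff :: "('a \<Rightarrow> 'b \<Rightarrow> real) \<Rightarrow> 'a \<Rightarrow> 'a \<Rightarrow> 'b \<Rightarrow> 'b \<Rightarrow> real" where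
  "xdiff g i j k l = g i k + g j l - g i l - g j k"

abbreviation swap :: "'a \<Rightarrow> 'a \<Rightarrow> ('a \<Rightarrow> 'b) \<Rightarrow> ('a \<Rightarrow> 'b)" where
  "swap i j \<pi> \<equiv> \<pi> \<circ> Transposition.transpose i j"

lemma swap_swap: "swap i j (swap i j \<pi>) = \<pi>"
  by (simp add: comp_assoc)

lemma inj_swap: "inj_on (swap i j) S"
  by (metis inj_onI swap_swap)

lemma permutes_swap: "\<pi> permutes I \<Longrightarrow> i \<in> I \<Longrightarrow> j \<in> I \<Longrightarrow> swap i j \<pi> permutes I"
  by (intro permutes_compose permutes_swap_id)

lemma lin_stat_swap:
  assumes "finite I" "i \<in> I" "j \<in> I"
  shows "lin_stat I g (swap i j \<pi>) = lin_stat I g \<pi> - xdiff g i j (\<pi> i) (\<pi> j)"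
proof (cases "i = j")
  case True
  then show ?thesis by (simp add: xdiff_def)
next
  case False
  have split: "lin_stat I g \<rho> = g i (\<rho> i) + g j (\<rho> j) + (\<Sum>r\<in>I - {i, j}. g r (\<rho> r))" for \<rho>
  proof -
    have "lin_stat I g \<rho> = (\<Sum>r\<in>{i, j}. g r (\<rho> r)) + (\<Sum>r\<in>I - {i, j}. g r (\<rho> r))"
      unfolding lin_stat_def
      by (metis (no_types, lifting) assms add.commute empty_subsetI insert_subset sum.subset_diff)
    then show ?thesis using False by simp
  qed
  have "(\<Sum>r\<in>I - {i, j}. g r (swap i j \<pi> r)) = (\<Sum>r\<in>I - {i, j}. g r (\<pi> r))"
    by (intro sum.cong) auto
  then show ?thesis by (simp add: split xdiff_def)
qed

text \<open>
  At most \<open>4 * card I\<close> index pairs meet \<open>{r, s}\<close>, and each of their summands moves by at most \<open>2 * M\<close>.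
\<close>

lemma quad_stat_swap:
  assumes fin: "finite I" and r: "r \<in> I" and s: "s \<in> I" and \<pi>: "\<pi> permutes I"
    and bd: "\<And>i j k l. i \<in> I \<Longrightarrow> j \<in> I \<Longrightarrow> k \<in> I \<Longrightarrow> l \<in> I \<Longrightarrow> \<bar>\<psi> i j k l\<bar> \<le> M"
  shows "\<bar>(\<Sum>i\<in>I. \<Sum>j\<in>I. \<psi> i j (swap r s \<pi> i) (swap r s \<pi> j)) - (\<Sum>i\<in>I. \<Sum>j\<in>I. \<psi> i j (\<pi> i) (\<pi> j :: 'a))\<bar>
    \<le> 8 * M * real (card I)"
proof -
  let ?\<rho> = "swap r s \<pi>"
  let ?u = "\<lambda>i. of_bool (i \<in> {r, s}) :: real"
  have M: "M \<ge> 0" using bd[OF r r r r] by linarith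
  have \<rho>: "?\<rho> permutes I" by (rule permutes_swap[OF \<pi> r s])
  have in\<pi>: "\<pi> i \<in> I" "?\<rho> i \<in> I" if "i \<in> I" for i
    using permutes_in_image[OF \<pi>] permutes_in_image[OF \<rho>] that by auto
  have summand: "\<bar>\<psi> i j (?\<rho> i) (?\<rho> j) - \<psi> i j (\<pi> i) (\<pi> j)\<bar> \<le> 2 * M * (?u i + ?u j)"
    if "i \<in> I" "j \<in> I" for i j
  proof (cases "i \<in> {r, s} \<or> j \<in> {r, s}")
    case True
    have "\<bar>\<psi> i j (?\<rho> i) (?\<rho> j)\<bar> \<le> M" "\<bar>\<psi> i j (\<pi> i) (\<pi> j)\<bar> \<le> M"
      using bd in\<pi> that by blast+
    then have "\<bar>\<psi> i j (?\<rho> i) (?\<rho> j) - \<psi> i j (\<pi> i) (\<pi> j)\<bar> \<le> 2 * M" by linarith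
    also have "\<dots> \<le> 2 * M * (?u i + ?u j)"
      using True M mult_left_mono[of 1 "?u i + ?u j" "2 * M"] by auto
    finally show ?thesis .
  next
    case False
    then show ?thesis by auto
  qed
  have card2: "(\<Sum>i\<in>I. ?u i) \<le> 2"
  proof -
    have "(\<Sum>i\<in>I. ?u i) \<le> (\<Sum>i\<in>I. (if i = r then 1 else 0) + (if i = s then 1 else 0))"
      by (intro sum_mono) auto
    also have "\<dots> = 2" using fin r s by (simp add: sum.distrib)
    finally show ?thesis .
  qed
  have "\<bar>(\<Sum>i\<in>I. \<Sum>j\<in>I. \<psi> i j (?\<rho> i) (?\<rho> j)) - (\<Sum>i\<in>I. \<Sum>j\<in>I. \<psi> i j (\<pi> i) (\<pi> j))\<bar>
      = \<bar>\<Sum>i\<in>I. \<Sum>j\<in>I. \<psi> i j (?\<rho> i) (?\<rho> j) - \<psi> i j (\<pi> i) (\<pi> j)\<bar>"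
    by (simp only: sum_subtractf)
  also have "\<dots> \<le> (\<Sum>i\<in>I. \<Sum>j\<in>I. \<bar>\<psi> i j (?\<rho> i) (?\<rho> j) - \<psi> i j (\<pi> i) (\<pi> j)\<bar>)"
    by (rule order_trans[OF sum_abs]) (intro sum_mono sum_abs)
  also have "\<dots> \<le> (\<Sum>i\<in>I. \<Sum>j\<in>I. 2 * M * (?u i + ?u j))"
    by (intro sum_mono summand)
  also have "\<dots> = 2 * M * (2 * real (card I) * (\<Sum>i\<in>I. ?u i))"
    by (simp only: sum_distrib_left[symmetric] sum.distrib sum_constant) (simp add: sum_distrib_left[symmetric] algebra_simps)
  also have "\<dots> \<le> 2 * M * (2 * real (card I) * 2)"
    by (intro mult_left_mono card2) (use M in auto)
  finally show ?thesis by simp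
qed

section \<open>Influence of one prescribed value\<close>

text \<open>
  The ratio condition forces every weight to be at least \<open>1 / (R * card K)\<close>.  Both mixtures
  therefore contain the uniform mixture with total mass \<open>1 / R\<close>, which cancels in the difference;
  only the remaining mass can feel the spread of \<open>e\<close>.
\<close>

lemma mixture_gap_one_sided:
  fixes p q e :: "'k \<Rightarrow> real"
  assumes K: "finite K" "K \<noteq> {}" and p1: "sum p K = 1" and q1: "sum q K = 1" and R: "R > 0"
    and p: "\<And>k k'. k \<in> K \<Longrightarrow> k' \<in> K \<Longrightarrow> p k \<le> R * p k'"
    and q: "\<And>k k'. k \<in> K \<Longrightarrow> k' \<in> K \<Longrightarrow> q k \<le> R * q k'"
    and e: "\<And>k k'. k \<in> K \<Longrightarrow> k' \<in> K \<Longrightarrow> e k - e k' \<le> D"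
  shows "(\<Sum>k\<in>K. p k * e k) - (\<Sum>k\<in>K. q k * e k) \<le> (1 - 1 / R) * D"
proof -
  define \<alpha> where "\<alpha> = 1 / (R * real (card K))"
  have cK: "real (card K) > 0" using K by (simp add: card_gt_0_iff)
  have low: "s k \<ge> \<alpha>" if s1: "sum s K = 1" and s: "\<And>k k'. k \<in> K \<Longrightarrow> k' \<in> K \<Longrightarrow> s k \<le> R * s k'" and k: "k \<in> K"
    for s :: "'k \<Rightarrow> real" and k
  proof -
    have "1 \<le> (\<Sum>k'\<in>K. R * s k)" unfolding s1[symmetric] by (intro sum_mono s k)
    then show ?thesis using R cK by (simp add: \<alpha>_def field_simps)
  qed
  define l where "l = Min (e ` K)"
  have "l \<in> e ` K" unfolding l_def using K by (intro Min_in) auto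
  then obtain k0 where k0: "k0 \<in> K" "l = e k0" by blast
  have l: "l \<le> e k" "e k - l \<le> D" if "k \<in> K" for k
    using Min_le[of "e ` K" "e k"] K that e[OF that k0(1)] k0(2) unfolding l_def by auto
  have "(\<Sum>k\<in>K. p k * e k) - (\<Sum>k\<in>K. q k * e k)
      = (\<Sum>k\<in>K. p k * e k) - l * sum p K - ((\<Sum>k\<in>K. q k * e k) - l * sum q K)"
    by (simp add: p1 q1)
  also have "\<dots> = (\<Sum>k\<in>K. (p k - \<alpha>) * (e k - l)) - (\<Sum>k\<in>K. (q k - \<alpha>) * (e k - l))"
    by (simp add: algebra_simps sum.distrib sum_subtractf sum_distrib_left)
  also have "\<dots> \<le> (\<Sum>k\<in>K. (p k - \<alpha>) * D) - 0"
    by (intro diff_mono sum_mono mult_left_mono sum_nonneg mult_nonneg_nonneg)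
       (use l low[OF p1 p] low[OF q1 q] in auto)
  also have "\<dots> = (1 - \<alpha> * real (card K)) * D"
    by (simp add: sum_distrib_right[symmetric] sum_subtractf p1)
  also have "\<alpha> * real (card K) = 1 / R" using cK by (simp add: \<alpha>_def)
  finally show ?thesis .
qed

lemma mixture_gap:
  fixes p q e e' :: "'k \<Rightarrow> real"
  assumes K: "finite K" "K \<noteq> {}" and p1: "sum p K = 1" and q1: "sum q K = 1" and R: "R > 0"
    and p0: "\<And>k. k \<in> K \<Longrightarrow> p k \<ge> 0"
    and p: "\<And>k k'. k \<in> K \<Longrightarrow> k' \<in> K \<Longrightarrow> p k \<le> R * p k'"
    and q: "\<And>k k'. k \<in> K \<Longrightarrow> k' \<in> K \<Longrightarrow> q k \<le> R * q k'"
    and e: "\<And>k k'. k \<in> K \<Longrightarrow> k' \<in> K \<Longrightarrow> \<bar>e k - e k'\<bar> \<le> D"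
    and e': "\<And>k. k \<in> K \<Longrightarrow> \<bar>e' k - e k\<bar> \<le> c"
  shows "\<bar>(\<Sum>k\<in>K. p k * e' k) - (\<Sum>k\<in>K. q k * e k)\<bar> \<le> c + (1 - 1 / R) * D"
proof -
  have D: "e k - e k' \<le> D" if "k \<in> K" "k' \<in> K" for k k' using e[OF that] by linarith
  have "(\<Sum>k\<in>K. p k * e k) - (\<Sum>k\<in>K. q k * e k) \<le> (1 - 1 / R) * D"
    "(\<Sum>k\<in>K. q k * e k) - (\<Sum>k\<in>K. p k * e k) \<le> (1 - 1 / R) * D"
    using mixture_gap_one_sided[OF K p1 q1 R p q D] mixture_gap_one_sided[OF K q1 p1 R q p D] by auto
  moreover have "\<bar>(\<Sum>k\<in>K. p k * e' k) - (\<Sum>k\<in>K. p k * e k)\<bar> \<le> c"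
  proof -
    have "\<bar>(\<Sum>k\<in>K. p k * e' k) - (\<Sum>k\<in>K. p k * e k)\<bar> = \<bar>\<Sum>k\<in>K. p k * (e' k - e k)\<bar>"
      by (simp add: sum_subtractf algebra_simps)
    also have "\<dots> \<le> (\<Sum>k\<in>K. p k * c)"
      by (rule order_trans[OF sum_abs], rule sum_mono) (simp add: abs_mult p0 e' mult_left_mono)
    also have "\<dots> = c" by (simp add: sum_distrib_right[symmetric] p1)
    finally show ?thesis .
  qed
  ultimately show ?thesis by linarith
qed

text \<open>
  Gibbs weights \<open>exp (\<Sum>i. g i (\<pi> i))\<close> on the permutations of a finite set.  The matrix \<open>g\<close> is the
  parameter in the application; \<open>g = 0\<close> is the uniform law.
\<close>

locale perm_weights =
  fixes I :: "'a set" and g :: "'a \<Rightarrow> 'a \<Rightarrow> real" and B :: real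
  assumes fin: "finite I" and ne: "I \<noteq> {}"
    and bound: "\<And>i k. i \<in> I \<Longrightarrow> k \<in> I \<Longrightarrow> \<bar>g i k\<bar> \<le> B"
begin

definition wt :: "('a \<Rightarrow> 'a) \<Rightarrow> real" where "wt \<pi> = exp (lin_stat I g \<pi>)"

definition W :: "('a \<Rightarrow> 'a) set \<Rightarrow> real" where "W S = (\<Sum>\<pi>\<in>S. wt \<pi>)"

definition mean :: "('a \<Rightarrow> 'a) set \<Rightarrow> (('a \<Rightarrow> 'a) \<Rightarrow> real) \<Rightarrow> real" where
  "mean S G = (\<Sum>\<pi>\<in>S. wt \<pi> * G \<pi>) / W S"

text \<open>
  A transposition changes a weight at most by this factor (lemma \<open>wt_swap_le\<close>).
\<close>

definition R :: real where "R = exp (4 * B)"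

definition perms :: "('a \<Rightarrow> 'a) set" where "perms = {\<pi>. \<pi> permutes I}"

text \<open>
  The prescribed entries are a set of pairs (position, value) rather than a partial map, so that
  rows and columns of the permutation matrix are treated alike.
\<close>

definition cyl :: "('a \<times> 'a) set \<Rightarrow> ('a \<Rightarrow> 'a) set" where
  "cyl C = {\<pi>. \<pi> permutes I \<and> (\<forall>(i, k)\<in>C. \<pi> i = k)}"

definition lip :: "(('a \<Rightarrow> 'a) \<Rightarrow> real) \<Rightarrow> real \<Rightarrow> bool" where
  "lip G c \<longleftrightarrow> (\<forall>\<pi> i j. \<pi> permutes I \<longrightarrow> i \<in> I \<longrightarrow> j \<in> I \<longrightarrow> \<bar>G (swap i j \<pi>) - G \<pi>\<bar> \<le> c)"

lemma finite_perms: "finite perms" by (simp add: perms_def finite_permutations fin)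
lemma id_perms: "id \<in> perms" by (simp add: perms_def permutes_id)
lemma cyl_sub: "cyl C \<subseteq> perms" by (auto simp: cyl_def perms_def)
lemma cyl_empty: "cyl {} = perms" by (auto simp: cyl_def perms_def)
lemma finite_cyl: "finite (cyl C)" using cyl_sub finite_perms finite_subset by blast
lemma finite_sub: "S \<subseteq> perms \<Longrightarrow> finite S" using finite_perms finite_subset by blast

lemma perms_in: "\<pi> \<in> perms \<Longrightarrow> i \<in> I \<Longrightarrow> \<pi> i \<in> I"
  by (simp add: perms_def permutes_in_image)

lemma swap_perms: "\<pi> \<in> perms \<Longrightarrow> i \<in> I \<Longrightarrow> j \<in> I \<Longrightarrow> swap i j \<pi> \<in> perms"
  by (simp add: perms_def permutes_swap)

lemma B0: "B \<ge> 0" using ne bound by fastforce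
lemma R1: "R \<ge> 1" using B0 by (simp add: R_def)
lemma R0: "R > 0" by (simp add: R_def)

lemma wt_pos: "wt \<pi> > 0" by (simp add: wt_def)

lemma W_pos: "S \<subseteq> perms \<Longrightarrow> S \<noteq> {} \<Longrightarrow> W S > 0"
  unfolding W_def using finite_sub wt_pos by (intro sum_pos) auto

lemma xdiff_bound: "i \<in> I \<Longrightarrow> j \<in> I \<Longrightarrow> k \<in> I \<Longrightarrow> l \<in> I \<Longrightarrow> \<bar>xdiff g i j k l\<bar> \<le> 4 * B"
  using bound[of i k] bound[of j l] bound[of i l] bound[of j k] by (simp add: xdiff_def)

lemma wt_swap: "i \<in> I \<Longrightarrow> j \<in> I \<Longrightarrow> wt (swap i j \<pi>) = exp (- xdiff g i j (\<pi> i) (\<pi> j)) * wt \<pi>"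
  by (simp add: wt_def lin_stat_swap[OF fin] exp_diff exp_minus field_simps)

lemma wt_swap_le:
  assumes "\<pi> \<in> perms" "i \<in> I" "j \<in> I"
  shows "wt \<pi> \<le> R * wt (swap i j \<pi>)"
proof -
  have "1 \<le> R * exp (- xdiff g i j (\<pi> i) (\<pi> j))"
    unfolding R_def exp_add[symmetric]
    using xdiff_bound[of i j "\<pi> i" "\<pi> j"] assms perms_in by fastforce
  then show ?thesis
    using mult_right_mono[of 1 "R * exp (- xdiff g i j (\<pi> i) (\<pi> j))" "wt \<pi>"] wt_pos[of \<pi>] assms
    by (simp add: wt_swap mult.assoc)
qed

text \<open>
  Exchanging two values is exchanging the positions that carry them, so the bounds for \<open>swap\<close> also
  apply to compositions from the left.
\<close>

lemma left_swap_eq: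
  assumes "\<pi> \<in> perms" "k \<in> I" "l \<in> I"
  obtains i j where "i \<in> I" "j \<in> I" "Transposition.transpose k l \<circ> \<pi> = swap i j \<pi>"
proof -
  have p: "\<pi> permutes I" using assms by (simp add: perms_def)
  have "inv \<pi> k \<in> I" "inv \<pi> l \<in> I"
    using permutes_in_image[OF permutes_inv[OF p]] assms by auto
  moreover have "Transposition.transpose k l \<circ> \<pi> = swap (inv \<pi> k) (inv \<pi> l) \<pi>"
    using transpose_comp_eq[OF permutes_bij[OF p], of k l] permutes_inverses[OF p]
    by (auto simp: fun_eq_iff Transposition.transpose_def)
  ultimately show ?thesis using that by blast
qed

lemma W_le_by_injection:
  assumes "S' \<subseteq> perms" "inj_on \<rho> S" "\<rho> ` S \<subseteq> S'" "\<And>\<pi>. \<pi> \<in> S \<Longrightarrow> wt \<pi> \<le> r * wt (\<rho> \<pi>)" "r \<ge> 0"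
  shows "W S \<le> r * W S'"
proof -
  have "W S \<le> (\<Sum>\<pi>\<in>S. r * wt (\<rho> \<pi>))" unfolding W_def by (intro sum_mono assms)
  also have "\<dots> = r * (\<Sum>\<pi>\<in>\<rho> ` S. wt \<pi>)"
    by (simp add: sum.reindex[OF assms(2)] sum_distrib_left)
  also have "\<dots> \<le> r * W S'"
    unfolding W_def using assms(5) finite_sub[OF assms(1)] wt_pos
    by (intro mult_left_mono sum_mono2 assms) (auto simp: less_imp_le)
  finally show ?thesis .
qed

lemma mean_const: "S \<subseteq> perms \<Longrightarrow> S \<noteq> {} \<Longrightarrow> mean S (\<lambda>_. c) = c"
  using W_pos[of S] by (simp add: mean_def W_def sum_distrib_right[symmetric])

lemma mean_add: "mean S (\<lambda>\<pi>. G \<pi> + H \<pi>) = mean S G + mean S H"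
  by (simp add: mean_def distrib_left sum.distrib add_divide_distrib)

lemma mean_cmult: "mean S (\<lambda>\<pi>. c * G \<pi>) = c * mean S G"
  by (simp add: mean_def sum_distrib_left mult.left_commute)

lemma mean_diff: "mean S (\<lambda>\<pi>. G \<pi> - H \<pi>) = mean S G - mean S H"
  by (simp add: mean_def right_diff_distrib sum_subtractf diff_divide_distrib)

lemma mean_sum: "mean S (\<lambda>\<pi>. \<Sum>i\<in>A. G i \<pi>) = (\<Sum>i\<in>A. mean S (G i))"
  unfolding mean_def sum_distrib_left sum_divide_distrib by (subst sum.swap) simp

lemma mean_mono: "S \<subseteq> perms \<Longrightarrow> (\<And>\<pi>. \<pi> \<in> S \<Longrightarrow> G \<pi> \<le> H \<pi>) \<Longrightarrow> mean S G \<le> mean S H"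
  unfolding mean_def W_def by (intro divide_right_mono sum_mono mult_left_mono sum_nonneg) (auto simp: wt_pos less_imp_le)

lemma mean_cong: "(\<And>\<pi>. \<pi> \<in> S \<Longrightarrow> G \<pi> = H \<pi>) \<Longrightarrow> mean S G = mean S H"
  unfolding mean_def by (intro arg_cong2[where f="(/)"] sum.cong) auto

lemma mean_abs_diff:
  assumes "S \<subseteq> perms" "S \<noteq> {}" "\<And>\<pi>. \<pi> \<in> S \<Longrightarrow> \<bar>G \<pi> - H \<pi>\<bar> \<le> c"
  shows "\<bar>mean S G - mean S H\<bar> \<le> c"
proof -
  have "mean S (\<lambda>\<pi>. G \<pi> - H \<pi>) \<le> mean S (\<lambda>_. c)" "mean S (\<lambda>_. -c) \<le> mean S (\<lambda>\<pi>. G \<pi> - H \<pi>)"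
    using assms by (intro mean_mono; force)+
  then show ?thesis by (simp add: mean_diff mean_const assms)
qed

lemma mean_UNION:
  assumes "finite K" "\<And>k. k \<in> K \<Longrightarrow> P k \<subseteq> perms" "\<And>k. k \<in> K \<Longrightarrow> P k \<noteq> {}"
    "\<And>k k'. k \<in> K \<Longrightarrow> k' \<in> K \<Longrightarrow> k \<noteq> k' \<Longrightarrow> P k \<inter> P k' = {}"
  shows "mean (\<Union>k\<in>K. P k) G = (\<Sum>k\<in>K. W (P k) / W (\<Union>k\<in>K. P k) * mean (P k) G)"
    and "K \<noteq> {} \<Longrightarrow> (\<Sum>k\<in>K. W (P k) / W (\<Union>k\<in>K. P k)) = 1"
proof -
  have f: "\<forall>k\<in>K. finite (P k)" using assms finite_sub by blast
  have "(\<Sum>\<pi>\<in>(\<Union>k\<in>K. P k). wt \<pi> * G \<pi>) = (\<Sum>k\<in>K. \<Sum>\<pi>\<in>P k. wt \<pi> * G \<pi>)"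
    using assms f by (intro sum.UNION_disjoint) auto
  also have "\<dots> = (\<Sum>k\<in>K. W (P k) * mean (P k) G)"
    using W_pos[OF assms(2,3)] by (intro sum.cong) (force simp: mean_def)+
  finally show "mean (\<Union>k\<in>K. P k) G = (\<Sum>k\<in>K. W (P k) / W (\<Union>k\<in>K. P k) * mean (P k) G)"
    unfolding mean_def by (simp add: sum_divide_distrib)
  have "W (\<Union>k\<in>K. P k) = (\<Sum>k\<in>K. W (P k))"
    unfolding W_def using assms f by (intro sum.UNION_disjoint) auto
  moreover have "W (\<Union>k\<in>K. P k) > 0" if "K \<noteq> {}" using that assms(2,3) by (intro W_pos) auto
  ultimately show "(\<Sum>k\<in>K. W (P k) / W (\<Union>k\<in>K. P k)) = 1" if "K \<noteq> {}"
    using that by (simp add: sum_divide_distrib[symmetric])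
qed

text \<open>
  On \<open>P k\<close> the values at the two exchanged positions are fixed, so the transposition multiplies all
  weights of \<open>P k\<close> by one and the same factor.  It therefore carries the conditional law on \<open>P k\<close> to
  the one on \<open>Q k\<close>, and the two conditional means of \<open>G\<close> differ by at most \<open>c\<close>.  What remains is a
  comparison of two mixtures with comparable weights.
\<close>

lemma swapped_families:
  assumes K: "finite K" "K \<noteq> {}"
    and P: "\<And>k. k \<in> K \<Longrightarrow> P k \<subseteq> perms" "\<And>k. k \<in> K \<Longrightarrow> P k \<noteq> {}"
      "\<And>k k'. k \<in> K \<Longrightarrow> k' \<in> K \<Longrightarrow> k \<noteq> k' \<Longrightarrow> P k \<inter> P k' = {}"
      "\<And>k k'. k \<in> K \<Longrightarrow> k' \<in> K \<Longrightarrow> W (P k) \<le> R * W (P k')"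
    and Q: "\<And>k. k \<in> K \<Longrightarrow> Q k = swap (i k) (j k) ` P k"
      "\<And>k k'. k \<in> K \<Longrightarrow> k' \<in> K \<Longrightarrow> k \<noteq> k' \<Longrightarrow> Q k \<inter> Q k' = {}"
      "\<And>k k'. k \<in> K \<Longrightarrow> k' \<in> K \<Longrightarrow> W (Q k) \<le> R * W (Q k')"
      "\<And>k k'. k \<in> K \<Longrightarrow> k' \<in> K \<Longrightarrow> \<bar>mean (Q k) G - mean (Q k') G\<bar> \<le> D"
    and ij: "\<And>k. k \<in> K \<Longrightarrow> i k \<in> I" "\<And>k. k \<in> K \<Longrightarrow> j k \<in> I"
    and val: "\<And>k \<pi>. k \<in> K \<Longrightarrow> \<pi> \<in> P k \<Longrightarrow> \<pi> (i k) = a k" "\<And>k \<pi>. k \<in> K \<Longrightarrow> \<pi> \<in> P k \<Longrightarrow> \<pi> (j k) = b k"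
    and G: "lip G c"
  shows "\<bar>mean (\<Union>k\<in>K. P k) G - mean (\<Union>k\<in>K. Q k) G\<bar> \<le> c + (1 - 1 / R) * D"
proof -
  have Qs: "Q k \<subseteq> perms" "Q k \<noteq> {}" if "k \<in> K" for k
    using Q(1)[OF that] P(1,2)[OF that] swap_perms ij[OF that] by auto
  have meanQ: "mean (Q k) G = mean (P k) (\<lambda>\<pi>. G (swap (i k) (j k) \<pi>))" if k: "k \<in> K" for k
  proof -
    let ?c = "exp (- xdiff g (i k) (j k) (a k) (b k))"
    have w: "wt (swap (i k) (j k) \<pi>) = ?c * wt \<pi>" if "\<pi> \<in> P k" for \<pi>
      using wt_swap[OF ij[OF k]] val[OF k that] by simp
    have "W (Q k) = ?c * W (P k)"
      unfolding W_def Q(1)[OF k] sum_distrib_left by (subst sum.reindex[OF inj_swap]) (simp add: w)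
    moreover have "(\<Sum>\<pi>\<in>Q k. wt \<pi> * G \<pi>) = ?c * (\<Sum>\<pi>\<in>P k. wt \<pi> * G (swap (i k) (j k) \<pi>))"
      unfolding Q(1)[OF k] sum_distrib_left by (subst sum.reindex[OF inj_swap]) (simp add: w mult.assoc)
    ultimately show ?thesis by (simp add: mean_def)
  qed
  have e': "\<bar>mean (P k) G - mean (Q k) G\<bar> \<le> c" if k: "k \<in> K" for k
    unfolding meanQ[OF k]
  proof (rule mean_abs_diff[OF P(1,2)[OF k]])
    fix \<pi> assume "\<pi> \<in> P k"
    then have "\<pi> permutes I" using P(1)[OF k] by (auto simp: perms_def)
    then show "\<bar>G \<pi> - G (swap (i k) (j k) \<pi>)\<bar> \<le> c"
      using G ij[OF k] unfolding lip_def by (metis abs_minus_commute)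
  qed
  have WP: "W (\<Union>k\<in>K. P k) > 0" using K P(1,2) by (intro W_pos) auto
  have WQ: "W (\<Union>k\<in>K. Q k) > 0" using K Qs by (intro W_pos; fastforce)
  have eqP: "mean (\<Union>k\<in>K. P k) G = (\<Sum>k\<in>K. W (P k) / W (\<Union>k\<in>K. P k) * mean (P k) G)"
    by (rule mean_UNION(1)[OF K(1) P(1,2,3)])
  have eqQ: "mean (\<Union>k\<in>K. Q k) G = (\<Sum>k\<in>K. W (Q k) / W (\<Union>k\<in>K. Q k) * mean (Q k) G)"
    by (rule mean_UNION(1)[OF K(1) Qs Q(2)])
  show ?thesis
    unfolding eqP eqQ
  proof (rule mixture_gap[OF K _ _ R0])
    show "(\<Sum>k\<in>K. W (P k) / W (\<Union> (P ` K))) = 1" by (rule mean_UNION(2)[OF K(1) P(1,2,3) K(2)])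
    show "(\<Sum>k\<in>K. W (Q k) / W (\<Union> (Q ` K))) = 1" by (rule mean_UNION(2)[OF K(1) Qs Q(2) K(2)])
    show "0 \<le> W (P k) / W (\<Union> (P ` K))" if "k \<in> K" for k
      using W_pos[OF P(1,2)[OF that]] WP by simp
    show "W (P k) / W (\<Union> (P ` K)) \<le> R * (W (P k') / W (\<Union> (P ` K)))" if "k \<in> K" "k' \<in> K" for k k'
      using divide_right_mono[OF P(4)[OF that], of "W (\<Union> (P ` K))"] WP by simp
    show "W (Q k) / W (\<Union> (Q ` K)) \<le> R * (W (Q k') / W (\<Union> (Q ` K)))" if "k \<in> K" "k' \<in> K" for k k'
      using divide_right_mono[OF Q(3)[OF that], of "W (\<Union> (Q ` K))"] WQ by simp
  qed (use Q(4) e' in auto)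
qed

lemma cyl_perms: "\<pi> \<in> cyl C \<Longrightarrow> \<pi> \<in> perms" using cyl_sub by blast

lemma cyl_insert: "cyl (insert (i, k) C) = {\<pi> \<in> cyl C. \<pi> i = k}"
  by (auto simp: cyl_def)

lemma cylD: "\<pi> \<in> cyl C \<Longrightarrow> (i, k) \<in> C \<Longrightarrow> \<pi> i = k"
  by (auto simp: cyl_def)

lemma cyl_swap:
  assumes "\<pi> \<in> cyl C" "i \<in> I" "j \<in> I" "i \<notin> fst ` C" "j \<notin> fst ` C"
  shows "swap i j \<pi> \<in> cyl C"
proof -
  have "swap i j \<pi> r = k" if rk: "(r, k) \<in> C" for r k
  proof -
    have "r \<noteq> i" "r \<noteq> j" using rk assms(4,5) by force+
    then show ?thesis using cylD[OF assms(1) rk] by simp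
  qed
  moreover have "swap i j \<pi> permutes I" using swap_perms[OF cyl_perms] assms by (auto simp: perms_def)
  ultimately show ?thesis unfolding cyl_def by blast
qed

lemma cyl_left_swap:
  assumes "\<pi> \<in> cyl C" "k \<in> I" "l \<in> I" "k \<notin> snd ` C" "l \<notin> snd ` C"
  shows "Transposition.transpose k l \<circ> \<pi> \<in> cyl C"
proof -
  have "(Transposition.transpose k l \<circ> \<pi>) r = m" if rk: "(r, m) \<in> C" for r m
  proof -
    have "m \<noteq> k" "m \<noteq> l" using rk assms(4,5) by force+
    then show ?thesis using cylD[OF assms(1) rk] by simp
  qed
  moreover have "Transposition.transpose k l \<circ> \<pi> permutes I"
    using assms by (intro permutes_compose[of \<pi> I] permutes_swap_id) (auto simp: cyl_def)
  ultimately show ?thesis unfolding cyl_def by blast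
qed

lemma W_cyl_swap_le:
  assumes C: "S \<subseteq> perms" "S' \<subseteq> perms" and ij: "i \<in> I" "j \<in> I"
    and S: "\<And>\<pi>. \<pi> \<in> S \<Longrightarrow> swap i j \<pi> \<in> S'"
  shows "W S \<le> R * W S'"
  by (rule W_le_by_injection[where \<rho> = "swap i j"]) (use assms inj_swap wt_swap_le R0 in auto)

lemma W_cyl_left_swap_le:
  assumes C: "S \<subseteq> perms" "S' \<subseteq> perms" and kl: "k \<in> I" "l \<in> I"
    and S: "\<And>\<pi>. \<pi> \<in> S \<Longrightarrow> Transposition.transpose k l \<circ> \<pi> \<in> S'"
  shows "W S \<le> R * W S'"
proof (rule W_le_by_injection[where \<rho> = "\<lambda>\<pi>. Transposition.transpose k l \<circ> \<pi>"])
  show "inj_on (\<lambda>\<pi>. Transposition.transpose k l \<circ> \<pi>) S"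
    by (rule inj_onI) (metis comp_assoc id_comp transpose_comp_involutory)
  show "wt \<pi> \<le> R * wt (Transposition.transpose k l \<circ> \<pi>)" if \<pi>: "\<pi> \<in> S" for \<pi>
  proof -
    have "\<pi> \<in> perms" using \<pi> C by blast
    then obtain i j where "i \<in> I" "j \<in> I" "Transposition.transpose k l \<circ> \<pi> = swap i j \<pi>"
      using left_swap_eq[OF _ kl] by blast
    then show ?thesis using wt_swap_le[OF \<open>\<pi> \<in> perms\<close>] by simp
  qed
qed (use assms R0 in auto)

lemma perms_inj: "\<pi> \<in> perms \<Longrightarrow> \<pi> i = \<pi> j \<Longrightarrow> i = j"
  using permutes_inj unfolding perms_def by (blast dest: injD)

lemma perms_surj: "\<pi> \<in> perms \<Longrightarrow> k \<in> I \<Longrightarrow> \<exists>i\<in>I. \<pi> i = k"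
  using permutes_image[of \<pi> I] unfolding perms_def by (force simp: image_iff)

text \<open>
  Two prescriptions \<open>\<pi> i = a\<close> and \<open>\<pi> i = b\<close> are coupled by splitting the first according to the
  position \<open>k\<close> that carries \<open>b\<close>, and the second according to the position \<open>k\<close> that carries \<open>a\<close>.  The
  transposition of \<open>i\<close> and \<open>k\<close> exchanges corresponding pieces, so \<open>swapped_families\<close> applies.  The
  pieces of the second family differ among themselves in the position of one value, given
  \<open>\<pi> i = b\<close>; this is the second conjunct for a smaller cylinder.  The second conjunct is reduced to the
  first one in the same way, with positions and values interchanged, so both go through one
  induction.  The bound \<open>R * c\<close> is the fixed point of \<open>D \<mapsto> c + (1 - 1 / R) * D\<close>, which
  is what makes it independent of the number of steps.
\<close>

lemma cyl_mean_gap: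
  assumes G: "lip G c"
  shows "(\<forall>i a b. cyl (insert (i, a) C) \<noteq> {} \<longrightarrow> cyl (insert (i, b) C) \<noteq> {} \<longrightarrow>
           \<bar>mean (cyl (insert (i, a) C)) G - mean (cyl (insert (i, b) C)) G\<bar> \<le> R * c) \<and>
         (\<forall>i j a. cyl (insert (i, a) C) \<noteq> {} \<longrightarrow> cyl (insert (j, a) C) \<noteq> {} \<longrightarrow>
           \<bar>mean (cyl (insert (i, a) C)) G - mean (cyl (insert (j, a) C)) G\<bar> \<le> R * c)"
proof (induction "card (cyl C)" arbitrary: C rule: less_induct)
  case less
  obtain i0 where "i0 \<in> I" using ne by blast
  then have "\<bar>G (swap i0 i0 id) - G id\<bar> \<le> c" using G id_perms unfolding lip_def perms_def by blast
  then have "c \<ge> 0" by linarith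
  then have D0: "0 \<le> R * c" using R0 by simp
  have Rc: "c + (1 - 1 / R) * (R * c) = R * c" using R0 by (simp add: field_simps)
  have smaller: "card (cyl (insert x C)) < card (cyl C)"
    if "cyl (insert y C) \<noteq> {}" "cyl (insert x C) \<inter> cyl (insert y C) = {}" for x y
  proof (rule psubset_card_mono[OF finite_cyl])
    have "cyl (insert x C) \<subseteq> cyl C" "cyl (insert y C) \<subseteq> cyl C" by (auto simp: cyl_def)
    then show "cyl (insert x C) \<subset> cyl C" using that by blast
  qed
  have in_I: "i \<in> I \<longleftrightarrow> a \<in> I" if "cyl (insert (i, a) C) \<noteq> {}" for i a
    using that permutes_in_image by (fastforce simp: cyl_def)
  have out_I: "i = a" if "cyl (insert (i, a) C) \<noteq> {}" "i \<notin> I" for i a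
    using that by (auto simp: cyl_def permutes_def)
  show ?case
  proof (intro conjI allI impI)
    fix i a b assume nea: "cyl (insert (i, a) C) \<noteq> {}" and neb: "cyl (insert (i, b) C) \<noteq> {}"
    show "\<bar>mean (cyl (insert (i, a) C)) G - mean (cyl (insert (i, b) C)) G\<bar> \<le> R * c"
    proof (cases "a = b")
      case True
      then show ?thesis using D0 by simp
    next
      case False
      then have i: "i \<in> I" using out_I[OF nea] out_I[OF neb] by blast
      then have ab: "a \<in> I" "b \<in> I" using in_I[OF nea] in_I[OF neb] by auto
      have iC: "i \<notin> fst ` C" using nea neb False by (force simp: cyl_insert dest: cylD)
      define K where "K = {k \<in> I. k \<noteq> i \<and> k \<notin> fst ` C}"
      define P where "P k = cyl (insert (k, b) (insert (i, a) C))" for k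
      define Q where "Q k = cyl (insert (k, a) (insert (i, b) C))" for k
      have U: "cyl (insert (i, x) C) = (\<Union>k\<in>K. cyl (insert (k, y) (insert (i, x) C)))"
        if y: "cyl (insert (i, y) C) \<noteq> {}" "y \<in> I" "x \<noteq> y" for x y
      proof (intro equalityI subsetI)
        fix \<pi> assume \<pi>: "\<pi> \<in> cyl (insert (i, x) C)"
        then obtain k where k: "k \<in> I" "\<pi> k = y" using perms_surj[OF cyl_perms] y by blast
        have "k \<noteq> i" using \<pi> k y by (auto simp: cyl_insert)
        moreover have "k \<notin> fst ` C"
        proof
          assume "k \<in> fst ` C"
          then obtain z where z: "(k, z) \<in> C" by auto
          then have "z = y" using \<pi> k cylD[of \<pi> C k z] by (auto simp: cyl_insert)
          obtain \<rho> where \<rho>: "\<rho> \<in> cyl C" "\<rho> i = y" using y by (auto simp: cyl_insert)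
          then have "\<rho> k = y" using z \<open>z = y\<close> cylD by blast
          then show False using \<rho> perms_inj[OF cyl_perms[OF \<rho>(1)], of i k] \<open>k \<noteq> i\<close> by simp
        qed
        ultimately show "\<pi> \<in> (\<Union>k\<in>K. cyl (insert (k, y) (insert (i, x) C)))"
          using k \<pi> by (auto simp: K_def cyl_insert)
      qed (auto simp: cyl_insert)
      have UP: "cyl (insert (i, a) C) = (\<Union>k\<in>K. P k)"
        unfolding P_def by (rule U) (use neb ab False in auto)
      have UQ: "cyl (insert (i, b) C) = (\<Union>k\<in>K. Q k)"
        unfolding Q_def by (rule U) (use nea ab False in auto)
      have disj: "cyl (insert (k, y) C') \<inter> cyl (insert (k', y) C') = {}" if "k \<noteq> k'" for k k' y C'
        using that by (auto simp: cyl_insert dest: perms_inj[OF cyl_perms])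
      have move: "swap k k' \<pi> \<in> cyl (insert (k', y) (insert (i, x) C))"
        if "\<pi> \<in> cyl (insert (k, y) (insert (i, x) C))" "k \<in> K" "k' \<in> K" for \<pi> k k' x y
        using that i iC cyl_swap[of \<pi> C k k'] by (auto simp: K_def cyl_insert)
      have QP: "Q k = swap i k ` P k" if k: "k \<in> K" for k
      proof (intro equalityI subsetI)
        fix \<pi> assume "\<pi> \<in> Q k"
        then have "swap i k \<pi> \<in> P k" unfolding P_def Q_def
          using k i iC cyl_swap[of \<pi> C i k] by (auto simp: K_def cyl_insert)
        then show "\<pi> \<in> swap i k ` P k" using swap_swap[of \<pi> i k] by (metis imageI)
      next
        fix \<pi> assume "\<pi> \<in> swap i k ` P k"
        then show "\<pi> \<in> Q k" unfolding P_def Q_def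
          using k i iC cyl_swap[of _ C i k] by (auto simp: K_def cyl_insert)
      qed
      have "\<bar>mean (\<Union>k\<in>K. P k) G - mean (\<Union>k\<in>K. Q k) G\<bar> \<le> c + (1 - 1 / R) * (R * c)"
      proof (rule swapped_families[where i = "\<lambda>_. i" and j = "\<lambda>k. k" and a = "\<lambda>_. a" and b = "\<lambda>_. b"])
        show "finite K" using fin by (simp add: K_def)
        show Kne: "K \<noteq> {}" using nea unfolding UP by auto
        show "P k \<subseteq> perms" for k unfolding P_def by (rule cyl_sub)
        show "P k \<noteq> {}" if k: "k \<in> K" for k
          using nea move[of _ _ b a k] k unfolding UP P_def by blast
        show "P k \<inter> P k' = {}" if "k \<noteq> k'" for k k' unfolding P_def by (rule disj[OF that])
        show "Q k \<inter> Q k' = {}" if "k \<noteq> k'" for k k' unfolding Q_def by (rule disj[OF that])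
        show "W (P k) \<le> R * W (P k')" if "k \<in> K" "k' \<in> K" for k k'
          unfolding P_def by (rule W_cyl_swap_le[OF cyl_sub cyl_sub, of k k']) (use that move in \<open>auto simp: K_def\<close>)
        show "W (Q k) \<le> R * W (Q k')" if "k \<in> K" "k' \<in> K" for k k'
          unfolding Q_def by (rule W_cyl_swap_le[OF cyl_sub cyl_sub, of k k']) (use that move in \<open>auto simp: K_def\<close>)
        show "\<bar>mean (Q k) G - mean (Q k') G\<bar> \<le> R * c" if k: "k \<in> K" "k' \<in> K" for k k'
        proof -
          have small: "card (cyl (insert (i, b) C)) < card (cyl C)"
            by (rule smaller[OF nea]) (use False in \<open>auto simp: cyl_insert\<close>)
          have Qne: "Q k \<noteq> {}" if k: "k \<in> K" for k
            using neb move[of _ _ a b k] k unfolding UQ Q_def by blast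
          show ?thesis using Qne[OF k(1)] Qne[OF k(2)] unfolding Q_def
            by (rule conjunct2[OF less[OF small], rule_format])
        qed
      qed (use G QP i in \<open>auto simp: P_def cyl_insert K_def\<close>)
      then show ?thesis unfolding UP UQ Rc .
    qed
  next
    fix i j a assume nei: "cyl (insert (i, a) C) \<noteq> {}" and nej: "cyl (insert (j, a) C) \<noteq> {}"
    show "\<bar>mean (cyl (insert (i, a) C)) G - mean (cyl (insert (j, a) C)) G\<bar> \<le> R * c"
    proof (cases "i = j")
      case True
      then show ?thesis using D0 by simp
    next
      case False
      then have a: "a \<in> I" using out_I[OF nei] out_I[OF nej] in_I[OF nei] in_I[OF nej] by blast
      then have ij: "i \<in> I" "j \<in> I" using in_I[OF nei] in_I[OF nej] by auto
      have aC: "a \<notin> snd ` C"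
      proof
        assume "a \<in> snd ` C"
        then obtain r where r: "(r, a) \<in> C" by auto
        obtain \<pi> \<rho> where "\<pi> \<in> cyl C" "\<pi> i = a" "\<rho> \<in> cyl C" "\<rho> j = a"
          using nei nej by (auto simp: cyl_insert)
        then have "r = i" "r = j" using cylD[OF _ r] perms_inj[OF cyl_perms] by metis+
        then show False using False by simp
      qed
      have rowC: "r \<notin> fst ` C" if r: "cyl (insert (r, a) C) \<noteq> {}" for r
      proof
        assume "r \<in> fst ` C"
        then obtain z where z: "(r, z) \<in> C" by auto
        then have "z = a" using r cylD[OF _ z] by (auto simp: cyl_insert)
        then show False using z aC by force
      qed
      define K where "K = {b \<in> I. b \<noteq> a \<and> b \<notin> snd ` C}"
      define P where "P b = cyl (insert (j, b) (insert (i, a) C))" for b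
      define Q where "Q b = cyl (insert (i, b) (insert (j, a) C))" for b
      have U: "cyl (insert (r, a) C) = (\<Union>b\<in>K. cyl (insert (s, b) (insert (r, a) C)))"
        if s: "cyl (insert (s, a) C) \<noteq> {}" "s \<in> I" "r \<noteq> s" for r s
      proof (intro equalityI subsetI)
        fix \<pi> assume \<pi>: "\<pi> \<in> cyl (insert (r, a) C)"
        have "\<pi> s \<in> I" using perms_in[OF cyl_perms[OF \<pi>]] s by blast
        moreover have "\<pi> s \<noteq> a" using \<pi> s perms_inj[OF cyl_perms[OF \<pi>]] by (auto simp: cyl_insert)
        moreover have "\<pi> s \<notin> snd ` C"
        proof
          assume "\<pi> s \<in> snd ` C"
          then obtain x where x: "(x, \<pi> s) \<in> C" by auto
          then have "\<pi> x = \<pi> s" using \<pi> cylD[of \<pi> C x "\<pi> s"] by (auto simp: cyl_insert)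
          then have "x = s" using perms_inj[OF cyl_perms[OF \<pi>]] by blast
          then show False using rowC[OF s(1)] x by force
        qed
        ultimately show "\<pi> \<in> (\<Union>b\<in>K. cyl (insert (s, b) (insert (r, a) C)))"
          using \<pi> by (auto simp: K_def cyl_insert)
      qed (auto simp: cyl_insert)
      have UP: "cyl (insert (i, a) C) = (\<Union>b\<in>K. P b)"
        unfolding P_def by (rule U) (use nej ij False in auto)
      have UQ: "cyl (insert (j, a) C) = (\<Union>b\<in>K. Q b)"
        unfolding Q_def by (rule U) (use nei ij False in auto)
      have disj: "cyl (insert (r, b) C') \<inter> cyl (insert (r, b') C') = {}" if "b \<noteq> b'" for b b' r C'
        using that by (auto simp: cyl_insert)
      have move: "Transposition.transpose b b' \<circ> \<pi> \<in> cyl (insert (r, b') (insert (s, a) C))"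
        if "\<pi> \<in> cyl (insert (r, b) (insert (s, a) C))" "b \<in> K" "b' \<in> K" for \<pi> b b' r s
        using that a aC cyl_left_swap[of \<pi> C b b'] by (auto simp: K_def cyl_insert)
      have QP: "Q b = swap i j ` P b" if b: "b \<in> K" for b
      proof (intro equalityI subsetI)
        fix \<pi> assume "\<pi> \<in> Q b"
        then have "swap i j \<pi> \<in> P b" unfolding P_def Q_def
          using b ij rowC[OF nei] rowC[OF nej] cyl_swap[of \<pi> C i j] by (auto simp: K_def cyl_insert)
        then show "\<pi> \<in> swap i j ` P b" using swap_swap[of \<pi> i j] by (metis imageI)
      next
        fix \<pi> assume "\<pi> \<in> swap i j ` P b"
        then show "\<pi> \<in> Q b" unfolding P_def Q_def
          using b ij rowC[OF nei] rowC[OF nej] cyl_swap[of _ C i j] by (auto simp: K_def cyl_insert)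
      qed
      have "\<bar>mean (\<Union>b\<in>K. P b) G - mean (\<Union>b\<in>K. Q b) G\<bar> \<le> c + (1 - 1 / R) * (R * c)"
      proof (rule swapped_families[where i = "\<lambda>_. i" and j = "\<lambda>_. j" and a = "\<lambda>_. a" and b = "\<lambda>b. b"])
        show "finite K" using fin by (simp add: K_def)
        show Kne: "K \<noteq> {}" using nei unfolding UP by auto
        show "P b \<subseteq> perms" for b unfolding P_def by (rule cyl_sub)
        show "P b \<noteq> {}" if b: "b \<in> K" for b
          using nei move[of _ j _ i b] b unfolding UP P_def by blast
        show "P b \<inter> P b' = {}" if "b \<noteq> b'" for b b' unfolding P_def by (rule disj[OF that])
        show "Q b \<inter> Q b' = {}" if "b \<noteq> b'" for b b' unfolding Q_def by (rule disj[OF that])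
        show "W (P b) \<le> R * W (P b')" if "b \<in> K" "b' \<in> K" for b b'
          unfolding P_def by (rule W_cyl_left_swap_le[OF cyl_sub cyl_sub, of b b']) (use that move in \<open>auto simp: K_def\<close>)
        show "W (Q b) \<le> R * W (Q b')" if "b \<in> K" "b' \<in> K" for b b'
          unfolding Q_def by (rule W_cyl_left_swap_le[OF cyl_sub cyl_sub, of b b']) (use that move in \<open>auto simp: K_def\<close>)
        show "\<bar>mean (Q b) G - mean (Q b') G\<bar> \<le> R * c" if b: "b \<in> K" "b' \<in> K" for b b'
        proof -
          have small: "card (cyl (insert (j, a) C)) < card (cyl C)"
            by (rule smaller[OF nei]) (use False in \<open>auto simp: cyl_insert dest: perms_inj[OF cyl_perms]\<close>)
          have Qne: "Q b \<noteq> {}" if b: "b \<in> K" for b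
            using nej move[of _ i _ j b] b unfolding UQ Q_def by blast
          show ?thesis using Qne[OF b(1)] Qne[OF b(2)] unfolding Q_def
            by (rule conjunct1[OF less[OF small], rule_format])
        qed
      qed (use G QP ij in \<open>auto simp: P_def cyl_insert K_def\<close>)
      then show ?thesis unfolding UP UQ Rc .
    qed
  qed
qed

end

context perm_weights begin

section \<open>Bounds on variances under Gibbs weights\<close>

definition moment_about :: "('a \<Rightarrow> 'a) set \<Rightarrow> (('a \<Rightarrow> 'a) \<Rightarrow> real) \<Rightarrow> real \<Rightarrow> real" where
  "moment_about S G t = mean S (\<lambda>\<pi>. (G \<pi> - t)\<^sup>2)"

lemma moment_about_shift:
  assumes "S \<subseteq> perms" "S \<noteq> {}"
  shows "moment_about S G t = moment_about S G (mean S G) + (mean S G - t)\<^sup>2"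
proof -
  let ?m = "mean S G"
  have "moment_about S G t = mean S (\<lambda>\<pi>. (G \<pi> - ?m)\<^sup>2 + (2 * (?m - t) * (G \<pi> - ?m) + (?m - t)\<^sup>2))"
    unfolding moment_about_def by (intro mean_cong) (simp add: power2_eq_square algebra_simps)
  also have "\<dots> = moment_about S G ?m + (2 * (?m - t) * (?m - ?m) + (?m - t)\<^sup>2)"
    by (simp only: mean_add mean_cmult mean_diff mean_const[OF assms] moment_about_def)
  finally show ?thesis by simp
qed

text \<open>
  The values of \<open>\<pi>\<close> are revealed one position at a time.  By the law of total variance each
  step contributes at most the squared gap between conditional means.
\<close>

lemma variance_cyl:
  assumes G: "lip G c"
  shows "cyl C \<noteq> {} \<Longrightarrow> moment_about (cyl C) G (mean (cyl C) G) \<le> real (card (I - fst ` C)) * (R * c)\<^sup>2"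
proof (induction "card (I - fst ` C)" arbitrary: C)
  case 0
  then have full: "I \<subseteq> fst ` C" using fin by auto
  have "\<pi> = \<rho>" if "\<pi> \<in> cyl C" "\<rho> \<in> cyl C" for \<pi> \<rho>
  proof
    fix i
    show "\<pi> i = \<rho> i"
    proof (cases "i \<in> I")
      case True
      then obtain k where "(i, k) \<in> C" using full by fastforce
      then show ?thesis using that cylD by metis
    next
      case False
      then show ?thesis using that by (auto simp: cyl_def permutes_def)
    qed
  qed
  then obtain \<pi> where "cyl C = {\<pi>}" using 0(2) by blast
  then show ?case using wt_pos[of \<pi>] by (simp add: moment_about_def mean_def W_def)
next
  case (Suc m)
  let ?m = "mean (cyl C) G"
  obtain i where i: "i \<in> I" "i \<notin> fst ` C"
    using Suc(2) by (metis Diff_iff Suc_neq_Zero card.empty equals0I)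
  define K where "K = (\<lambda>\<pi>. \<pi> i) ` cyl C"
  define P where "P k = cyl (insert (i, k) C)" for k
  have K: "finite K" "K \<noteq> {}" using finite_cyl Suc(3) by (auto simp: K_def)
  have U: "cyl C = (\<Union>k\<in>K. P k)" by (auto simp: K_def P_def cyl_insert)
  have P: "P k \<subseteq> perms" "P k \<noteq> {}" if "k \<in> K" for k
    using that by (auto simp: P_def K_def cyl_insert dest: cyl_perms)
  have disj: "P k \<inter> P k' = {}" if "k \<in> K" "k' \<in> K" "k \<noteq> k'" for k k'
    using that by (auto simp: P_def cyl_insert)
  define p where "p k = W (P k) / W (cyl C)" for k
  have p0: "p k \<ge> 0" if "k \<in> K" for k
    unfolding p_def using W_pos[OF P[OF that]] W_pos[OF cyl_sub Suc(3)] by simp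
  have mix: "mean (cyl C) H = (\<Sum>k\<in>K. p k * mean (P k) H)" for H
    unfolding p_def U by (rule mean_UNION(1)[OF K(1) P disj])
  have p1: "sum p K = 1"
    unfolding p_def U by (rule mean_UNION(2)[OF K(1) P disj K(2)])
  have gap: "\<bar>mean (P k) G - ?m\<bar> \<le> R * c" if k: "k \<in> K" for k
  proof -
    have "mean (P k) G - ?m = (\<Sum>k'\<in>K. p k' * (mean (P k) G - mean (P k') G))"
      unfolding mix by (simp add: right_diff_distrib sum_subtractf sum_distrib_right[symmetric] p1)
    also have "\<bar>\<dots>\<bar> \<le> (\<Sum>k'\<in>K. p k' * (R * c))"
    proof (rule order_trans[OF sum_abs], rule sum_mono)
      fix k' assume k': "k' \<in> K"
      have "\<bar>mean (P k) G - mean (P k') G\<bar> \<le> R * c"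
        using cyl_mean_gap[OF G, of C] P(2)[OF k] P(2)[OF k'] unfolding P_def by blast
      then show "\<bar>p k' * (mean (P k) G - mean (P k') G)\<bar> \<le> p k' * (R * c)"
        using p0[OF k'] by (simp add: abs_mult mult_left_mono)
    qed
    finally show ?thesis by (simp add: sum_distrib_right[symmetric] p1)
  qed
  have step: "moment_about (P k) G ?m \<le> real (Suc m) * (R * c)\<^sup>2" if k: "k \<in> K" for k
  proof -
    have "I - fst ` C = insert i (I - fst ` insert (i, k) C)" using i by auto
    moreover have "i \<notin> I - fst ` insert (i, k) C" by simp
    ultimately have m: "m = card (I - fst ` insert (i, k) C)"
      using Suc(2) fin by (metis card_insert_disjoint finite_Diff diff_Suc_1)
    have "moment_about (P k) G (mean (P k) G) \<le> real m * (R * c)\<^sup>2"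
      using Suc(1)[OF m] P(2)[OF k] m unfolding P_def by simp
    moreover have "(mean (P k) G - ?m)\<^sup>2 \<le> (R * c)\<^sup>2"
      using gap[OF k] by (simp add: abs_le_square_iff[symmetric])
    ultimately show ?thesis unfolding moment_about_shift[OF P[OF k], of G ?m] by (simp add: algebra_simps)
  qed
  have "moment_about (cyl C) G ?m = (\<Sum>k\<in>K. p k * moment_about (P k) G ?m)" unfolding moment_about_def by (rule mix)
  also have "\<dots> \<le> (\<Sum>k\<in>K. p k * (real (Suc m) * (R * c)\<^sup>2))"
    by (intro sum_mono mult_left_mono step p0)
  also have "\<dots> = real (Suc m) * (R * c)\<^sup>2" by (simp only: sum_distrib_right[symmetric] p1)
  finally show ?case unfolding Suc(2)[symmetric] .
qed

definition expec :: "(('a \<Rightarrow> 'a) \<Rightarrow> real) \<Rightarrow> real" where "expec = mean perms"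

definition var :: "(('a \<Rightarrow> 'a) \<Rightarrow> real) \<Rightarrow> real" where "var G = expec (\<lambda>\<pi>. (G \<pi> - expec G)\<^sup>2)"

lemma perms_ne: "perms \<noteq> {}" using id_perms by blast

theorem variance_bounded_differences:
  assumes "lip G c"
  shows "var G \<le> real (card I) * (R * c)\<^sup>2"
  using variance_cyl[OF assms, of "{}"] perms_ne
  unfolding cyl_empty var_def expec_def moment_about_def by simp

lemma expec_swap_weighted:
  assumes "i \<in> I" "j \<in> I"
  shows "(\<Sum>\<pi>\<in>perms. F (swap i j \<pi>)) = (\<Sum>\<pi>\<in>perms. F \<pi>)"
proof -
  have "swap i j ` perms = perms"
    using swap_perms[OF _ assms] by (auto simp: image_iff) (metis swap_swap)
  then show ?thesis using sum.reindex[OF inj_swap[of i j perms], of F] by (simp add: o_def)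
qed

text \<open>
  Both \<open>\<pi>\<close> and \<open>swap i j \<pi>\<close> run through all permutations; averaging the two resulting expressions
  turns a factor \<open>F\<close> into half of its increment.
\<close>

lemma expec_antisymmetric:
  assumes ij: "i \<in> I" "j \<in> I"
    and anti: "\<And>\<pi>. \<pi> \<in> perms \<Longrightarrow> wt (swap i j \<pi>) * H (swap i j \<pi>) = - (wt \<pi> * H \<pi>)"
  shows "2 * expec (\<lambda>\<pi>. F \<pi> * H \<pi>) = expec (\<lambda>\<pi>. (F \<pi> - F (swap i j \<pi>)) * H \<pi>)"
proof -
  have "(\<Sum>\<pi>\<in>perms. wt \<pi> * (F \<pi> * H \<pi>)) = (\<Sum>\<pi>\<in>perms. F (swap i j \<pi>) * (wt (swap i j \<pi>) * H (swap i j \<pi>)))"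
    using expec_swap_weighted[OF ij, of "\<lambda>\<pi>. wt \<pi> * (F \<pi> * H \<pi>)"] by (simp add: mult_ac)
  also have "\<dots> = - (\<Sum>\<pi>\<in>perms. wt \<pi> * (F (swap i j \<pi>) * H \<pi>))"
    unfolding sum_negf[symmetric] by (intro sum.cong refl) (simp only: anti, simp)
  finally have "(\<Sum>\<pi>\<in>perms. wt \<pi> * (F \<pi> * H \<pi>)) = - (\<Sum>\<pi>\<in>perms. wt \<pi> * (F (swap i j \<pi>) * H \<pi>))" .
  then have "expec (\<lambda>\<pi>. F \<pi> * H \<pi>) = - expec (\<lambda>\<pi>. F (swap i j \<pi>) * H \<pi>)"
    by (simp add: expec_def mean_def)
  then show ?thesis by (simp add: expec_def left_diff_distrib mean_diff)
qed

text \<open>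
  Two exchanges of values, \<open>k\<close> with \<open>k'\<close> and then the image of \<open>l\<close> with \<open>l'\<close>, map the first event
  into the second one, and each costs a factor \<open>R\<close>.
\<close>

lemma pair_weight_le:
  assumes ij: "i \<in> I" "j \<in> I" "i \<noteq> j" and kl: "k \<in> I" "l \<in> I" "k \<noteq> l" "k' \<in> I" "l' \<in> I" "k' \<noteq> l'"
  shows "W {\<pi> \<in> perms. \<pi> i = k \<and> \<pi> j = l} \<le> R\<^sup>2 * W {\<pi> \<in> perms. \<pi> i = k' \<and> \<pi> j = l'}"
proof -
  define l1 where "l1 = Transposition.transpose k k' l"
  have l1: "l1 \<in> I" "l1 \<noteq> k'" using kl by (auto simp: l1_def Transposition.transpose_def)
  have left: "Transposition.transpose x y \<circ> \<pi> \<in> perms" if "\<pi> \<in> perms" "x \<in> I" "y \<in> I" for x y \<pi>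
    using that unfolding perms_def by (auto intro!: permutes_compose permutes_swap_id)
  have "W {\<pi> \<in> perms. \<pi> i = k \<and> \<pi> j = l} \<le> R * W {\<pi> \<in> perms. \<pi> i = k' \<and> \<pi> j = l1}"
    by (rule W_cyl_left_swap_le[of _ _ k k']) (use kl left in \<open>auto simp: l1_def\<close>)
  also have "W {\<pi> \<in> perms. \<pi> i = k' \<and> \<pi> j = l1} \<le> R * W {\<pi> \<in> perms. \<pi> i = k' \<and> \<pi> j = l'}"
    by (rule W_cyl_left_swap_le[of _ _ l1 l']) (use kl l1 left in auto)
  finally show ?thesis using R0 by (simp add: power2_eq_square mult.assoc)
qed

lemma expec_pair:
  assumes ij: "i \<in> I" "j \<in> I" "i \<noteq> j"
  shows "expec (\<lambda>\<pi>. F (\<pi> i) (\<pi> j))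
    = (\<Sum>k\<in>I. \<Sum>l\<in>I - {k}. W {\<pi> \<in> perms. \<pi> i = k \<and> \<pi> j = l} / W perms * F k l)"
proof -
  have "(\<Sum>\<pi>\<in>perms. wt \<pi> * F (\<pi> i) (\<pi> j)) = (\<Sum>\<pi>\<in>perms. \<Sum>k\<in>I. \<Sum>l\<in>I - {k}. if \<pi> i = k \<and> \<pi> j = l then wt \<pi> * F k l else 0)"
  proof (rule sum.cong[OF refl])
    fix \<pi> assume \<pi>: "\<pi> \<in> perms"
    have "(\<Sum>k\<in>I. \<Sum>l\<in>I - {k}. if \<pi> i = k \<and> \<pi> j = l then wt \<pi> * F k l else 0)
        = (\<Sum>k\<in>I. if \<pi> i = k then \<Sum>l\<in>I - {k}. if \<pi> j = l then wt \<pi> * F k l else 0 else 0)"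
      by (intro sum.cong) auto
    also have "\<dots> = (\<Sum>l\<in>I - {\<pi> i}. if \<pi> j = l then wt \<pi> * F (\<pi> i) l else 0)"
      using perms_in[OF \<pi> ij(1)] fin by simp
    also have "\<dots> = wt \<pi> * F (\<pi> i) (\<pi> j)"
      using perms_in[OF \<pi> ij(2)] perms_inj[OF \<pi>, of i j] ij(3) fin by auto
    finally show "wt \<pi> * F (\<pi> i) (\<pi> j) = (\<Sum>k\<in>I. \<Sum>l\<in>I - {k}. if \<pi> i = k \<and> \<pi> j = l then wt \<pi> * F k l else 0)" ..
  qed
  also have "\<dots> = (\<Sum>k\<in>I. \<Sum>l\<in>I - {k}. \<Sum>\<pi>\<in>perms. if \<pi> i = k \<and> \<pi> j = l then wt \<pi> * F k l else 0)"
    by (subst sum.swap, intro sum.cong refl, subst sum.swap, rule refl)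
  also have "\<dots> = (\<Sum>k\<in>I. \<Sum>l\<in>I - {k}. W {\<pi> \<in> perms. \<pi> i = k \<and> \<pi> j = l} * F k l)"
    by (intro sum.cong refl) (auto simp: W_def sum_distrib_right sum.inter_filter[OF finite_perms] intro!: sum.cong)
  finally show ?thesis by (simp add: expec_def mean_def sum_divide_distrib)
qed

lemma card_offdiag: "(\<Sum>k\<in>I. \<Sum>l\<in>I - {k}. x) = real (card I) * real (card I - 1) * x"
  using fin by simp

text \<open>
  The \<open>n * (n - 1)\<close> pair probabilities add up to \<open>1\<close> and are comparable by \<open>pair_weight_le\<close>.  The two
  bounds meet for \<open>R = 1\<close>, where they determine the probability.
\<close>

lemma pair_prob_ge:
  assumes ij: "i \<in> I" "j \<in> I" "i \<noteq> j" and kl: "k \<in> I" "l \<in> I" "k \<noteq> l"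
  shows "1 \<le> real (card I) * real (card I - 1) * (R\<^sup>2 * (W {\<pi> \<in> perms. \<pi> i = k \<and> \<pi> j = l} / W perms))"
    and "real (card I) * real (card I - 1) * (W {\<pi> \<in> perms. \<pi> i = k \<and> \<pi> j = l} / W perms) \<le> R\<^sup>2"
proof -
  let ?w = "\<lambda>k l. W {\<pi> \<in> perms. \<pi> i = k \<and> \<pi> j = l} / W perms"
  have Wp: "W perms > 0" using perms_ne by (intro W_pos) auto
  have le: "?w k l \<le> R\<^sup>2 * ?w k' l'" if "k \<in> I" "l \<in> I" "k \<noteq> l" "k' \<in> I" "l' \<in> I" "k' \<noteq> l'" for k l k' l'
    using divide_right_mono[OF pair_weight_le[OF ij that], of "W perms"] Wp by simp
  have one: "(\<Sum>k\<in>I. \<Sum>l\<in>I - {k}. ?w k l) = 1"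
    using expec_pair[OF ij, of "\<lambda>_ _. 1"] mean_const[of perms 1] perms_ne by (simp add: expec_def)
  have "(\<Sum>k'\<in>I. \<Sum>l'\<in>I - {k'}. ?w k' l') \<le> (\<Sum>k'\<in>I. \<Sum>l'\<in>I - {k'}. R\<^sup>2 * ?w k l)"
    by (intro sum_mono le) (use kl in auto)
  then show "1 \<le> real (card I) * real (card I - 1) * (R\<^sup>2 * ?w k l)"
    unfolding one card_offdiag .
  have "(\<Sum>k'\<in>I. \<Sum>l'\<in>I - {k'}. ?w k l) \<le> (\<Sum>k'\<in>I. \<Sum>l'\<in>I - {k'}. R\<^sup>2 * ?w k' l')"
    by (intro sum_mono le) (use kl in auto)
  also have "\<dots> = R\<^sup>2" by (simp only: sum_distrib_left[symmetric] one mult_1_right)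
  finally show "real (card I) * real (card I - 1) * ?w k l \<le> R\<^sup>2" unfolding card_offdiag .
qed

lemma expec_pair_ge:
  assumes ij: "i \<in> I" "j \<in> I" "i \<noteq> j" and F: "\<And>k l. k \<in> I \<Longrightarrow> l \<in> I \<Longrightarrow> F k l \<ge> 0"
    and diag: "\<And>k. k \<in> I \<Longrightarrow> F k k = 0"
  shows "(\<Sum>k\<in>I. \<Sum>l\<in>I. F k l) \<le> R\<^sup>2 * (real (card I))\<^sup>2 * expec (\<lambda>\<pi>. F (\<pi> i) (\<pi> j))"
proof -
  let ?w = "\<lambda>k l. W {\<pi> \<in> perms. \<pi> i = k \<and> \<pi> j = l} / W perms"
  let ?n = "real (card I)"
  have Wp: "W perms > 0" using perms_ne by (intro W_pos) auto
  have w0: "?w k l \<ge> 0" for k l using Wp by (simp add: W_def sum_nonneg wt_pos less_imp_le)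
  have "(\<Sum>k\<in>I. \<Sum>l\<in>I. F k l) = (\<Sum>k\<in>I. \<Sum>l\<in>I - {k}. F k l)"
    by (rule sum.cong[OF refl], rule sum.mono_neutral_right) (use fin diag in auto)
  also have "\<dots> \<le> (\<Sum>k\<in>I. \<Sum>l\<in>I - {k}. R\<^sup>2 * ?n\<^sup>2 * (?w k l * F k l))"
  proof (intro sum_mono)
    fix k l assume kl: "k \<in> I" "l \<in> I - {k}"
    have "1 \<le> ?n * real (card I - 1) * (R\<^sup>2 * ?w k l)" by (rule pair_prob_ge(1)[OF ij]) (use kl in auto)
    also have "\<dots> \<le> ?n * ?n * (R\<^sup>2 * ?w k l)"
      using w0[of k l] by (intro mult_right_mono mult_left_mono mult_nonneg_nonneg) auto
    finally have "1 * F k l \<le> ?n * ?n * (R\<^sup>2 * ?w k l) * F k l" using kl F by (intro mult_right_mono) auto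
    then show "F k l \<le> R\<^sup>2 * ?n\<^sup>2 * (?w k l * F k l)" by (simp add: power2_eq_square mult_ac)
  qed
  also have "\<dots> = R\<^sup>2 * ?n\<^sup>2 * expec (\<lambda>\<pi>. F (\<pi> i) (\<pi> j))"
    by (simp add: expec_pair[OF ij] sum_distrib_left)
  finally show ?thesis .
qed

lemma expec_mono: "(\<And>\<pi>. \<pi> \<in> perms \<Longrightarrow> G \<pi> \<le> H \<pi>) \<Longrightarrow> expec G \<le> expec H"
  unfolding expec_def by (intro mean_mono) auto

lemma expec_cong: "(\<And>\<pi>. \<pi> \<in> perms \<Longrightarrow> G \<pi> = H \<pi>) \<Longrightarrow> expec G = expec H"
  unfolding expec_def by (rule mean_cong)

lemma expec_const: "expec (\<lambda>_. c) = c"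
  unfolding expec_def by (rule mean_const) (use perms_ne in auto)

lemma expec_linear:
  "expec (\<lambda>\<pi>. G \<pi> + H \<pi>) = expec G + expec H"
  "expec (\<lambda>\<pi>. G \<pi> - H \<pi>) = expec G - expec H"
  "expec (\<lambda>\<pi>. c * G \<pi>) = c * expec G"
  "expec (\<lambda>\<pi>. \<Sum>i\<in>A. K i \<pi>) = (\<Sum>i\<in>A. expec (K i))"
  unfolding expec_def by (rule mean_add mean_diff mean_cmult mean_sum)+

lemma expec_nonneg: "(\<And>\<pi>. \<pi> \<in> perms \<Longrightarrow> 0 \<le> G \<pi>) \<Longrightarrow> 0 \<le> expec G"
  using expec_mono[of "\<lambda>_. 0" G] expec_const[of 0] by simp

text \<open>
  The Cauchy--Schwarz inequality with \<open>b\<close> in place of the variance of \<open>H\<close>, from the nonnegative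
  second moment of \<open>F - x * H\<close> about the mean of \<open>F\<close>.
\<close>

lemma covariance_lower_bound:
  assumes H: "expec (\<lambda>\<pi>. (H \<pi>)\<^sup>2) \<le> b" "expec H = 0" and b: "b > 0"
  shows "(expec (\<lambda>\<pi>. F \<pi> * H \<pi>))\<^sup>2 / b \<le> var F"
proof -
  let ?C = "expec (\<lambda>\<pi>. F \<pi> * H \<pi>)" and ?m = "expec F"
  define x where "x = ?C / b"
  have "0 \<le> expec (\<lambda>\<pi>. ((F \<pi> - ?m) - x * H \<pi>)\<^sup>2)" by (intro expec_nonneg) simp
  also have "\<dots> = expec (\<lambda>\<pi>. (F \<pi> - ?m)\<^sup>2 - 2 * x * (F \<pi> * H \<pi> - ?m * H \<pi>) + x\<^sup>2 * (H \<pi>)\<^sup>2)"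
    by (intro expec_cong) (simp add: power2_eq_square algebra_simps)
  also have "\<dots> = var F - 2 * x * ?C + x\<^sup>2 * expec (\<lambda>\<pi>. (H \<pi>)\<^sup>2)"
    by (simp only: expec_linear var_def H(2)) simp
  also have "\<dots> \<le> var F - 2 * x * ?C + x\<^sup>2 * b"
    by (intro add_mono mult_left_mono H) auto
  also have "\<dots> = var F - ?C\<^sup>2 / b" using b by (simp add: x_def power2_eq_square field_simps)
  finally show ?thesis by simp
qed

text \<open>
  The test statistic \<open>H\<close> averages \<open>xdiff a / (1 + exp (xdiff g))\<close> over all pairs of positions.  Since
  \<open>exp (- xdiff g)\<close> is the ratio of the weights before and after the transposition, the denominator
  makes each summand antisymmetric for the weighted law.  Hence \<open>H\<close> has mean \<open>0\<close>, and its covariance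
  with the linear statistic is half the mean of \<open>xdiff a\<close> times the summand, which is at least
  a multiple of the mean of \<open>(xdiff a)\<^sup>2\<close>.  As \<open>H\<close> changes boundedly under
  transpositions, its variance is at most of order \<open>n\<close>.
\<close>

theorem lin_stat_variance_lower:
  assumes a: "\<And>i k. i \<in> I \<Longrightarrow> k \<in> I \<Longrightarrow> \<bar>a i k\<bar> \<le> A" and A: "A > 0"
  defines "n \<equiv> real (card I)"
  defines "S \<equiv> (\<Sum>i\<in>I. \<Sum>j\<in>I. \<Sum>k\<in>I. \<Sum>l\<in>I. (xdiff a i j k l)\<^sup>2)"
  shows "(S / n ^ 4)\<^sup>2 / (4 * (1 + R)\<^sup>2 * R ^ 6 * 32\<^sup>2 * A\<^sup>2) * n \<le> var (lin_stat I a)"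
proof -
  define \<psi> where "\<psi> i j k l = xdiff a i j k l / (1 + exp (xdiff g i j k l))" for i j k l
  define H where "H \<pi> = 1 / n * (\<Sum>i\<in>I. \<Sum>j\<in>I. \<psi> i j (\<pi> i) (\<pi> j))" for \<pi>
  have n: "n > 0" using fin ne by (simp add: n_def card_gt_0_iff)
  have xa: "\<bar>xdiff a i j k l\<bar> \<le> 4 * A" if "i \<in> I" "j \<in> I" "k \<in> I" "l \<in> I" for i j k l
    using a[of i k] a[of j l] a[of i l] a[of j k] that by (simp add: xdiff_def)
  have \<psi>b: "\<bar>\<psi> i j k l\<bar> \<le> 4 * A" if ijkl: "i \<in> I" "j \<in> I" "k \<in> I" "l \<in> I" for i j k l
  proof -
    have "\<bar>\<psi> i j k l\<bar> = \<bar>xdiff a i j k l\<bar> / (1 + exp (xdiff g i j k l))"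
      unfolding \<psi>_def abs_divide by (simp add: add_nonneg_nonneg)
    also have "\<dots> \<le> \<bar>xdiff a i j k l\<bar> / 1"
      by (rule divide_left_mono) (simp_all add: add_pos_pos)
    finally show ?thesis using xa[OF ijkl] by simp
  qed
  have lipH: "lip H (32 * A)"
    unfolding lip_def
  proof (intro allI impI)
    fix \<pi> i j assume *: "\<pi> permutes I" "i \<in> I" "j \<in> I"
    have "\<bar>H (swap i j \<pi>) - H \<pi>\<bar> = 1 / n * \<bar>(\<Sum>x\<in>I. \<Sum>y\<in>I. \<psi> x y (swap i j \<pi> x) (swap i j \<pi> y)) - (\<Sum>x\<in>I. \<Sum>y\<in>I. \<psi> x y (\<pi> x) (\<pi> y))\<bar>"
      unfolding H_def right_diff_distrib[symmetric] abs_mult using n by simp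
    also have "\<dots> \<le> 1 / n * (8 * (4 * A) * n)"
      unfolding n_def by (intro mult_left_mono quad_stat_swap[OF fin *(2,3,1)] \<psi>b) auto
    finally show "\<bar>H (swap i j \<pi>) - H \<pi>\<bar> \<le> 32 * A" using n by simp
  qed
  have anti: "wt (swap i j \<pi>) * \<psi> i j (swap i j \<pi> i) (swap i j \<pi> j) = - (wt \<pi> * \<psi> i j (\<pi> i) (\<pi> j))"
    if "i \<in> I" "j \<in> I" for i j \<pi>
  proof -
    have x: "xdiff h i j (\<pi> j) (\<pi> i) = - xdiff h i j (\<pi> i) (\<pi> j)" for h by (simp add: xdiff_def)
    have e: "1 + exp (x::real) > 0" for x by (simp add: add_pos_pos)
    show ?thesis
      unfolding wt_swap[OF that] \<psi>_def using e[of "xdiff g i j (\<pi> i) (\<pi> j)"] e[of "- xdiff g i j (\<pi> i) (\<pi> j)"]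
      by (simp add: x exp_minus field_simps)
  qed
  have mean0: "expec H = 0"
  proof -
    have "expec (\<lambda>\<pi>. 1 * \<psi> i j (\<pi> i) (\<pi> j)) = 0" if "i \<in> I" "j \<in> I" for i j
      using expec_antisymmetric[OF that anti[OF that], where F="\<lambda>_. 1"] expec_const[of 0] by simp
    then show ?thesis unfolding H_def expec_linear(3) expec_linear(4) by simp
  qed
  have cov: "S / (2 * (1 + R) * R\<^sup>2 * n ^ 3) \<le> expec (\<lambda>\<pi>. lin_stat I a \<pi> * H \<pi>)"
  proof -
    have ij: "(\<Sum>k\<in>I. \<Sum>l\<in>I. (xdiff a i j k l)\<^sup>2) / (2 * (1 + R) * R\<^sup>2 * n\<^sup>2)
        \<le> expec (\<lambda>\<pi>. lin_stat I a \<pi> * \<psi> i j (\<pi> i) (\<pi> j))" if ij: "i \<in> I" "j \<in> I" for i j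
    proof (cases "i = j")
      case True
      then show ?thesis by (simp add: \<psi>_def xdiff_def expec_const)
    next
      case False
      have c1: "(\<Sum>k\<in>I. \<Sum>l\<in>I. (xdiff a i j k l)\<^sup>2) \<le> R\<^sup>2 * n\<^sup>2 * expec (\<lambda>\<pi>. (xdiff a i j (\<pi> i) (\<pi> j))\<^sup>2)"
        unfolding n_def by (rule expec_pair_ge[OF ij False]) (auto simp: xdiff_def)
      have c2: "expec (\<lambda>\<pi>. (xdiff a i j (\<pi> i) (\<pi> j))\<^sup>2)
          \<le> expec (\<lambda>\<pi>. (1 + R) * (xdiff a i j (\<pi> i) (\<pi> j) * \<psi> i j (\<pi> i) (\<pi> j)))"
      proof (rule expec_mono)
        fix \<pi> assume \<pi>: "\<pi> \<in> perms"
        let ?x = "xdiff a i j (\<pi> i) (\<pi> j)" and ?e = "1 + exp (xdiff g i j (\<pi> i) (\<pi> j))"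
        have "?e \<le> 1 + R" unfolding R_def
          using xdiff_bound[OF ij perms_in[OF \<pi> ij(1)] perms_in[OF \<pi> ij(2)]] by simp
        moreover have e: "?e > 0" by (simp add: add_pos_pos)
        ultimately have "?x\<^sup>2 * ?e \<le> ?x\<^sup>2 * (1 + R)" by (intro mult_left_mono) auto
        then show "?x\<^sup>2 \<le> (1 + R) * (?x * \<psi> i j (\<pi> i) (\<pi> j))"
          unfolding \<psi>_def using e by (simp add: field_simps power2_eq_square)
      qed
      have c3: "expec (\<lambda>\<pi>. (1 + R) * (xdiff a i j (\<pi> i) (\<pi> j) * \<psi> i j (\<pi> i) (\<pi> j)))
          = (1 + R) * (2 * expec (\<lambda>\<pi>. lin_stat I a \<pi> * \<psi> i j (\<pi> i) (\<pi> j)))"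
        unfolding expec_antisymmetric[OF ij anti[OF ij]] expec_linear by (simp add: lin_stat_swap[OF fin ij])
      have le: "(\<Sum>k\<in>I. \<Sum>l\<in>I. (xdiff a i j k l)\<^sup>2)
          \<le> expec (\<lambda>\<pi>. lin_stat I a \<pi> * \<psi> i j (\<pi> i) (\<pi> j)) * (2 * (1 + R) * R\<^sup>2 * n\<^sup>2)"
        using order_trans[OF c1 mult_left_mono[OF c2[unfolded c3], of "R\<^sup>2 * n\<^sup>2"]] by (simp add: algebra_simps)
      have pos: "2 * (1 + R) * R\<^sup>2 * n\<^sup>2 > 0" using R0 n by simp
      show ?thesis unfolding pos_divide_le_eq[OF pos] by (rule le)
    qed
    have "S / (2 * (1 + R) * R\<^sup>2 * n ^ 3) = 1 / n * (\<Sum>i\<in>I. \<Sum>j\<in>I. (\<Sum>k\<in>I. \<Sum>l\<in>I. (xdiff a i j k l)\<^sup>2) / (2 * (1 + R) * R\<^sup>2 * n\<^sup>2))"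
      unfolding S_def sum_divide_distrib[symmetric] by (simp add: power3_eq_cube power2_eq_square mult_ac)
    also have "\<dots> \<le> 1 / n * (\<Sum>i\<in>I. \<Sum>j\<in>I. expec (\<lambda>\<pi>. lin_stat I a \<pi> * \<psi> i j (\<pi> i) (\<pi> j)))"
      using n by (intro mult_left_mono sum_mono ij) auto
    also have "\<dots> = expec (\<lambda>\<pi>. lin_stat I a \<pi> * H \<pi>)"
      unfolding expec_linear(3)[symmetric] expec_linear(4)[symmetric] H_def
      by (intro expec_cong) (simp add: sum_distrib_left mult_ac)
    finally show ?thesis .
  qed
  have S0: "S \<ge> 0" unfolding S_def by (intro sum_nonneg) auto
  let ?b = "n * (R * (32 * A))\<^sup>2"
  have b: "?b > 0" using n A R0 by simp
  have "expec (\<lambda>\<pi>. (H \<pi>)\<^sup>2) \<le> ?b"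
    using variance_bounded_differences[OF lipH] unfolding var_def mean0 n_def by simp
  then have "(expec (\<lambda>\<pi>. lin_stat I a \<pi> * H \<pi>))\<^sup>2 / ?b \<le> var (lin_stat I a)"
    by (rule covariance_lower_bound[OF _ mean0 b])
  moreover have "(S / (2 * (1 + R) * R\<^sup>2 * n ^ 3))\<^sup>2 / ?b \<le> (expec (\<lambda>\<pi>. lin_stat I a \<pi> * H \<pi>))\<^sup>2 / ?b"
    using cov S0 R0 n b by (intro divide_right_mono power_mono) auto
  moreover have "(S / (2 * (1 + R) * R\<^sup>2 * n ^ 3))\<^sup>2 / ?b = (S / n ^ 4)\<^sup>2 / (4 * (1 + R)\<^sup>2 * R ^ 6 * 32\<^sup>2 * A\<^sup>2) * n"
  proof -
    have q: "(S / (2 * q * R\<^sup>2 * n ^ 3))\<^sup>2 / ?b = (S / n ^ 4)\<^sup>2 / (4 * q\<^sup>2 * R ^ 6 * 32\<^sup>2 * A\<^sup>2) * n" if "q > 0" for q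
      using n R0 A that by (simp add: field_simps power2_eq_square eval_nat_numeral)
    show ?thesis by (rule q) (use R0 in simp)
  qed
  ultimately show ?thesis by linarith
qed

end

section \<open>Stein's identity for uniform permutations\<close>

text \<open>
  The number subtracted is the mean of the linear statistic under the uniform law
  (lemma \<open>expec_norm_stat\<close>).
\<close>

definition norm_stat :: "'a set \<Rightarrow> ('a \<Rightarrow> 'a \<Rightarrow> real) \<Rightarrow> ('a \<Rightarrow> 'a) \<Rightarrow> real" where
  "norm_stat I a \<pi> = (lin_stat I a \<pi> - (\<Sum>i\<in>I. \<Sum>k\<in>I. a i k) / card I) / sqrt (card I)"

lemma weighted_am_gm:
  fixes x y q :: real
  assumes "q > 0"
  shows "x * y \<le> q / 2 * x\<^sup>2 + 1 / (2 * q) * y\<^sup>2"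
proof -
  have "0 \<le> (q * x - y)\<^sup>2 / (2 * q)" using assms by simp
  also have "\<dots> = q / 2 * x\<^sup>2 + 1 / (2 * q) * y\<^sup>2 - x * y"
    using assms by (simp add: field_simps power2_eq_square)
  finally show ?thesis by simp
qed

text \<open>
  The first summand comes from the quadratic Taylor remainder of the exponential, the second one
  from replacing \<open>quad_var\<close> by its mean.
\<close>

definition stein_const :: "real \<Rightarrow> real \<Rightarrow> real" where
  "stein_const A K = 16 * A ^ 3 * K\<^sup>2 * exp (4 * A * K) * exp (4 * A\<^sup>2 * K\<^sup>2)
     + K * (1024 * A ^ 4 + exp (16 * A\<^sup>2 * K\<^sup>2)) / 2"

locale uniform_perms =
  fixes I :: "'a set"
  assumes fin: "finite I" and ne: "I \<noteq> {}"

sublocale uniform_perms \<subseteq> U: perm_weights I "\<lambda>_ _. 0" 0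
  by unfold_locales (auto simp: fin ne)

context uniform_perms
begin

abbreviation "perms \<equiv> U.perms"
abbreviation "expec \<equiv> U.expec"

definition n :: real where "n = real (card I)"

definition cexpec :: "(('a \<Rightarrow> 'a) \<Rightarrow> complex) \<Rightarrow> complex" where
  "cexpec F = (\<Sum>\<pi>\<in>perms. F \<pi>) / of_nat (card perms)"

lemma n1: "n \<ge> 1" using fin ne by (simp add: n_def Suc_leI card_gt_0_iff)
lemma n0: "n > 0" using n1 by simp

lemma wt1: "U.wt \<pi> = 1" by (simp add: U.wt_def lin_stat_def)
lemma R1: "U.R = 1" by (simp add: U.R_def)

lemma expec_eq: "expec G = (\<Sum>\<pi>\<in>perms. G \<pi>) / real (card perms)"
  by (simp add: U.expec_def U.mean_def U.W_def wt1)

lemma cexpec_of_real: "cexpec (\<lambda>\<pi>. complex_of_real (G \<pi>)) = of_real (expec G)"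
  by (simp add: expec_eq cexpec_def)

lemma cexpec_linear:
  "cexpec (\<lambda>\<pi>. F \<pi> - G \<pi>) = cexpec F - cexpec G"
  "cexpec (\<lambda>\<pi>. c * F \<pi>) = c * cexpec F"
  "cexpec (\<lambda>\<pi>. \<Sum>i\<in>A. K i \<pi>) = (\<Sum>i\<in>A. cexpec (K i))"
proof -
  show "cexpec (\<lambda>\<pi>. \<Sum>i\<in>A. K i \<pi>) = (\<Sum>i\<in>A. cexpec (K i))"
    unfolding cexpec_def sum_divide_distrib[symmetric] by (subst sum.swap) simp
qed (simp_all add: cexpec_def sum_subtractf diff_divide_distrib sum_distrib_left)

lemma cexpec_cong: "(\<And>\<pi>. \<pi> \<in> perms \<Longrightarrow> F \<pi> = G \<pi>) \<Longrightarrow> cexpec F = cexpec G"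
  unfolding cexpec_def by (simp cong: sum.cong)

lemma norm_cexpec: "norm (cexpec F) \<le> expec (\<lambda>\<pi>. norm (F \<pi>))"
  unfolding cexpec_def expec_eq by (simp add: norm_divide divide_right_mono norm_sum)

lemma norm_cexpec_le: "(\<And>\<pi>. \<pi> \<in> perms \<Longrightarrow> norm (F \<pi>) \<le> G \<pi>) \<Longrightarrow> norm (cexpec F) \<le> expec G"
  by (rule order_trans[OF norm_cexpec U.expec_mono])

lemma cexpec_antisymmetric:
  assumes ij: "i \<in> I" "j \<in> I" and anti: "\<And>\<pi>. H (swap i j \<pi>) = - H \<pi>"
  shows "2 * cexpec (\<lambda>\<pi>. H \<pi> * F \<pi>) = cexpec (\<lambda>\<pi>. H \<pi> * (F \<pi> - F (swap i j \<pi>)))"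
proof -
  have "swap i j ` perms = perms"
    using U.swap_perms[OF _ ij] by (auto simp: image_iff) (metis swap_swap)
  then have "(\<Sum>\<pi>\<in>perms. H \<pi> * F \<pi>) = (\<Sum>\<pi>\<in>perms. H (swap i j \<pi>) * F (swap i j \<pi>))"
    using sum.reindex[OF inj_swap[of i j perms], of "\<lambda>\<pi>. H \<pi> * F \<pi>"] by (simp add: o_def)
  also have "\<dots> = - (\<Sum>\<pi>\<in>perms. H \<pi> * F (swap i j \<pi>))" unfolding anti by (simp add: sum_negf)
  finally show ?thesis
    by (simp add: cexpec_def right_diff_distrib sum_subtractf)
qed

lemma expec_swap:
  assumes ij: "i \<in> I" "j \<in> I"
  shows "expec (\<lambda>\<pi>. F (swap i j \<pi>)) = expec F"
  unfolding expec_eq by (simp only: U.expec_swap_weighted[OF ij])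

text \<open>
  The average change under a random transposition is proportional to the statistic itself: the
  linear regression property on which the exchangeable pair method rests.
\<close>

lemma sum_xdiff:
  assumes \<pi>: "\<pi> \<in> perms"
  shows "(\<Sum>i\<in>I. \<Sum>j\<in>I. xdiff a i j (\<pi> i) (\<pi> j)) = 2 * n * sqrt n * norm_stat I a \<pi>"
proof -
  have perm: "(\<Sum>j\<in>I. h (\<pi> j)) = (\<Sum>k\<in>I. h k)" for h :: "'a \<Rightarrow> real"
    using sum.permute[of \<pi> I h] \<pi> by (simp add: U.perms_def o_def)
  have 1: "(\<Sum>i\<in>I. \<Sum>j\<in>I. a i (\<pi> j)) = (\<Sum>i\<in>I. \<Sum>k\<in>I. a i k)" by (simp only: perm)
  have 2: "(\<Sum>i\<in>I. \<Sum>j\<in>I. a j (\<pi> i)) = (\<Sum>i\<in>I. \<Sum>k\<in>I. a i k)" by (subst sum.swap) (rule 1)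
  have "(\<Sum>i\<in>I. \<Sum>j\<in>I. xdiff a i j (\<pi> i) (\<pi> j))
      = 2 * n * lin_stat I a \<pi> - 2 * (\<Sum>i\<in>I. \<Sum>k\<in>I. a i k)"
    unfolding xdiff_def sum_subtractf sum.distrib 1 2
    by (simp add: lin_stat_def n_def sum_distrib_left[symmetric])
  moreover have "2 * n * sqrt n * norm_stat I a \<pi> = 2 * n * (lin_stat I a \<pi> - (\<Sum>i\<in>I. \<Sum>k\<in>I. a i k) / n)"
    unfolding norm_stat_def n_def[symmetric] using n0 by simp
  ultimately show ?thesis using n0 by (simp add: right_diff_distrib)
qed

lemma norm_stat_swap:
  assumes "i \<in> I" "j \<in> I"
  shows "norm_stat I a (swap i j \<pi>) = norm_stat I a \<pi> - xdiff a i j (\<pi> i) (\<pi> j) / sqrt n"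
  unfolding norm_stat_def lin_stat_swap[OF fin assms] n_def by (simp add: diff_divide_distrib)

lemma cexpec_norm_stat:
  "cexpec (\<lambda>\<pi>. of_real (norm_stat I b \<pi>) * F \<pi>) =
    (\<Sum>i\<in>I. \<Sum>j\<in>I. cexpec (\<lambda>\<pi>. of_real (xdiff b i j (\<pi> i) (\<pi> j)) * (F \<pi> - F (swap i j \<pi>))))
      / of_real (4 * n * sqrt n)"
proof -
  let ?c = "complex_of_real (1 / (2 * n * sqrt n))"
  let ?d = "\<lambda>i j \<pi>. complex_of_real (xdiff b i j (\<pi> i) (\<pi> j))"
  have "cexpec (\<lambda>\<pi>. of_real (norm_stat I b \<pi>) * F \<pi>) = cexpec (\<lambda>\<pi>. ?c * (\<Sum>i\<in>I. \<Sum>j\<in>I. ?d i j \<pi> * F \<pi>))"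
  proof (rule cexpec_cong)
    fix \<pi> assume \<pi>: "\<pi> \<in> perms"
    have "(\<Sum>i\<in>I. \<Sum>j\<in>I. ?d i j \<pi> * F \<pi>) = of_real (\<Sum>i\<in>I. \<Sum>j\<in>I. xdiff b i j (\<pi> i) (\<pi> j)) * F \<pi>"
      by (simp add: sum_distrib_right)
    then show "of_real (norm_stat I b \<pi>) * F \<pi> = ?c * (\<Sum>i\<in>I. \<Sum>j\<in>I. ?d i j \<pi> * F \<pi>)"
      unfolding sum_xdiff[OF \<pi>] using n0 by simp
  qed
  also have "\<dots> = (\<Sum>i\<in>I. \<Sum>j\<in>I. 2 * cexpec (\<lambda>\<pi>. ?d i j \<pi> * F \<pi>)) / of_real (4 * n * sqrt n)"
    unfolding cexpec_linear sum_distrib_left[symmetric] by simp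
  also have "(\<Sum>i\<in>I. \<Sum>j\<in>I. 2 * cexpec (\<lambda>\<pi>. ?d i j \<pi> * F \<pi>)) =
      (\<Sum>i\<in>I. \<Sum>j\<in>I. cexpec (\<lambda>\<pi>. ?d i j \<pi> * (F \<pi> - F (swap i j \<pi>))))"
  proof (intro sum.cong refl)
    fix i j assume ij: "i \<in> I" "j \<in> I"
    show "2 * cexpec (\<lambda>\<pi>. ?d i j \<pi> * F \<pi>) = cexpec (\<lambda>\<pi>. ?d i j \<pi> * (F \<pi> - F (swap i j \<pi>)))"
      by (rule cexpec_antisymmetric[OF ij]) (simp add: xdiff_def)
  qed
  finally show ?thesis .
qed

definition bounded_by :: "real \<Rightarrow> ('a \<Rightarrow> 'a \<Rightarrow> real) \<Rightarrow> bool" where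
  "bounded_by A a \<longleftrightarrow> (\<forall>i\<in>I. \<forall>k\<in>I. \<bar>a i k\<bar> \<le> A)"

lemma xdiff_le:
  assumes "bounded_by A a" "i \<in> I" "j \<in> I" "k \<in> I" "l \<in> I"
  shows "\<bar>xdiff a i j k l\<bar> \<le> 4 * A"
proof -
  have "\<bar>a i k\<bar> \<le> A" "\<bar>a j l\<bar> \<le> A" "\<bar>a i l\<bar> \<le> A" "\<bar>a j k\<bar> \<le> A"
    using assms by (auto simp: bounded_by_def)
  then show ?thesis by (simp add: xdiff_def)
qed

lemma bounded_by_nonneg: "bounded_by A a \<Longrightarrow> A \<ge> 0"
  using ne by (fastforce simp: bounded_by_def)

lemma double_sum_bound:
  assumes "\<And>i j. i \<in> I \<Longrightarrow> j \<in> I \<Longrightarrow> norm (h i j :: 'b::real_normed_vector) \<le> x"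
  shows "norm (\<Sum>i\<in>I. \<Sum>j\<in>I. h i j) \<le> n\<^sup>2 * x"
proof -
  have "norm (\<Sum>i\<in>I. \<Sum>j\<in>I. h i j) \<le> (\<Sum>i\<in>I. \<Sum>j\<in>I. x)"
    by (intro order_trans[OF norm_sum] sum_mono assms)
  then show ?thesis by (simp add: n_def power2_eq_square mult.assoc)
qed

text \<open>
  The exchangeable pair identity bounds the derivative \<open>m'\<close> of the moment generating function by
  \<open>8 * A\<^sup>2 * r * m\<close>, so that \<open>m r * exp (- 4 * A\<^sup>2 * r\<^sup>2)\<close> is nonincreasing from its value \<open>1\<close> at \<open>0\<close>.
\<close>

lemma mgf_le:
  assumes a: "bounded_by A a" and r: "r \<ge> 0"
  shows "expec (\<lambda>\<pi>. exp (r * norm_stat I a \<pi>)) \<le> exp (4 * A\<^sup>2 * r\<^sup>2)"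
proof -
  define m where "m r = expec (\<lambda>\<pi>. exp (r * norm_stat I a \<pi>))" for r
  define m' where "m' r = expec (\<lambda>\<pi>. norm_stat I a \<pi> * exp (r * norm_stat I a \<pi>))" for r
  have m0: "m r \<ge> 0" for r unfolding m_def by (intro U.expec_nonneg) simp
  have deriv: "(m has_real_derivative m' r) (at r)" for r
    unfolding m_def m'_def expec_eq
    by (auto intro!: derivative_eq_intros simp: sum_divide_distrib U.finite_perms intro!: sum.cong)
  have bound: "m' r \<le> 8 * A\<^sup>2 * r * m r" if r: "r \<ge> 0" for r
  proof -
    let ?e = "\<lambda>\<pi>. exp (r * norm_stat I a \<pi>)"
    have "of_real (m' r) = cexpec (\<lambda>\<pi>. of_real (norm_stat I a \<pi>) * of_real (?e \<pi>))"
      unfolding m'_def cexpec_of_real[symmetric] by simp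
    also have "norm \<dots> \<le> n\<^sup>2 * (32 * A\<^sup>2 * r / sqrt n * m r) / (4 * n * sqrt n)"
      unfolding cexpec_norm_stat norm_divide
    proof (intro frac_le double_sum_bound)
      fix i j assume ij: "i \<in> I" "j \<in> I"
      have "norm (cexpec (\<lambda>\<pi>. of_real (xdiff a i j (\<pi> i) (\<pi> j)) * (of_real (?e \<pi>) - of_real (?e (swap i j \<pi>)))))
          \<le> expec (\<lambda>\<pi>. 16 * A\<^sup>2 * r / sqrt n * (?e \<pi> + ?e (swap i j \<pi>)))"
      proof (rule norm_cexpec_le)
        fix \<pi> assume \<pi>: "\<pi> \<in> perms"
        let ?x = "xdiff a i j (\<pi> i) (\<pi> j)"
        have x: "\<bar>?x\<bar> \<le> 4 * A" by (intro xdiff_le[OF a]) (use ij U.perms_in[OF \<pi>] in auto)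
        have lip: "\<bar>exp u - exp v\<bar> \<le> \<bar>u - v\<bar> * (exp u + exp v)" for u v :: real
        proof -
          have *: "exp u - exp v \<le> (u - v) * exp u" "exp v * (u - v) \<le> exp u - exp v" for u v :: real
            using exp_ge_add_one_self[of "v - u"] exp_ge_add_one_self[of "u - v"]
              mult_left_mono[OF exp_ge_add_one_self[of "v - u"], of "exp u"]
              mult_left_mono[OF exp_ge_add_one_self[of "u - v"], of "exp v"]
            by (auto simp: exp_diff algebra_simps)
          show ?thesis
          proof (cases "u \<le> v")
            case True
            have "exp v - exp u \<le> (v - u) * exp v" by (rule *)
            also have "\<dots> \<le> (v - u) * (exp u + exp v)" using True by (intro mult_left_mono) auto
            finally show ?thesis using True by simp
          next
            case False
            have "exp u - exp v \<le> (u - v) * exp u" by (rule *)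
            also have "\<dots> \<le> (u - v) * (exp u + exp v)" using False by (intro mult_left_mono) auto
            finally show ?thesis using False by simp
          qed
        qed
        have "norm (of_real ?x * (of_real (?e \<pi>) - of_real (?e (swap i j \<pi>))) :: complex)
            = \<bar>?x\<bar> * \<bar>?e \<pi> - ?e (swap i j \<pi>)\<bar>"
          by (simp only: norm_mult of_real_diff[symmetric] norm_of_real)
        also have "\<dots> \<le> \<bar>?x\<bar> * (\<bar>r * norm_stat I a \<pi> - r * norm_stat I a (swap i j \<pi>)\<bar> * (?e \<pi> + ?e (swap i j \<pi>)))"
          by (intro mult_left_mono lip) auto
        also have "\<bar>r * norm_stat I a \<pi> - r * norm_stat I a (swap i j \<pi>)\<bar> = r / sqrt n * \<bar>?x\<bar>"
          unfolding norm_stat_swap[OF ij] right_diff_distrib[symmetric] using r n0 by (simp add: abs_mult)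
        also have "\<bar>?x\<bar> * (r / sqrt n * \<bar>?x\<bar> * (?e \<pi> + ?e (swap i j \<pi>)))
            = ?x\<^sup>2 * (r / sqrt n * (?e \<pi> + ?e (swap i j \<pi>)))"
          by (simp add: power2_eq_square mult_ac)
        also have "\<dots> \<le> (4 * A)\<^sup>2 * (r / sqrt n * (?e \<pi> + ?e (swap i j \<pi>)))"
          using power_mono[OF x, of 2] r n0 by (intro mult_right_mono) (auto intro!: mult_nonneg_nonneg add_nonneg_nonneg)
        also have "(4 * A)\<^sup>2 * (r / sqrt n * (?e \<pi> + ?e (swap i j \<pi>))) = 16 * A\<^sup>2 * r / sqrt n * (?e \<pi> + ?e (swap i j \<pi>))"
          by (simp only: power_mult_distrib times_divide_eq_left times_divide_eq_right) simp
        finally show "norm (of_real ?x * (of_real (?e \<pi>) - of_real (?e (swap i j \<pi>))) :: complex)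
            \<le> 16 * A\<^sup>2 * r / sqrt n * (?e \<pi> + ?e (swap i j \<pi>))" .
      qed
      also have "\<dots> = 32 * A\<^sup>2 * r / sqrt n * m r"
        using expec_swap[OF ij, of ?e] by (simp only: U.expec_linear m_def) simp
      finally show "norm (cexpec (\<lambda>\<pi>. of_real (xdiff a i j (\<pi> i) (\<pi> j)) * (of_real (?e \<pi>) - of_real (?e (swap i j \<pi>)))))
          \<le> 32 * A\<^sup>2 * r / sqrt n * m r" .
    qed (use n0 m0 r in \<open>auto simp: norm_mult\<close>)
    finally have "\<bar>m' r\<bar> \<le> n\<^sup>2 * (32 * A\<^sup>2 * r / sqrt n * m r) / (4 * n * sqrt n)" by (simp only: norm_of_real)
    also have "\<dots> = 8 * A\<^sup>2 * r * m r * (n / (sqrt n * sqrt n))"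
      using n0 by (simp add: power2_eq_square field_simps del: real_sqrt_mult_self)
    finally show ?thesis using n0 by simp
  qed
  define q where "q r = m r * exp (- (4 * A\<^sup>2 * r\<^sup>2))" for r
  have dq: "(q has_real_derivative (m' r - 8 * A\<^sup>2 * r * m r) * exp (- (4 * A\<^sup>2 * r\<^sup>2))) (at r)" for r
    unfolding q_def by (auto intro!: derivative_eq_intros deriv simp: algebra_simps)
  have "q r \<le> q 0"
    by (rule DERIV_nonpos_imp_nonincreasing[OF r])
       (use dq bound in \<open>auto intro!: exI mult_nonpos_nonneg\<close>)
  also have "q 0 = 1" by (simp add: q_def m_def U.expec_const)
  finally show ?thesis unfolding q_def m_def[symmetric] by (simp add: exp_minus field_simps)
qed

text \<open>
  The average product of the changes of two linear statistics under a random transposition, in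
  the normalisation in which its mean is the covariance of the two values of \<open>norm_stat\<close>.
\<close>

definition quad_var :: "('a \<Rightarrow> 'a \<Rightarrow> real) \<Rightarrow> ('a \<Rightarrow> 'a \<Rightarrow> real) \<Rightarrow> ('a \<Rightarrow> 'a) \<Rightarrow> real" where
  "quad_var a b \<pi> = (\<Sum>i\<in>I. \<Sum>j\<in>I. xdiff a i j (\<pi> i) (\<pi> j) * xdiff b i j (\<pi> i) (\<pi> j)) / (4 * n\<^sup>2)"

lemma quad_var_concentration:
  assumes a: "bounded_by A a" and b: "bounded_by A b"
  shows "U.var (quad_var a b) \<le> 1024 * A ^ 4 / n"
proof -
  have "U.lip (quad_var a b) (32 * A\<^sup>2 / n)"
    unfolding U.lip_def
  proof (intro allI impI)
    fix \<pi> i j assume *: "\<pi> permutes I" "i \<in> I" "j \<in> I"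
    let ?\<psi> = "\<lambda>i j k l. xdiff a i j k l * xdiff b i j k l"
    have \<psi>: "\<bar>?\<psi> i j k l\<bar> \<le> 16 * A\<^sup>2" if "i \<in> I" "j \<in> I" "k \<in> I" "l \<in> I" for i j k l
      using mult_mono[OF xdiff_le[OF a that] xdiff_le[OF b that]] bounded_by_nonneg[OF a]
      by (simp add: abs_mult power2_eq_square)
    have "\<bar>quad_var a b (swap i j \<pi>) - quad_var a b \<pi>\<bar>
        = \<bar>(\<Sum>x\<in>I. \<Sum>y\<in>I. ?\<psi> x y (swap i j \<pi> x) (swap i j \<pi> y)) - (\<Sum>x\<in>I. \<Sum>y\<in>I. ?\<psi> x y (\<pi> x) (\<pi> y))\<bar> / (4 * n\<^sup>2)"
      unfolding quad_var_def diff_divide_distrib[symmetric] abs_divide by simp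
    also have "\<dots> \<le> 8 * (16 * A\<^sup>2) * real (card I) / (4 * n\<^sup>2)"
      by (intro divide_right_mono quad_stat_swap[OF fin *(2,3,1), of ?\<psi>] \<psi>) auto
    also have "\<dots> = 32 * A\<^sup>2 / n" using n0 by (simp add: n_def[symmetric] power2_eq_square)
    finally show "\<bar>quad_var a b (swap i j \<pi>) - quad_var a b \<pi>\<bar> \<le> 32 * A\<^sup>2 / n" .
  qed
  from U.variance_bounded_differences[OF this] show ?thesis
    unfolding R1 n_def[symmetric] using n0 by (simp add: power2_eq_square eval_nat_numeral field_simps)
qed

text \<open>
  For the uniform law the pair \<open>(\<pi> i, \<pi> j)\<close> is uniform on the pairs of distinct values; the diagonal
  pairs may be added because \<open>xdiff\<close> vanishes there.
\<close>

lemma expec_quad_var: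
  assumes n2: "n > 1"
  shows "expec (quad_var a b) = (\<Sum>i\<in>I. \<Sum>j\<in>I. \<Sum>k\<in>I. \<Sum>l\<in>I. xdiff a i j k l * xdiff b i j k l) / (4 * n ^ 3 * (n - 1))"
proof -
  have c1: "real (card I - 1) = n - 1" using n1 by (simp add: n_def of_nat_diff)
  have prob: "U.W {\<pi> \<in> perms. \<pi> i = k \<and> \<pi> j = l} / U.W perms = 1 / (n * (n - 1))"
    if "i \<in> I" "j \<in> I" "i \<noteq> j" "k \<in> I" "l \<in> I" "k \<noteq> l" for i j k l
  proof -
    have "n * (n - 1) * (U.W {\<pi> \<in> perms. \<pi> i = k \<and> \<pi> j = l} / U.W perms) = 1"
      using U.pair_prob_ge[OF that] unfolding R1 c1 n_def[symmetric] power_one mult_1_left by linarith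
    moreover have "p = 1 / (n * (n - 1))" if "n * (n - 1) * p = 1" for p
      using that n2 by (simp add: field_simps)
    ultimately show ?thesis by blast
  qed
  have pair: "expec (\<lambda>\<pi>. xdiff a i j (\<pi> i) (\<pi> j) * xdiff b i j (\<pi> i) (\<pi> j))
      = (\<Sum>k\<in>I. \<Sum>l\<in>I. xdiff a i j k l * xdiff b i j k l) / (n * (n - 1))" if ij: "i \<in> I" "j \<in> I" for i j
  proof (cases "i = j")
    case True
    then show ?thesis by (simp add: xdiff_def U.expec_const)
  next
    case False
    have "expec (\<lambda>\<pi>. xdiff a i j (\<pi> i) (\<pi> j) * xdiff b i j (\<pi> i) (\<pi> j))
        = (\<Sum>k\<in>I. \<Sum>l\<in>I - {k}. 1 / (n * (n - 1)) * (xdiff a i j k l * xdiff b i j k l))"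
      unfolding U.expec_pair[OF ij False, of "\<lambda>k l. xdiff a i j k l * xdiff b i j k l"]
      by (intro sum.cong refl, subst prob) (use ij False in auto)
    also have "\<dots> = (\<Sum>k\<in>I. \<Sum>l\<in>I. 1 / (n * (n - 1)) * (xdiff a i j k l * xdiff b i j k l))"
      by (rule sum.cong[OF refl], rule sum.mono_neutral_left) (use fin in \<open>auto simp: xdiff_def\<close>)
    finally show ?thesis by (simp add: sum_divide_distrib)
  qed
  have "expec (quad_var a b) = expec (\<lambda>\<pi>. 1 / (4 * n\<^sup>2) * (\<Sum>i\<in>I. \<Sum>j\<in>I. xdiff a i j (\<pi> i) (\<pi> j) * xdiff b i j (\<pi> i) (\<pi> j)))"
    by (intro U.expec_cong) (simp add: quad_var_def)
  also have "\<dots> = 1 / (4 * n\<^sup>2) * (\<Sum>i\<in>I. \<Sum>j\<in>I. (\<Sum>k\<in>I. \<Sum>l\<in>I. xdiff a i j k l * xdiff b i j k l) / (n * (n - 1)))"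
    unfolding U.expec_linear by (simp add: pair)
  also have "\<dots> = (\<Sum>i\<in>I. \<Sum>j\<in>I. \<Sum>k\<in>I. \<Sum>l\<in>I. xdiff a i j k l * xdiff b i j k l) / (4 * n ^ 3 * (n - 1))"
    by (simp add: sum_divide_distrib[symmetric] power3_eq_cube power2_eq_square mult_ac)
  finally show ?thesis .
qed

text \<open>
  In the exchangeable pair identity \<open>cexpec_norm_stat\<close>, the increment of \<open>e\<close> under a transposition is
  \<open>s * e * xdiff a / sqrt n\<close> up to a quadratic error, which produces \<open>quad_var a b\<close>; this in turn is
  close to its mean by \<open>quad_var_concentration\<close>.  The exponential moments in both error terms are
  bounded uniformly in \<open>n\<close> by \<open>mgf_le\<close>.  Complex \<open>s\<close> covers characteristic functions and exponential tilts at once.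
\<close>

theorem stein_identity:
  fixes s :: complex and e :: "('a \<Rightarrow> 'a) \<Rightarrow> complex"
  assumes a: "bounded_by A a" and b: "bounded_by A b" and s: "norm s \<le> K" "Re s \<ge> 0"
  defines "e \<equiv> \<lambda>\<pi>. exp (s * of_real (norm_stat I a \<pi>))"
  shows "norm (cexpec (\<lambda>\<pi>. of_real (norm_stat I b \<pi>) * e \<pi>) - s * of_real (expec (quad_var a b)) * cexpec e)
    \<le> stein_const A K / sqrt n"
proof -
  have A0: "A \<ge> 0" by (rule bounded_by_nonneg[OF a])
  have K0: "K \<ge> 0" using s(1) norm_ge_zero order_trans by blast
  have ResK: "Re s \<le> K" using s(1) complex_Re_le_cmod order_trans by blast
  define m where "m r = expec (\<lambda>\<pi>. exp (r * norm_stat I a \<pi>))" for r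
  have m_le: "m r \<le> exp (4 * A\<^sup>2 * x\<^sup>2)" if "0 \<le> r" "r \<le> x" for r x
  proof -
    have "m r \<le> exp (4 * A\<^sup>2 * r\<^sup>2)" unfolding m_def by (rule mgf_le[OF a that(1)])
    also have "\<dots> \<le> exp (4 * A\<^sup>2 * x\<^sup>2)" using that by (auto intro!: mult_left_mono power_mono)
    finally show ?thesis .
  qed
  have norm_e: "norm (e \<pi>) = exp (Re s * norm_stat I a \<pi>)" for \<pi>
    by (simp add: e_def norm_exp_eq_Re)
  let ?\<Delta> = "\<lambda>c i j \<pi>. complex_of_real (xdiff c i j (\<pi> i) (\<pi> j))"
  have part1: "norm (cexpec (\<lambda>\<pi>. of_real (norm_stat I b \<pi>) * e \<pi>) - s * cexpec (\<lambda>\<pi>. of_real (quad_var a b \<pi>) * e \<pi>))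
      \<le> 16 * A ^ 3 * K\<^sup>2 * exp (4 * A * K) * exp (4 * A\<^sup>2 * K\<^sup>2) / sqrt n"
  proof -
    have q: "s * cexpec (\<lambda>\<pi>. of_real (quad_var a b \<pi>) * e \<pi>)
        = (\<Sum>i\<in>I. \<Sum>j\<in>I. cexpec (\<lambda>\<pi>. s / of_real (sqrt n) * (?\<Delta> a i j \<pi> * ?\<Delta> b i j \<pi> * e \<pi>))) / of_real (4 * n * sqrt n)"
    proof -
      have "cexpec (\<lambda>\<pi>. of_real (quad_var a b \<pi>) * e \<pi>)
          = cexpec (\<lambda>\<pi>. of_real (1 / (4 * n\<^sup>2)) * (\<Sum>i\<in>I. \<Sum>j\<in>I. ?\<Delta> a i j \<pi> * ?\<Delta> b i j \<pi> * e \<pi>))"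
        by (intro cexpec_cong) (simp add: quad_var_def sum_distrib_right)
      also have "\<dots> = (\<Sum>i\<in>I. \<Sum>j\<in>I. cexpec (\<lambda>\<pi>. ?\<Delta> a i j \<pi> * ?\<Delta> b i j \<pi> * e \<pi>)) / of_real (4 * n\<^sup>2)"
        unfolding cexpec_linear by simp
      also have "s * \<dots> = (s / of_real (sqrt n) * (\<Sum>i\<in>I. \<Sum>j\<in>I. cexpec (\<lambda>\<pi>. ?\<Delta> a i j \<pi> * ?\<Delta> b i j \<pi> * e \<pi>))) / of_real (4 * n * sqrt n)"
      proof -
        have "complex_of_real (sqrt n) * complex_of_real (sqrt n) = n"
          unfolding of_real_mult[symmetric] using n0 by simp
        then show ?thesis using n0 by (simp add: power2_eq_square field_simps)
      qed
      finally show ?thesis unfolding cexpec_linear sum_distrib_left[symmetric] .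
    qed
    have D: "norm (complex_of_real (4 * n * sqrt n)) = 4 * n * sqrt n"
      unfolding norm_of_real using n0 by simp
    have "norm (cexpec (\<lambda>\<pi>. of_real (norm_stat I b \<pi>) * e \<pi>) - s * cexpec (\<lambda>\<pi>. of_real (quad_var a b \<pi>) * e \<pi>))
      = norm (\<Sum>i\<in>I. \<Sum>j\<in>I. cexpec (\<lambda>\<pi>. ?\<Delta> b i j \<pi> * (e \<pi> - e (swap i j \<pi>))
            - s / of_real (sqrt n) * (?\<Delta> a i j \<pi> * ?\<Delta> b i j \<pi> * e \<pi>))) / (4 * n * sqrt n)"
      unfolding cexpec_norm_stat q diff_divide_distrib[symmetric] norm_divide D
      by (simp only: cexpec_linear(1) sum_subtractf)
    also have "\<dots> \<le> n\<^sup>2 * (4 * A * (K\<^sup>2 * (16 * A\<^sup>2) / n) * exp (4 * A * K) * exp (4 * A\<^sup>2 * K\<^sup>2)) / (4 * n * sqrt n)"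
    proof (intro divide_right_mono double_sum_bound)
      fix i j assume ij: "i \<in> I" "j \<in> I"
      have "norm (cexpec (\<lambda>\<pi>. ?\<Delta> b i j \<pi> * (e \<pi> - e (swap i j \<pi>)) - s / of_real (sqrt n) * (?\<Delta> a i j \<pi> * ?\<Delta> b i j \<pi> * e \<pi>)))
          \<le> expec (\<lambda>\<pi>. 4 * A * (K\<^sup>2 * (16 * A\<^sup>2) / n) * exp (4 * A * K) * exp (Re s * norm_stat I a \<pi>))"
      proof (rule norm_cexpec_le)
        fix \<pi> assume \<pi>: "\<pi> \<in> perms"
        define x where "x = xdiff a i j (\<pi> i) (\<pi> j)"
        define y where "y = xdiff b i j (\<pi> i) (\<pi> j)"
        define z where "z = - (s * (x / sqrt n))"
        have xy: "\<bar>x\<bar> \<le> 4 * A" "\<bar>y\<bar> \<le> 4 * A"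
          unfolding x_def y_def by (intro xdiff_le[OF a] xdiff_le[OF b]; use ij U.perms_in[OF \<pi>] in auto)+
        have esw: "e (swap i j \<pi>) = e \<pi> * exp z"
          unfolding e_def norm_stat_swap[OF ij] x_def[symmetric] z_def exp_add[symmetric] by (simp add: algebra_simps)
        have T: "norm (exp z - (1 + z)) \<le> exp (norm z) * (norm z)\<^sup>2"
        proof -
          have "norm (exp z - (1 + z)) \<le> exp \<bar>Re z\<bar> * (norm z)\<^sup>2"
            using Taylor_exp[of z 1] by (simp add: power2_eq_square)
          also have "\<dots> \<le> exp (norm z) * (norm z)\<^sup>2"
            by (intro mult_right_mono) (auto simp: abs_Re_le_cmod)
          finally show ?thesis .
        qed
        have nz: "norm z = norm s * \<bar>x\<bar> / sqrt n" using n0 by (simp add: z_def norm_mult norm_divide)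
        have sx: "norm s * \<bar>x\<bar> \<le> K * (4 * A)" using s(1) xy(1) K0 by (intro mult_mono) auto
        have nz1: "norm z \<le> 4 * A * K"
        proof -
          have "norm z \<le> norm s * \<bar>x\<bar> / 1"
            unfolding nz using n1 by (intro divide_left_mono) auto
          then show ?thesis using sx by (simp add: mult_ac)
        qed
        have nz2: "(norm z)\<^sup>2 \<le> K\<^sup>2 * (16 * A\<^sup>2) / n"
        proof -
          have "(norm z)\<^sup>2 = (norm s * \<bar>x\<bar>)\<^sup>2 / n" unfolding nz using n0 by (simp add: power_divide)
          also have "\<dots> \<le> (K * (4 * A))\<^sup>2 / n" using sx n0 by (intro divide_right_mono power_mono) auto
          finally show ?thesis by (simp add: power_mult_distrib)
        qed
        have eq: "of_real y * (e \<pi> - e (swap i j \<pi>)) - s / of_real (sqrt n) * (of_real x * of_real y * e \<pi>)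
            = - of_real y * e \<pi> * (exp z - (1 + z))"
          unfolding esw z_def by (simp add: algebra_simps)
        have "norm (of_real y * (e \<pi> - e (swap i j \<pi>)) - s / of_real (sqrt n) * (of_real x * of_real y * e \<pi>))
            = \<bar>y\<bar> * norm (exp z - (1 + z)) * norm (e \<pi>)"
          unfolding eq by (simp add: norm_mult)
        also have "\<dots> \<le> (4 * A) * (exp (4 * A * K) * (K\<^sup>2 * (16 * A\<^sup>2) / n)) * norm (e \<pi>)"
        proof (intro mult_right_mono mult_mono xy)
          show "norm (exp z - (1 + z)) \<le> exp (4 * A * K) * (K\<^sup>2 * (16 * A\<^sup>2) / n)"
            by (rule order_trans[OF T]) (intro mult_mono, use nz1 nz2 in auto)
        qed (use A0 n0 in auto)
        finally show "norm (?\<Delta> b i j \<pi> * (e \<pi> - e (swap i j \<pi>)) - s / of_real (sqrt n) * (?\<Delta> a i j \<pi> * ?\<Delta> b i j \<pi> * e \<pi>))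
            \<le> 4 * A * (K\<^sup>2 * (16 * A\<^sup>2) / n) * exp (4 * A * K) * exp (Re s * norm_stat I a \<pi>)"
          unfolding norm_e x_def y_def by (simp add: mult_ac)
      qed
      also have "\<dots> \<le> 4 * A * (K\<^sup>2 * (16 * A\<^sup>2) / n) * exp (4 * A * K) * exp (4 * A\<^sup>2 * K\<^sup>2)"
        unfolding U.expec_linear m_def[symmetric]
        using A0 n0 by (intro mult_left_mono m_le s ResK) auto
      finally show "norm (cexpec (\<lambda>\<pi>. ?\<Delta> b i j \<pi> * (e \<pi> - e (swap i j \<pi>)) - s / of_real (sqrt n) * (?\<Delta> a i j \<pi> * ?\<Delta> b i j \<pi> * e \<pi>)))
          \<le> 4 * A * (K\<^sup>2 * (16 * A\<^sup>2) / n) * exp (4 * A * K) * exp (4 * A\<^sup>2 * K\<^sup>2)" .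
    qed (use n0 in auto)
    also have "\<dots> = 16 * A ^ 3 * K\<^sup>2 * exp (4 * A * K) * exp (4 * A\<^sup>2 * K\<^sup>2) / sqrt n"
      using n0 by (simp add: power2_eq_square power3_eq_cube)
    finally show ?thesis .
  qed
  let ?v = "expec (quad_var a b)"
  have part2: "norm (cexpec (\<lambda>\<pi>. of_real (quad_var a b \<pi>) * e \<pi>) - of_real ?v * cexpec e)
      \<le> (1024 * A ^ 4 + exp (16 * A\<^sup>2 * K\<^sup>2)) / 2 / sqrt n"
  proof -
    have "norm (cexpec (\<lambda>\<pi>. of_real (quad_var a b \<pi>) * e \<pi>) - of_real ?v * cexpec e)
        = norm (cexpec (\<lambda>\<pi>. of_real (quad_var a b \<pi>) * e \<pi> - of_real ?v * e \<pi>))"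
      unfolding cexpec_linear ..
    \<comment> \<open>The weight \<open>sqrt n\<close> balances a variance of order \<open>1 / n\<close> against a bounded exponential moment.\<close>
    also have "\<dots> \<le> expec (\<lambda>\<pi>. sqrt n / 2 * (quad_var a b \<pi> - ?v)\<^sup>2 + 1 / (2 * sqrt n) * exp (2 * Re s * norm_stat I a \<pi>))"
    proof (rule norm_cexpec_le)
      fix \<pi>
      let ?x = "\<bar>quad_var a b \<pi> - ?v\<bar>" and ?y = "exp (Re s * norm_stat I a \<pi>)"
      have "norm (of_real (quad_var a b \<pi>) * e \<pi> - of_real ?v * e \<pi>) = ?x * ?y"
        unfolding left_diff_distrib[symmetric] of_real_diff[symmetric] norm_mult norm_of_real norm_e ..
      also have "\<dots> \<le> sqrt n / 2 * ?x\<^sup>2 + 1 / (2 * sqrt n) * ?y\<^sup>2"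
        using n0 by (intro weighted_am_gm) simp
      also have "?y\<^sup>2 = exp (2 * Re s * norm_stat I a \<pi>)" by (simp add: exp_double[symmetric] mult.assoc)
      finally show "norm (of_real (quad_var a b \<pi>) * e \<pi> - of_real ?v * e \<pi>)
          \<le> sqrt n / 2 * (quad_var a b \<pi> - ?v)\<^sup>2 + 1 / (2 * sqrt n) * exp (2 * Re s * norm_stat I a \<pi>)" by simp
    qed
    also have "\<dots> = sqrt n / 2 * U.var (quad_var a b) + 1 / (2 * sqrt n) * m (2 * Re s)"
      unfolding U.expec_linear U.var_def m_def ..
    also have "\<dots> \<le> sqrt n / 2 * (1024 * A ^ 4 / n) + 1 / (2 * sqrt n) * exp (4 * A\<^sup>2 * (2 * K)\<^sup>2)"
      using n0 by (intro add_mono mult_left_mono quad_var_concentration[OF a b] m_le) (use s ResK in auto)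
    also have "\<dots> = (1024 * A ^ 4 + exp (16 * A\<^sup>2 * K\<^sup>2)) / 2 / sqrt n"
    proof -
      have "sqrt n / n = 1 / sqrt n" using n0 by (simp add: field_simps)
      moreover have "sqrt n / 2 * (1024 * A ^ 4 / n) = 1024 * A ^ 4 / 2 * (sqrt n / n)" by simp
      ultimately have "sqrt n / 2 * (1024 * A ^ 4 / n) = 1024 * A ^ 4 / 2 / sqrt n" by simp
      then show ?thesis by (simp add: power_mult_distrib add_divide_distrib mult_ac)
    qed
    finally show ?thesis .
  qed
  have "norm (cexpec (\<lambda>\<pi>. of_real (norm_stat I b \<pi>) * e \<pi>) - s * of_real ?v * cexpec e)
     \<le> norm (cexpec (\<lambda>\<pi>. of_real (norm_stat I b \<pi>) * e \<pi>) - s * cexpec (\<lambda>\<pi>. of_real (quad_var a b \<pi>) * e \<pi>))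
       + norm (s * (cexpec (\<lambda>\<pi>. of_real (quad_var a b \<pi>) * e \<pi>) - of_real ?v * cexpec e))"
    by (rule order_trans[OF _ norm_triangle_ineq]) (simp add: algebra_simps)
  also have "\<dots> \<le> 16 * A ^ 3 * K\<^sup>2 * exp (4 * A * K) * exp (4 * A\<^sup>2 * K\<^sup>2) / sqrt n
      + K * ((1024 * A ^ 4 + exp (16 * A\<^sup>2 * K\<^sup>2)) / 2 / sqrt n)"
    unfolding norm_mult by (intro add_mono part1 mult_mono part2 s K0) auto
  finally show ?thesis by (simp add: stein_const_def add_divide_distrib algebra_simps)
qed

lemma quad_var_nonneg: "expec (quad_var a a) \<ge> 0"
  unfolding quad_var_def by (intro U.expec_nonneg divide_nonneg_nonneg sum_nonneg) auto

text \<open>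
  For \<open>s = \<i> t\<close> the identity says that \<open>M t = E (exp (\<i> t S))\<close> almost solves \<open>M' = - t v M\<close>.  After
  multiplication with the integrating factor \<open>exp (t\<^sup>2 v / 2)\<close> the derivative is small, and the mean
  value inequality on \<open>[0, 1]\<close> applies.
\<close>

corollary char_fun_approx:
  assumes a: "bounded_by A a"
  shows "norm (cexpec (\<lambda>\<pi>. cis (norm_stat I a \<pi>)) - of_real (exp (- expec (quad_var a a) / 2)))
    \<le> stein_const A 1 / sqrt n"
proof -
  define v where "v = expec (quad_var a a)"
  have v0: "v \<ge> 0" unfolding v_def by (rule quad_var_nonneg)
  let ?C = "stein_const A 1 / sqrt n"
  define e where "e t \<pi> = exp ((\<i> * of_real t) * of_real (norm_stat I a \<pi>))" for t \<pi>
  define M where "M t = cexpec (e t)" for t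
  define M' where "M' t = cexpec (\<lambda>\<pi>. of_real (norm_stat I a \<pi>) * e t \<pi>)" for t
  define N where "N t = M t * of_real (exp (t\<^sup>2 * v / 2))" for t
  define N' where "N' t = (\<i> * M' t + of_real (t * v) * M t) * of_real (exp (t\<^sup>2 * v / 2))" for t
  have dM: "(M has_vector_derivative \<i> * M' t) (at t)" for t
  proof -
    have 1: "((\<lambda>t. e t \<pi>) has_vector_derivative \<i> * of_real (norm_stat I a \<pi>) * e t \<pi>) (at t)" for \<pi>
      unfolding e_def
      by (rule has_vector_derivative_eq_rhs, rule field_vector_diff_chain_at[where g = exp, unfolded o_def])
         (auto intro!: derivative_eq_intros)
    have "((\<lambda>t. (\<Sum>\<pi>\<in>perms. e t \<pi>) / of_nat (card perms)) has_vector_derivative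
        (\<Sum>\<pi>\<in>perms. \<i> * of_real (norm_stat I a \<pi>) * e t \<pi>) / of_nat (card perms)) (at t)"
      by (intro has_vector_derivative_divide has_vector_derivative_sum 1)
    then show ?thesis
      unfolding M_def[abs_def] M'_def cexpec_def by (simp add: sum_distrib_left mult.assoc)
  qed
  have dN: "(N has_vector_derivative N' t) (at t)" for t
  proof -
    have "((\<lambda>t. complex_of_real (exp (t\<^sup>2 * v / 2))) has_vector_derivative of_real (t * v * exp (t\<^sup>2 * v / 2))) (at t)"
      by (intro has_vector_derivative_of_real) (auto intro!: derivative_eq_intros)
    from has_vector_derivative_mult[OF dM this] show ?thesis
      unfolding N_def[abs_def] N'_def by (rule has_vector_derivative_eq_rhs) (simp add: algebra_simps)
  qed
  have bound: "norm (N' t) \<le> ?C * exp (v / 2)" if t: "0 < t" "t < 1" for t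
  proof -
    have "norm (M' t - (\<i> * of_real t) * of_real v * M t) \<le> ?C"
      unfolding M'_def M_def v_def e_def[abs_def]
      by (rule stein_identity[OF a a]) (use t in \<open>auto simp: norm_mult\<close>)
    moreover have "\<i> * M' t + of_real (t * v) * M t = \<i> * (M' t - (\<i> * of_real t) * of_real v * M t)"
      by (simp add: algebra_simps)
    ultimately have 1: "norm (\<i> * M' t + of_real (t * v) * M t) \<le> ?C" by (simp add: norm_mult)
    have "t\<^sup>2 \<le> 1" using t by (simp add: power_le_one)
    then have "exp (t\<^sup>2 * v / 2) \<le> exp (v / 2)" using v0 mult_right_mono[of "t\<^sup>2" 1 v] by simp
    then show ?thesis unfolding N'_def norm_mult norm_of_real abs_exp_cancel
      using 1 by (intro mult_mono order_trans[OF norm_ge_zero 1]) auto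
  qed
  obtain x where "0 < x" "x < 1" and x: "norm (N 1 - N 0) \<le> norm ((1 - 0) *\<^sub>R N' x)"
  proof -
    have "\<exists>x\<in>{0<..<1}. norm (N 1 - N 0) \<le> norm ((\<lambda>h. h *\<^sub>R N' x) (1 - 0))"
    proof (rule mvt_general)
      show "continuous_on {0..1} N"
        using dN by (intro continuous_at_imp_continuous_on ballI) (blast intro: has_vector_derivative_continuous)
      show "(N has_derivative (\<lambda>h. h *\<^sub>R N' t)) (at t)" for t
        using dN by (simp add: has_vector_derivative_def)
    qed simp
    then show ?thesis using that by auto
  qed
  then have N01: "norm (N 1 - N 0) \<le> ?C * exp (v / 2)" using bound by force
  have N0: "N 0 = 1" using U.finite_perms U.perms_ne by (simp add: N_def M_def cexpec_def e_def)
  have M1: "M 1 = cexpec (\<lambda>\<pi>. cis (norm_stat I a \<pi>))" by (simp add: M_def e_def[abs_def] cis_conv_exp)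
  have "M 1 - of_real (exp (- v / 2)) = of_real (exp (- v / 2)) * (N 1 - N 0)"
    unfolding N0 by (simp add: N_def right_diff_distrib exp_minus field_simps)
  then have "norm (M 1 - of_real (exp (- v / 2))) = exp (- v / 2) * norm (N 1 - N 0)"
    by (simp add: norm_mult)
  also have "\<dots> \<le> exp (- v / 2) * (?C * exp (v / 2))" by (intro mult_left_mono N01) auto
  also have "\<dots> = ?C" by (simp add: exp_minus)
  finally show ?thesis unfolding M1 v_def .
qed

corollary tilted_mean_approx:
  assumes a: "bounded_by A a" and b: "bounded_by A b"
  shows "\<bar>expec (\<lambda>\<pi>. norm_stat I b \<pi> * exp (norm_stat I a \<pi>))
      - expec (quad_var a b) * expec (\<lambda>\<pi>. exp (norm_stat I a \<pi>))\<bar> \<le> stein_const A 1 / sqrt n"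
proof -
  have e: "exp (1 * complex_of_real (norm_stat I a \<pi>)) = of_real (exp (norm_stat I a \<pi>))" for \<pi>
    by (simp add: exp_of_real)
  have c1: "cexpec (\<lambda>\<pi>. of_real (norm_stat I b \<pi>) * exp (1 * complex_of_real (norm_stat I a \<pi>)))
      = of_real (expec (\<lambda>\<pi>. norm_stat I b \<pi> * exp (norm_stat I a \<pi>)))"
    unfolding cexpec_of_real[symmetric] e by simp
  have c2: "cexpec (\<lambda>\<pi>. exp (1 * complex_of_real (norm_stat I a \<pi>))) = of_real (expec (\<lambda>\<pi>. exp (norm_stat I a \<pi>)))"
    unfolding cexpec_of_real[symmetric] e ..
  have "norm (complex_of_real (expec (\<lambda>\<pi>. norm_stat I b \<pi> * exp (norm_stat I a \<pi>))
      - expec (quad_var a b) * expec (\<lambda>\<pi>. exp (norm_stat I a \<pi>)))) \<le> stein_const A 1 / sqrt n"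
    using stein_identity[OF a b, of 1 1] unfolding c1 c2 by simp
  then show ?thesis unfolding norm_of_real .
qed

lemma expec_norm_stat: "expec (norm_stat I a) = 0"
proof -
  have "of_real (expec (norm_stat I a)) = cexpec (\<lambda>\<pi>. of_real (norm_stat I a \<pi>) * 1)"
    using cexpec_of_real[of "norm_stat I a"] by simp
  also have "\<dots> = 0" unfolding cexpec_norm_stat by (simp add: cexpec_def)
  finally show ?thesis by simp
qed

text \<open>
  This keeps the normalising constant of the tilted law away from \<open>0\<close>.
\<close>

lemma mgf_ge_1: "expec (\<lambda>\<pi>. exp (norm_stat I a \<pi>)) \<ge> 1"
proof -
  have "1 = expec (\<lambda>\<pi>. 1 + norm_stat I a \<pi>)"
    using expec_norm_stat[of a] U.expec_linear(1)[of "\<lambda>_. 1" "norm_stat I a"] U.expec_const[of 1] by simp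
  also have "\<dots> \<le> expec (\<lambda>\<pi>. exp (norm_stat I a \<pi>))" by (intro U.expec_mono exp_ge_add_one_self)
  finally show ?thesis .
qed

end

section \<open>The multivariate normal distribution\<close>

text \<open>
  By decomposition into elementary maps: singular maps have negligible images, stretchings multiply
  the volume by the product of the factors, and permutations of coordinates and shears preserve
  the volume of boxes.
\<close>

proposition measure_linear_image_finite:
  fixes f :: "real ^ 'n \<Rightarrow> real ^ 'n"
  assumes "linear f"
  shows "\<forall>S\<in>lmeasurable. f ` S \<in> lmeasurable \<and> measure lebesgue (f ` S) = \<bar>det (matrix f)\<bar> * measure lebesgue S"
    (is "?P f")
proof (rule induct_linear_elementary[OF assms])
  fix f g :: "real ^ 'n \<Rightarrow> real ^ 'n"
  assume *: "linear f" "linear g" "?P f" "?P g"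
  show "?P (f \<circ> g)"
  proof
    fix S :: "(real ^ 'n) set" assume "S \<in> lmeasurable"
    then have g: "g ` S \<in> lmeasurable" "measure lebesgue (g ` S) = \<bar>det (matrix g)\<bar> * measure lebesgue S"
      using *(4) by blast+
    then have "f ` g ` S \<in> lmeasurable" "measure lebesgue (f ` g ` S) = \<bar>det (matrix f)\<bar> * measure lebesgue (g ` S)"
      using *(3) by blast+
    then show "(f \<circ> g) ` S \<in> lmeasurable \<and> measure lebesgue ((f \<circ> g) ` S) = \<bar>det (matrix (f \<circ> g))\<bar> * measure lebesgue S"
      unfolding image_comp[symmetric] matrix_compose[OF *(2,1)] det_mul abs_mult g(2) mult.assoc by blast
  qed
next
  fix f :: "real ^ 'n \<Rightarrow> real ^ 'n" and i
  assume lin: "linear f" and zero: "\<And>x. f x $ i = 0"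
  have "\<not> surj f"
  proof
    assume "surj f"
    then obtain x where "axis i 1 = f x" by (metis surjD)
    then have "f x $ i = 1" by (metis axis_nth)
    then show False using zero by simp
  qed
  then have ninj: "\<not> inj f" using linear_injective_imp_surjective[OF lin] by blast
  then have "det (matrix f) = 0" using det_nz_iff_inj[OF lin] by blast
  moreover have "negligible (f ` S)" for S by (rule negligible_linear_singular_image[OF lin ninj])
  ultimately show "?P f" by (simp add: negligible_iff_measure)
next
  fix c :: "'n \<Rightarrow> real"
  have "matrix (\<lambda>x. \<chi> i. c i * x $ i) = (\<chi> i j. if i = j then c i else 0)"
    by (simp add: matrix_def axis_def vec_eq_iff)
  then have "det (matrix (\<lambda>x. \<chi> i. c i * x $ i)) = prod c UNIV"
    by (simp add: det_diagonal)
  then show "?P (\<lambda>x. \<chi> i. c i * x $ i)" by (simp add: measurable_stretch measure_stretch)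
next
  fix m n :: 'n
  let ?t = "Transposition.transpose m n"
  let ?h = "\<lambda>x :: real ^ 'n. \<chi> i. x $ ?t i"
  have lin: "linear ?h" by (rule linearI) (simp_all add: vec_eq_iff)
  have "?h \<circ> ?h = id" by (simp add: fun_eq_iff vec_eq_iff)
  then have "det (matrix ?h) * det (matrix ?h) = 1"
    unfolding det_mul[symmetric] matrix_compose[OF lin lin, symmetric] by (simp add: matrix_id_mat_1)
  then have det1: "\<bar>det (matrix ?h)\<bar> = 1" by (simp add: abs_square_eq_1[symmetric] power2_eq_square)
  have "measure lebesgue (?h ` cbox a b) = measure lebesgue (cbox a b)" for a b
  proof -
    have eq: "?h ` cbox a b = cbox (?h a) (?h b)"
    proof (intro equalityI subsetI)
      fix x assume x: "x \<in> cbox (?h a) (?h b)"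
      have "?h x \<in> cbox a b" unfolding mem_box_cart
      proof
        fix i show "a $ i \<le> ?h x $ i \<and> ?h x $ i \<le> b $ i"
          using x[unfolded mem_box_cart, rule_format, of "?t i"] by simp
      qed
      moreover have "x = ?h (?h x)" by (simp add: vec_eq_iff)
      ultimately show "x \<in> ?h ` cbox a b" by blast
    qed (auto simp: mem_box_cart)
    show ?thesis
    proof (cases "cbox a b = {}")
      case False
      then have "cbox (?h a) (?h b) \<noteq> {}" unfolding eq[symmetric] by simp
      then show ?thesis
        using False prod.permute[OF permutes_swap_id[of m UNIV n], of "\<lambda>i. b $ i - a $ i"]
        by (simp add: eq content_cbox_cart o_def)
    qed simp
  qed
  then have boxes: "measure lebesgue (?h ` cbox a b) = 1 * measure lebesgue (cbox a b)" for a b by simp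
  show "?P ?h"
  proof
    fix S :: "(real ^ 'n) set" assume S: "S \<in> lmeasurable"
    have "?h ` S \<in> lmeasurable \<and> 1 * measure lebesgue S = measure lebesgue (?h ` S)"
      by (rule measure_linear_sufficient[OF lin S boxes])
    then show "?h ` S \<in> lmeasurable \<and> measure lebesgue (?h ` S) = \<bar>det (matrix ?h)\<bar> * measure lebesgue S"
      unfolding det1 by simp
  qed
next
  fix m n :: 'n
  assume mn: "m \<noteq> n"
  let ?h = "\<lambda>x :: real ^ 'n. \<chi> i. if i = m then x $ m + x $ n else x $ i"
  have lin: "linear ?h" by (rule linearI) (auto simp: vec_eq_iff algebra_simps)
  have "matrix ?h = (\<chi> k. if k = m then row m (mat 1) + 1 *s row n (mat 1) else row k (mat 1))"
    by (auto simp: matrix_def vec_eq_iff row_def mat_def axis_def)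
  then have det1: "det (matrix ?h) = 1" using det_row_operation[OF mn, of "mat 1 :: real ^ 'n ^ 'n" 1] by simp
  have "measure lebesgue (?h ` cbox a b) = measure lebesgue (cbox a b)" for a b
  proof (cases "cbox a b = {}")
    case False
    have "cbox a b = (+) a ` cbox 0 (b - a)"
      by (simp add: cbox_translation[symmetric])
    moreover have "?h ` ((+) a ` S) = (+) (?h a) ` ?h ` S" for S
      using linear_add[OF lin] by (auto simp: image_image)
    moreover have "measure lebesgue (?h ` cbox 0 (b - a)) = measure lebesgue (cbox 0 (b - a))"
    proof (rule measure_shear_interval[OF mn])
      show "cbox 0 (b - a) \<noteq> {}" using False by (auto simp: interval_ne_empty_cart)
    qed simp
    ultimately show ?thesis by (simp add: measure_translation)
  qed simp
  then have boxes: "measure lebesgue (?h ` cbox a b) = 1 * measure lebesgue (cbox a b)" for a b by simp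
  show "?P ?h"
  proof
    fix S :: "(real ^ 'n) set" assume S: "S \<in> lmeasurable"
    have "?h ` S \<in> lmeasurable \<and> 1 * measure lebesgue S = measure lebesgue (?h ` S)"
      by (rule measure_linear_sufficient[OF lin S boxes])
    then show "?h ` S \<in> lmeasurable \<and> measure lebesgue (?h ` S) = \<bar>det (matrix ?h)\<bar> * measure lebesgue S"
      unfolding det1 by simp
  qed
qed

lemma lborel_linear:
  fixes f :: "real ^ 'n \<Rightarrow> real ^ 'n"
  assumes lin: "linear f" and det: "det (matrix f) \<noteq> 0"
  shows "lborel = density (distr lborel borel f) (\<lambda>_. ennreal \<bar>det (matrix f)\<bar>)"
proof (rule lborel_eqI)
  have inj: "inj f" using det det_nz_iff_inj[OF lin] by blast
  then have surj: "surj f" using linear_injective_imp_surjective[OF lin] by blast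
  have f[measurable]: "f \<in> borel_measurable borel"
    by (intro borel_measurable_continuous_onI linear_continuous_on lin[unfolded linear_conv_bounded_linear])
  fix l u :: "real ^ 'n" assume le: "\<And>b. b \<in> Basis \<Longrightarrow> l \<bullet> b \<le> u \<bullet> b"
  define g where "g = inv f"
  have gf: "f (g x) = x" "g (f x) = x" for x
    unfolding g_def using surj inj by (auto simp: surj_f_inv_f)
  have ling: "linear g" unfolding g_def using lin inj surj
    by (metis inj_linear_imp_inv_linear)
  have dets: "det (matrix f) * det (matrix g) = 1"
  proof -
    have "f \<circ> g = id" using gf by auto
    then show ?thesis unfolding det_mul[symmetric] matrix_compose[OF ling lin, symmetric]
      by (simp add: matrix_id_mat_1)
  qed
  have pre: "f -` box l u = g ` box l u" using gf by (auto simp: image_iff) (metis gf(2))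
  have lm: "g ` box l u \<in> lmeasurable" "measure lebesgue (g ` box l u) = \<bar>det (matrix g)\<bar> * measure lebesgue (box l u)"
    using measure_linear_image_finite[OF ling] lmeasurable_box by blast+
  have meas: "f -` box l u \<in> sets borel" using measurable_sets_borel[OF f, of "box l u"] by simp
  have "emeasure (density (distr lborel borel f) (\<lambda>_. ennreal \<bar>det (matrix f)\<bar>)) (box l u)
      = ennreal \<bar>det (matrix f)\<bar> * emeasure lborel (f -` box l u)"
    by (simp add: emeasure_density nn_integral_cmult_indicator emeasure_distr)
  also have "emeasure lborel (f -` box l u) = emeasure lebesgue (g ` box l u)"
    using meas by (simp add: pre)
  also have "\<dots> = ennreal (\<bar>det (matrix g)\<bar> * measure lebesgue (box l u))"
    unfolding emeasure_eq_measure2[OF lm(1)] lm(2) ..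
  also have "ennreal \<bar>det (matrix f)\<bar> * \<dots> = ennreal (measure lebesgue (box l u))"
  proof -
    have "\<bar>det (matrix f)\<bar> * (\<bar>det (matrix g)\<bar> * x) = x" for x
      using dets unfolding mult.assoc[symmetric] abs_mult[symmetric] by simp
    then show ?thesis by (simp add: ennreal_mult'[symmetric])
  qed
  also have "measure lebesgue (box l u) = (\<Prod>b\<in>Basis. (u - l) \<bullet> b)"
    using le by (simp add: measure_lborel_box)
  finally show "emeasure (density (distr lborel borel f) (\<lambda>_. ennreal \<bar>det (matrix f)\<bar>)) (box l u)
      = (\<Prod>b\<in>Basis. (u - l) \<bullet> b)" by (simp add: prod_ennreal le inner_diff_left)
qed simp

definition gauss :: "'a::euclidean_space \<Rightarrow> real" where
  "gauss x = (\<Prod>b\<in>Basis. std_normal_density (x \<bullet> b))"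

lemma gauss_eq: "gauss (x :: 'a::euclidean_space) = exp (- (x \<bullet> x) / 2) / sqrt ((2 * pi) ^ DIM('a))"
proof -
  have "gauss x = (\<Prod>b\<in>(Basis :: 'a set). 1 / sqrt (2 * pi)) * exp (\<Sum>b\<in>Basis. - (x \<bullet> b)\<^sup>2 / 2)"
    unfolding gauss_def std_normal_density_def prod.distrib by (simp add: exp_sum)
  also have "(\<Sum>b\<in>Basis. - (x \<bullet> b)\<^sup>2 / 2) = - (x \<bullet> x) / 2"
    by (simp add: euclidean_inner[of x x] sum_divide_distrib[symmetric] sum_negf power2_eq_square)
  also have "(\<Prod>b\<in>(Basis :: 'a set). 1 / sqrt (2 * pi)) = 1 / sqrt ((2 * pi) ^ DIM('a))"
    by (simp add: power_one_over real_sqrt_power[symmetric])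
  finally show ?thesis by simp
qed

lemma gauss_nonneg: "gauss x \<ge> 0"
  unfolding gauss_eq by simp

lemma gauss_measurable[measurable]: "gauss \<in> borel_measurable borel"
  unfolding gauss_eq[abs_def] by measurable

text \<open>
  The Lebesgue measure is the image of a product measure over the basis, and the integrand
  factorises into one-dimensional normal characteristic functions.
\<close>

lemma gauss_char:
  fixes t :: "'a::euclidean_space"
  shows "integrable lborel (\<lambda>x. complex_of_real (gauss x) * cis (t \<bullet> x))"
    and "(\<integral>x. complex_of_real (gauss x) * cis (t \<bullet> x) \<partial>lborel) = of_real (exp (- (t \<bullet> t) / 2))"
proof -
  interpret product_sigma_finite "\<lambda>_ :: 'a. lborel :: real measure" ..
  define h where "h b y = complex_of_real (std_normal_density y) * cis ((t \<bullet> b) * y)" for b y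
  have prod: "complex_of_real (gauss x) * cis (t \<bullet> x) = (\<Prod>b\<in>Basis. h b (x \<bullet> b))" for x
  proof -
    have "cis (t \<bullet> x) = (\<Prod>b\<in>Basis. cis ((t \<bullet> b) * (x \<bullet> b)))"
      unfolding cis_conv_exp by (subst euclidean_inner) (simp add: exp_sum[symmetric] sum_distrib_left)
    then show ?thesis by (simp add: h_def gauss_def prod.distrib)
  qed
  have h: "integrable lborel (h b)" "(\<integral>y. h b y \<partial>lborel) = of_real (exp (- (t \<bullet> b)\<^sup>2 / 2))" for b
  proof -
    have "integrable lborel (\<lambda>y. std_normal_density y *\<^sub>R cis ((t \<bullet> b) * y))"
      by (rule Bochner_Integration.integrable_bound[OF integrable_normal_density[of 1 0]])
         (auto simp: cis_conv_exp)
    then show "integrable lborel (h b)" by (simp add: h_def[abs_def] scaleR_conv_of_real)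
    have "char std_normal_distribution (t \<bullet> b) = (\<integral>y. std_normal_density y *\<^sub>R iexp ((t \<bullet> b) * y) \<partial>lborel)"
      unfolding char_def by (subst integral_density) auto
    then show "(\<integral>y. h b y \<partial>lborel) = of_real (exp (- (t \<bullet> b)\<^sup>2 / 2))"
      unfolding char_std_normal_distribution h_def by (simp add: scaleR_conv_of_real cis_conv_exp mult.commute)
  qed
  have m: "(\<lambda>f. \<Sum>b\<in>Basis. f b *\<^sub>R b) \<in> (\<Pi>\<^sub>M b\<in>(Basis :: 'a set). lborel) \<rightarrow>\<^sub>M borel"
    by measurable
  have hm: "(\<lambda>x :: 'a. \<Prod>b\<in>Basis. h b (x \<bullet> b)) \<in> borel_measurable borel"
    unfolding h_def cis_conv_exp by measurable
  have coord: "(\<Prod>b\<in>Basis. h b ((\<Sum>b\<in>Basis. f b *\<^sub>R b) \<bullet> b)) = (\<Prod>b\<in>Basis. h b (f b))" for f :: "'a \<Rightarrow> real"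
    by (intro prod.cong refl) (simp add: inner_sum_left_Basis)
  show "integrable lborel (\<lambda>x. complex_of_real (gauss x) * cis (t \<bullet> x))"
    unfolding prod by (subst lborel_eq, subst integrable_distr_eq[OF m hm], unfold coord)
      (rule product_integrable_prod, auto simp: h)
  have "(\<integral>x. (\<Prod>b\<in>Basis. h b (x \<bullet> b)) \<partial>(lborel :: 'a measure)) = (\<Prod>b\<in>Basis. \<integral>y. h b y \<partial>lborel)"
    by (subst lborel_eq, subst integral_distr[OF m hm], unfold coord)
      (rule product_integral_prod, auto simp: h)
  also have "\<dots> = of_real (exp (\<Sum>b\<in>Basis. - (t \<bullet> b)\<^sup>2 / 2))" unfolding h by (simp add: exp_sum)
  also have "(\<Sum>b\<in>Basis. - (t \<bullet> b)\<^sup>2 / 2) = - (t \<bullet> t) / 2"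
    by (simp add: euclidean_inner[of t t] sum_divide_distrib[symmetric] sum_negf power2_eq_square)
  finally show "(\<integral>x. complex_of_real (gauss x) * cis (t \<bullet> x) \<partial>lborel) = of_real (exp (- (t \<bullet> t) / 2))"
    unfolding prod .
qed

lemma gauss_integral: "integrable lborel (gauss :: 'a::euclidean_space \<Rightarrow> real)" "(\<integral>x. gauss (x :: 'a) \<partial>lborel) = 1"
proof -
  have "integrable lborel (\<lambda>x::'a. complex_of_real (gauss x))" using gauss_char(1)[of "0::'a"] by simp
  then show i: "integrable lborel (gauss :: 'a \<Rightarrow> real)" by (simp add: complex_of_real_integrable_eq)
  have "complex_of_real (\<integral>x. gauss (x :: 'a) \<partial>lborel) = 1" using gauss_char(2)[of "0::'a"] by simp
  then show "(\<integral>x. gauss (x :: 'a) \<partial>lborel) = 1" by simp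
qed

lemma prob_space_gauss: "prob_space (density lborel (gauss :: 'a::euclidean_space \<Rightarrow> real))"
proof
  have "(\<integral>\<^sup>+x. ennreal (gauss (x :: 'a)) \<partial>lborel) = ennreal (\<integral>x. gauss (x :: 'a) \<partial>lborel)"
    by (rule nn_integral_eq_integral[OF gauss_integral(1)]) (simp add: gauss_nonneg)
  then show "emeasure (density lborel (gauss :: 'a \<Rightarrow> real)) (space (density lborel (gauss :: 'a \<Rightarrow> real))) = 1"
    by (simp add: emeasure_density gauss_integral(2))
qed

text \<open>
  Gram--Schmidt orthonormalisation for the inner product \<open>(x, y) \<mapsto> x \<bullet> (S *v y)\<close>.
\<close>

lemma pos_def_orthonormal:
  fixes S :: "real ^ 'n ^ 'n"
  assumes sym: "transpose S = S" and pd: "\<And>d. d \<noteq> 0 \<Longrightarrow> d \<bullet> (S *v d) > 0"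
  shows "finite J \<Longrightarrow> \<exists>v. \<forall>i\<in>J. \<forall>j\<in>J. v i \<bullet> (S *v v j) = (if i = (j :: 'n) then 1 else 0)"
proof (induction J rule: finite_induct)
  case (insert k J)
  have symm: "x \<bullet> (S *v y) = y \<bullet> (S *v x)" for x y
    by (metis dot_lmul_matrix inner_commute sym transpose_matrix_vector)
  obtain v where v: "\<And>i j. i \<in> J \<Longrightarrow> j \<in> J \<Longrightarrow> v i \<bullet> (S *v v j) = (if i = j then 1 else 0)"
    using insert by blast
  have "dim (v ` J) \<le> card (v ` J)" using insert by (intro dim_le_card') auto
  also have "\<dots> \<le> card J" using insert by (intro card_image_le)
  also have "card J < CARD('n)" using insert by (intro psubset_card_mono) auto
  finally have "dim (v ` J) < DIM(real ^ 'n)" by simp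
  then have "span (v ` J) \<noteq> UNIV" by (metis dim_UNIV dim_span less_irrefl)
  then obtain x where x: "x \<notin> span (v ` J)" by blast
  define y where "y = x - (\<Sum>i\<in>J. (v i \<bullet> (S *v x)) *\<^sub>R v i)"
  have "y \<noteq> 0"
  proof
    assume "y = 0"
    then have "x = (\<Sum>i\<in>J. (v i \<bullet> (S *v x)) *\<^sub>R v i)" by (simp add: y_def)
    also have "\<dots> \<in> span (v ` J)" by (intro span_sum span_scale span_base) auto
    finally show False using x by simp
  qed
  then have q: "y \<bullet> (S *v y) > 0" by (rule pd)
  have ort: "v j \<bullet> (S *v y) = 0" if "j \<in> J" for j
  proof -
    have "v j \<bullet> (S *v y) = v j \<bullet> (S *v x) - (\<Sum>i\<in>J. (v i \<bullet> (S *v x)) * (v j \<bullet> (S *v v i)))"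
      unfolding y_def by (simp add: matrix_vector_mult_diff_distrib inner_diff_right
          linear_sum[OF matrix_vector_mul_linear] matrix_vector_mult_scaleR inner_sum_right o_def)
    also have "(\<Sum>i\<in>J. (v i \<bullet> (S *v x)) * (v j \<bullet> (S *v v i))) = (\<Sum>i\<in>J. if i = j then v i \<bullet> (S *v x) else 0)"
      by (intro sum.cong) (auto simp: v that)
    finally show ?thesis using that insert by simp
  qed
  define q where "q = sqrt (y \<bullet> (S *v y))"
  have q2: "q * q = y \<bullet> (S *v y)" "q \<noteq> 0" using q by (simp_all add: q_def)
  define u where "u = (1 / q) *\<^sub>R y"
  have uu: "u \<bullet> (S *v u) = 1"
    unfolding u_def using q2 by (simp add: matrix_vector_mult_scaleR q2(1)[symmetric])
  have vu: "v j \<bullet> (S *v u) = 0" "u \<bullet> (S *v v j) = 0" if "j \<in> J" for j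
    unfolding symm[of u "v j"] using ort[OF that] by (simp_all add: u_def matrix_vector_mult_scaleR)
  have "\<forall>i\<in>insert k J. \<forall>j\<in>insert k J.
      (v(k := u)) i \<bullet> (S *v (v(k := u)) j) = (if i = j then 1 else 0)"
    using insert(2) uu vu v by auto
  then show ?case by blast
qed simp

text \<open>
  If the columns of \<open>U\<close> are orthonormal for \<open>S\<close>, then \<open>transpose U ** S ** U = 1\<close>, so the transposed
  inverse of \<open>U\<close> is a square root of \<open>S\<close>.
\<close>

lemma pos_def_square_root:
  fixes S :: "real ^ 'n ^ 'n"
  assumes sym: "transpose S = S" and pd: "\<And>d. d \<noteq> 0 \<Longrightarrow> d \<bullet> (S *v d) > 0"
  obtains A :: "real ^ 'n ^ 'n" where "invertible A" "S = A ** transpose A"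
proof -
  obtain v where v: "\<And>i j. v i \<bullet> (S *v v j) = (if i = (j :: 'n) then 1 else 0)"
    using pos_def_orthonormal[OF sym pd finite, of UNIV] by auto
  define U where "U = (\<chi> r i. v i $ r)"
  have "transpose U ** (S ** U) = mat 1"
  proof -
    have "(transpose U ** (S ** U)) $ i $ j = v i \<bullet> (S *v v j)" for i j
      by (simp add: U_def matrix_matrix_mult_def transpose_def inner_vec_def matrix_vector_mult_def)
    then show ?thesis by (simp add: vec_eq_iff v mat_def)
  qed
  then have one: "(transpose U ** S) ** U = mat 1" by (simp add: matrix_mul_assoc)
  then have "invertible U" by (auto simp: invertible_left_inverse)
  then obtain X where X: "U ** X = mat 1" "X ** U = mat 1" by (auto simp: invertible_def)
  have "S = transpose (U ** X) ** S ** (U ** X)" by (simp add: X)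
  also have "\<dots> = transpose X ** ((transpose U ** S) ** U) ** X"
    by (simp add: matrix_transpose_mul matrix_mul_assoc)
  also have "\<dots> = transpose X ** X" unfolding one by simp
  finally have "S = transpose X ** transpose (transpose X)" by simp
  moreover have "invertible (transpose X)" using \<open>invertible U\<close> X by (metis invertible_det_nz det_transpose invertible_def)
  ultimately show ?thesis using that by blast
qed

lemma matrix_inv_mult:
  fixes S :: "real ^ 'n ^ 'n"
  assumes "invertible S"
  shows "S ** matrix_inv S = mat 1" "matrix_inv S ** S = mat 1"
  using someI_ex[OF assms[unfolded invertible_def]] unfolding matrix_inv_def by auto

theorem mv_normal_distr:
  fixes A S :: "real ^ 'n ^ 'n"
  assumes inv: "invertible A" and S: "S = A ** transpose A"
  shows "mv_normal 0 S = distr (density lborel gauss) borel ((*v) A)"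
proof -
  have detA: "det A \<noteq> 0" using inv by (simp add: invertible_det_nz)
  have mA: "matrix ((*v) A) = A" by simp
  have lin: "linear ((*v) A)" by simp
  have [measurable]: "(*v) A \<in> borel_measurable borel"
    by (intro borel_measurable_continuous_onI linear_continuous_on) (simp add: linear_conv_bounded_linear[symmetric])
  have Sinv: "invertible S" unfolding S using inv by (simp add: invertible_det_nz det_mul det_transpose)
  define dens where "dens x = exp (- (x \<bullet> (matrix_inv S *v x)) / 2) / sqrt ((2 * pi) ^ CARD('n) * det S)" for x
  have [measurable]: "dens \<in> borel_measurable borel"
  proof -
    have "(*v) (matrix_inv S) \<in> borel_measurable borel"
      by (intro borel_measurable_continuous_onI linear_continuous_on) (simp add: linear_conv_bounded_linear[symmetric])
    then show ?thesis unfolding dens_def[abs_def] by measurable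
  qed
  have key: "\<bar>det A\<bar> * dens (A *v z) = gauss z" for z
  proof -
    define w where "w = matrix_inv S *v (A *v z)"
    have "S *v w = A *v z"
      unfolding w_def using Sinv by (simp add: matrix_vector_mul_assoc matrix_mul_assoc matrix_inv_mult)
    then have "A *v (transpose A *v w) = A *v z" unfolding S by (simp only: matrix_vector_mul_assoc)
    then have "transpose A *v w = z" using inv
      by (metis invertible_def matrix_vector_mul_assoc matrix_vector_mul_lid)
    then have "(A *v z) \<bullet> w = z \<bullet> z"
      by (metis dot_lmul_matrix inner_commute transpose_matrix_vector)
    moreover have "det S = \<bar>det A\<bar>\<^sup>2" unfolding S by (simp add: det_mul det_transpose power2_eq_square)
    ultimately show ?thesis using detA
      unfolding dens_def gauss_eq w_def[symmetric] by (simp add: real_sqrt_mult)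
  qed
  have "mv_normal 0 S = density lborel (\<lambda>x. ennreal (dens x))"
    unfolding mv_normal_def dens_def by simp
  also have "\<dots> = density (density (distr lborel borel ((*v) A)) (\<lambda>_. ennreal \<bar>det A\<bar>)) (\<lambda>x. ennreal (dens x))"
    using lborel_linear[OF lin] detA unfolding mA by simp
  also have "\<dots> = density (distr lborel borel ((*v) A)) (\<lambda>x. ennreal \<bar>det A\<bar> * ennreal (dens x))"
    by (rule density_density_eq) auto
  also have "\<dots> = distr (density lborel (\<lambda>z. ennreal \<bar>det A\<bar> * ennreal (dens (A *v z)))) borel ((*v) A)"
    by (subst density_distr) auto
  also have "(\<lambda>z. ennreal \<bar>det A\<bar> * ennreal (dens (A *v z))) = (\<lambda>z. ennreal (gauss z))"
    by (simp add: ennreal_mult'[symmetric] key)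
  finally show ?thesis .
qed

theorem mv_normal_char:
  fixes S :: "real ^ 'n ^ 'n"
  assumes sym: "transpose S = S" and pd: "\<And>d. d \<noteq> 0 \<Longrightarrow> d \<bullet> (S *v d) > 0"
  shows "prob_space (mv_normal 0 S)"
    and "(\<integral>x. cis (d \<bullet> x) \<partial>mv_normal 0 S) = of_real (exp (- (d \<bullet> (S *v d)) / 2))"
proof -
  obtain A :: "real ^ 'n ^ 'n" where A: "invertible A" "S = A ** transpose A"
    by (rule pos_def_square_root[OF sym pd])
  have m[measurable]: "(*v) A \<in> borel_measurable borel"
    by (intro borel_measurable_continuous_onI linear_continuous_on) (simp add: linear_conv_bounded_linear[symmetric])
  interpret G: prob_space "density lborel (gauss :: real ^ 'n \<Rightarrow> real)" by (rule prob_space_gauss)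
  show "prob_space (mv_normal 0 S)"
    unfolding mv_normal_distr[OF A] by (rule G.prob_space_distr) simp
  define t where "t = transpose A *v d"
  have dt: "d \<bullet> (A *v z) = t \<bullet> z" for z
    unfolding t_def by (metis dot_lmul_matrix inner_commute transpose_matrix_vector)
  have "(\<integral>x. cis (d \<bullet> x) \<partial>mv_normal 0 S) = (\<integral>z. cis (t \<bullet> z) \<partial>density lborel gauss)"
    unfolding mv_normal_distr[OF A] dt[symmetric] by (rule integral_distr) (auto simp: cis_conv_exp)
  also have "\<dots> = (\<integral>z. gauss z *\<^sub>R cis (t \<bullet> z) \<partial>lborel)"
    by (rule integral_density) (auto simp: gauss_nonneg cis_conv_exp)
  also have "\<dots> = of_real (exp (- (t \<bullet> t) / 2))" using gauss_char(2)[of t] by (simp add: scaleR_conv_of_real)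
  also have "t \<bullet> t = d \<bullet> (S *v d)"
  proof -
    have "A *v t = S *v d" unfolding t_def A(2) by (rule matrix_vector_mul_assoc)
    then show ?thesis by (simp only: dt[symmetric])
  qed
  finally show "(\<integral>x. cis (d \<bullet> x) \<partial>mv_normal 0 S) = of_real (exp (- (d \<bullet> (S *v d)) / 2))" .
qed

section \<open>Convergence of characteristic functions implies convergence in distribution\<close>

definition std_gauss :: "'a::euclidean_space measure" where
  "std_gauss = density lborel gauss"

lemma sets_std_gauss[measurable_cong, simp]: "sets std_gauss = sets borel"
  and space_std_gauss[simp]: "space std_gauss = UNIV"
  by (simp_all add: std_gauss_def)

lemma prob_space_std_gauss: "prob_space std_gauss"
  unfolding std_gauss_def by (rule prob_space_gauss)

lemma std_gauss_char: "(\<integral>x. cis (t \<bullet> x) \<partial>std_gauss) = of_real (exp (- (t \<bullet> t) / 2))"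
proof -
  have "(\<integral>x. cis (t \<bullet> x) \<partial>std_gauss) = (\<integral>x. gauss x *\<^sub>R cis (t \<bullet> x) \<partial>lborel)"
    unfolding std_gauss_def by (rule integral_density) (auto simp: gauss_nonneg cis_conv_exp)
  then show ?thesis using gauss_char(2)[of t] by (simp add: scaleR_conv_of_real)
qed

lemma cis_inner_measurable[measurable]:
  "f \<in> borel_measurable M \<Longrightarrow> (\<lambda>x. cis (f x)) \<in> borel_measurable M"
  unfolding cis_conv_exp by measurable

lemma (in prob_space) integrable_bounded:
  fixes f :: "'a \<Rightarrow> 'b::{banach, second_countable_topology}"
  shows "f \<in> borel_measurable M \<Longrightarrow> (\<And>x. norm (f x) \<le> B) \<Longrightarrow> integrable M f"
  by (rule integrable_const_bound[where B = B]) auto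

text \<open>
  A Gaussian kernel is the characteristic function of a Gaussian vector.  By Fubini its mean under \<open>M\<close>
  is therefore a Gaussian average of the characteristic function of \<open>M\<close>, for which dominated
  convergence is available.
\<close>

lemma gauss_kernel_char:
  fixes M :: "'a::euclidean_space measure"
  assumes M: "prob_space M" and sets[measurable_cong]: "sets M = sets borel"
  shows "complex_of_real (\<integral>x. exp (- ((x - c) \<bullet> (x - c)) * \<epsilon>\<^sup>2 / 2) \<partial>M)
    = (\<integral>t. cis (- (\<epsilon> * (c \<bullet> t))) * (\<integral>x. cis ((\<epsilon> *\<^sub>R t) \<bullet> x) \<partial>M) \<partial>std_gauss)"
proof -
  interpret M: prob_space M by (rule M)
  interpret G: prob_space "std_gauss :: 'a measure" by (rule prob_space_std_gauss)
  interpret P: pair_prob_space M "std_gauss :: 'a measure" ..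
  let ?F = "\<lambda>x t. cis ((\<epsilon> *\<^sub>R (x - c)) \<bullet> t)"
  have int: "integrable (M \<Otimes>\<^sub>M std_gauss) (\<lambda>(x, t). ?F x t)"
    by (rule P.integrable_bounded[where B = 1]) (auto split: prod.split)
  have "complex_of_real (\<integral>x. exp (- ((x - c) \<bullet> (x - c)) * \<epsilon>\<^sup>2 / 2) \<partial>M)
      = (\<integral>x. complex_of_real (exp (- ((x - c) \<bullet> (x - c)) * \<epsilon>\<^sup>2 / 2)) \<partial>M)"
    by (rule integral_complex_of_real[symmetric])
  also have "\<dots> = (\<integral>x. (\<integral>t. ?F x t \<partial>std_gauss) \<partial>M)"
    unfolding std_gauss_char by (simp add: power2_eq_square mult_ac)
  also have "\<dots> = (\<integral>t. (\<integral>x. ?F x t \<partial>M) \<partial>std_gauss)"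
    by (rule P.Fubini_integral[OF int, symmetric])
  also have "\<dots> = (\<integral>t. cis (- (\<epsilon> * (c \<bullet> t))) * (\<integral>x. cis ((\<epsilon> *\<^sub>R t) \<bullet> x) \<partial>M) \<partial>std_gauss)"
  proof (rule Bochner_Integration.integral_cong[OF refl])
    fix t
    have "?F x t = cis (- (\<epsilon> * (c \<bullet> t))) * cis ((\<epsilon> *\<^sub>R t) \<bullet> x)" for x
      unfolding cis_mult by (simp add: inner_diff_left inner_diff_right right_diff_distrib inner_commute)
    then show "(\<integral>x. ?F x t \<partial>M) = cis (- (\<epsilon> * (c \<bullet> t))) * (\<integral>x. cis ((\<epsilon> *\<^sub>R t) \<bullet> x) \<partial>M)"
      by simp
  qed
  finally show ?thesis .
qed

lemma norm_char_le_1: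
  assumes "prob_space M"
  shows "norm (\<integral>x. cis (f x) \<partial>M) \<le> 1"
proof -
  interpret prob_space M by (rule assms)
  have "norm (\<integral>x. cis (f x) \<partial>M) \<le> (\<integral>x. norm (cis (f x)) \<partial>M)" by (rule integral_norm_bound)
  then show ?thesis by (simp add: prob_space)
qed

lemma char_measurable:
  fixes M :: "'a::euclidean_space measure"
  assumes M: "prob_space M" and [measurable_cong]: "sets M = sets borel"
  shows "(\<lambda>t::'a. \<integral>x. cis ((\<epsilon> *\<^sub>R t) \<bullet> x) \<partial>M) \<in> borel_measurable borel"
proof -
  interpret M: prob_space M by (rule M)
  show ?thesis by measurable
qed

locale char_convergence =
  fixes \<nu> :: "nat \<Rightarrow> 'a::euclidean_space measure" and N :: "'a measure"
  assumes prob_\<nu>: "\<And>n. prob_space (\<nu> n)" and sets_\<nu>[measurable_cong]: "\<And>n. sets (\<nu> n) = sets borel"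
    and prob_N: "prob_space N" and sets_N[measurable_cong]: "sets N = sets borel"
    and char: "\<And>t. (\<lambda>n. \<integral>x. cis (t \<bullet> x) \<partial>\<nu> n) \<longlonglongrightarrow> (\<integral>x. cis (t \<bullet> x) \<partial>N)"
begin

lemma conv_gauss_kernel:
  "(\<lambda>n. \<integral>x. exp (- ((x - c) \<bullet> (x - c)) * \<epsilon>\<^sup>2 / 2) \<partial>\<nu> n) \<longlonglongrightarrow> (\<integral>x. exp (- ((x - c) \<bullet> (x - c)) * \<epsilon>\<^sup>2 / 2) \<partial>N)"
proof -
  interpret G: prob_space "std_gauss :: 'a measure" by (rule prob_space_std_gauss)
  have [measurable]: "(\<lambda>t::'a. \<integral>x. cis ((\<epsilon> *\<^sub>R t) \<bullet> x) \<partial>\<nu> n) \<in> borel_measurable borel" for n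
    by (rule char_measurable[OF prob_\<nu> sets_\<nu>])
  have [measurable]: "(\<lambda>t::'a. \<integral>x. cis ((\<epsilon> *\<^sub>R t) \<bullet> x) \<partial>N) \<in> borel_measurable borel"
    by (rule char_measurable[OF prob_N sets_N])
  have "(\<lambda>n. complex_of_real (\<integral>x. exp (- ((x - c) \<bullet> (x - c)) * \<epsilon>\<^sup>2 / 2) \<partial>\<nu> n))
      \<longlonglongrightarrow> complex_of_real (\<integral>x. exp (- ((x - c) \<bullet> (x - c)) * \<epsilon>\<^sup>2 / 2) \<partial>N)"
    unfolding gauss_kernel_char[OF prob_\<nu> sets_\<nu>] gauss_kernel_char[OF prob_N sets_N]
  proof (rule integral_dominated_convergence[where w = "\<lambda>_. 1"])
    show "AE t in std_gauss. (\<lambda>n. cis (- (\<epsilon> * (c \<bullet> t))) * (\<integral>x. cis ((\<epsilon> *\<^sub>R t) \<bullet> x) \<partial>\<nu> n))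
        \<longlonglongrightarrow> cis (- (\<epsilon> * (c \<bullet> t))) * (\<integral>x. cis ((\<epsilon> *\<^sub>R t) \<bullet> x) \<partial>N)"
      by (intro AE_I2 tendsto_mult tendsto_const char)
    show "AE t in std_gauss. norm (cis (- (\<epsilon> * (c \<bullet> t))) * (\<integral>x. cis ((\<epsilon> *\<^sub>R t) \<bullet> x) \<partial>\<nu> n)) \<le> 1" for n
      using norm_char_le_1[OF prob_\<nu>] by (intro AE_I2) (simp add: norm_mult)
  qed (auto simp del: inner_scaleR_left)
  then show ?thesis by (simp only: tendsto_of_real_iff)
qed

end

text \<open>
  Convolution with the centred normal law of covariance \<open>s\<^sup>2\<close> times the identity.
\<close>

definition smooth :: "real \<Rightarrow> ('a::euclidean_space \<Rightarrow> real) \<Rightarrow> 'a \<Rightarrow> real" where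
  "smooth s g x = (\<integral>z. g (x + s *\<^sub>R z) \<partial>std_gauss)"

lemma smooth_eq:
  fixes g :: "'a::euclidean_space \<Rightarrow> real"
  assumes s: "s > 0" and g[measurable]: "g \<in> borel_measurable borel"
  shows "smooth s g x = (\<integral>y. g y * gauss ((1 / s) *\<^sub>R (y - x)) \<partial>lborel) / s ^ DIM('a)"
proof -
  have "(\<integral>y. g y * gauss ((1 / s) *\<^sub>R (y - x)) \<partial>lborel)
      = (\<integral>y. g y * gauss ((1 / s) *\<^sub>R (y - x)) \<partial>density (distr lborel borel (\<lambda>z. x + s *\<^sub>R z)) (\<lambda>_. ennreal (s ^ DIM('a))))"
    using lborel_affine[of s x] s by (simp add: ennreal_power)
  also have "\<dots> = (\<integral>y. s ^ DIM('a) *\<^sub>R (g y * gauss ((1 / s) *\<^sub>R (y - x))) \<partial>distr lborel borel (\<lambda>z. x + s *\<^sub>R z))"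
    using s by (intro integral_density) auto
  also have "\<dots> = (\<integral>z. s ^ DIM('a) *\<^sub>R (g (x + s *\<^sub>R z) * gauss z) \<partial>lborel)"
    using s by (subst integral_distr) auto
  also have "\<dots> = s ^ DIM('a) * (\<integral>z. gauss z *\<^sub>R g (x + s *\<^sub>R z) \<partial>lborel)" by (simp add: mult.commute)
  also have "(\<integral>z. gauss z *\<^sub>R g (x + s *\<^sub>R z) \<partial>lborel) = smooth s g x"
    unfolding smooth_def std_gauss_def by (rule integral_density[symmetric]) (auto simp: gauss_nonneg)
  finally show ?thesis using s by simp
qed

lemma tail_small:
  fixes M :: "'a::euclidean_space measure"
  assumes "prob_space M" and [measurable_cong]: "sets M = sets borel" and \<eta>: "\<eta> > 0"
  shows "\<exists>r::nat. measure M {x. norm x > r} < \<eta>"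
proof -
  interpret prob_space M by (rule assms)
  have sp: "space M = UNIV" using sets_eq_imp_space_eq[OF assms(2)] by simp
  have "(\<lambda>r. \<integral>x. indicator {x. norm x > real r} x \<partial>M) \<longlonglongrightarrow> (\<integral>x. 0 \<partial>M :: real)"
  proof (rule integral_dominated_convergence[where w = "\<lambda>_. 1 :: real"])
    show "AE x in M. (\<lambda>r. indicator {x. norm x > real r} x :: real) \<longlonglongrightarrow> 0"
    proof (rule AE_I2)
      fix x :: 'a
      obtain r0 :: nat where "norm x \<le> r0" using real_arch_simple by blast
      then have "eventually (\<lambda>r. indicator {x. norm x > real r} x = (0 :: real)) sequentially"
        by (intro eventually_sequentiallyI[of r0]) (auto simp: indicator_def)
      then show "(\<lambda>r. indicator {x. norm x > real r} x :: real) \<longlonglongrightarrow> 0" by (rule tendsto_eventually)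
    qed
  qed (auto simp: indicator_def)
  then have "(\<lambda>r. measure M {x. norm x > real r}) \<longlonglongrightarrow> 0" by (simp add: sp)
  then have "eventually (\<lambda>r. measure M {x. norm x > real r} < \<eta>) sequentially"
    using \<eta> by (auto dest: order_tendstoD)
  then show ?thesis by (auto simp: eventually_sequentially)
qed

lemma smooth_close:
  fixes g :: "'a::euclidean_space \<Rightarrow> real"
  assumes [measurable]: "g \<in> borel_measurable borel" and uc: "uniformly_continuous_on UNIV g"
    and B: "\<And>x. \<bar>g x\<bar> \<le> B" and \<eta>: "\<eta> > 0"
  shows "\<exists>s>0. \<forall>x. \<bar>smooth s g x - g x\<bar> \<le> \<eta>"
proof -
  interpret G: prob_space "std_gauss :: 'a measure" by (rule prob_space_std_gauss)
  have B0: "B \<ge> 0" using B[of 0] by linarith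
  obtain d where d: "d > 0" "\<And>x y. dist y x < d \<Longrightarrow> dist (g y) (g x) < \<eta> / 2"
    using uc \<eta> unfolding uniformly_continuous_on_def by (metis UNIV_I half_gt_zero)
  obtain r :: nat where r: "measure std_gauss {z::'a. norm z > r} < \<eta> / (4 * B + 4)"
    using tail_small[OF prob_space_std_gauss sets_std_gauss, where \<eta> = "\<eta> / (4 * B + 4)"] \<eta> B0 by auto
  \<comment> \<open>A shift by \<open>s *\<^sub>R z\<close> with \<open>norm z \<le> r\<close> then stays below the modulus of continuity \<open>d\<close>.\<close>
  define s where "s = d / (real r + 1)"
  have s: "s > 0" using d by (simp add: s_def)
  have "\<bar>smooth s g x - g x\<bar> \<le> \<eta>" for x
  proof -
    have pt: "\<bar>g (x + s *\<^sub>R z) - g x\<bar> \<le> \<eta> / 2 + 2 * B * indicator {z. norm z > r} z" for z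
    proof (cases "norm z > r")
      case True
      then show ?thesis using B[of "x + s *\<^sub>R z"] B[of x] \<eta> by simp
    next
      case False
      have "dist (x + s *\<^sub>R z) x = s * norm z" using s by (simp add: dist_norm)
      also have "\<dots> \<le> s * r" using False s by simp
      also have "\<dots> < d" using d by (simp add: s_def field_simps)
      finally show ?thesis using d(2)[of "x + s *\<^sub>R z" x] False by (simp add: dist_real_def)
    qed
    have i1: "integrable std_gauss (\<lambda>z. g (x + s *\<^sub>R z))"
      by (rule G.integrable_bounded[where B = B]) (auto simp: B)
    have "smooth s g x - g x = (\<integral>z. g (x + s *\<^sub>R z) - g x \<partial>std_gauss)"
      using i1 by (simp add: smooth_def G.prob_space[simplified])
    also have "\<bar>\<dots>\<bar> \<le> (\<integral>z. \<bar>g (x + s *\<^sub>R z) - g x\<bar> \<partial>std_gauss)" by (rule integral_abs_bound)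
    also have "\<dots> \<le> (\<integral>z. \<eta> / 2 + 2 * B * indicator {z::'a. norm z > r} z \<partial>std_gauss)"
    proof (rule Bochner_Integration.integral_mono)
      show "integrable std_gauss (\<lambda>z. \<eta> / 2 + 2 * B * indicator {z::'a. norm z > r} z)"
        by (rule G.integrable_bounded[where B = "\<eta> / 2 + 2 * B"]) (use B0 \<eta> in \<open>auto simp: indicator_def\<close>)
    qed (use i1 pt in auto)
    also have "\<dots> = \<eta> / 2 + 2 * B * measure std_gauss {z::'a. norm z > r}"
    proof -
      have "integrable std_gauss (indicator {z::'a. norm z > r} :: 'a \<Rightarrow> real)"
        by (rule G.integrable_bounded[where B = 1]) (auto simp: indicator_def)
      then show ?thesis by (simp add: G.prob_space[simplified])
    qed
    also have "\<dots> \<le> \<eta> / 2 + 2 * B * (\<eta> / (4 * B + 4))"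
      using r B0 by (intro add_left_mono mult_left_mono) auto
    also have "\<dots> \<le> \<eta>" using B0 \<eta> by (simp add: field_simps)
    finally show ?thesis .
  qed
  then show ?thesis using s by blast
qed

context char_convergence
begin

text \<open>
  A smoothed function is a superposition of Gaussian kernels with integrable weight \<open>g\<close>.
\<close>

lemma integral_smooth:
  fixes g :: "'a \<Rightarrow> real"
  assumes s: "s > 0" and [measurable]: "g \<in> borel_measurable borel" and g: "integrable lborel g"
    and M: "prob_space M" and sets[measurable_cong]: "sets M = sets borel"
  shows "(\<integral>x. smooth s g x \<partial>M)
    = (\<integral>y. g y * (\<integral>x. exp (- ((x - y) \<bullet> (x - y)) * (1 / s)\<^sup>2 / 2) \<partial>M) \<partial>lborel) / (s ^ DIM('a) * sqrt ((2 * pi) ^ DIM('a)))"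
proof -
  interpret M: prob_space M by (rule M)
  interpret P: pair_sigma_finite M "lborel :: 'a measure" ..
  let ?k = "\<lambda>x y. exp (- ((x - y) \<bullet> (x - y)) * (1 / s)\<^sup>2 / 2)"
  have k: "gauss ((1 / s) *\<^sub>R (y - x)) = ?k x y / sqrt ((2 * pi) ^ DIM('a))" for x y :: 'a
  proof -
    have "((1 / s) *\<^sub>R (y - x)) \<bullet> ((1 / s) *\<^sub>R (y - x)) = (x - y) \<bullet> (x - y) * (1 / s)\<^sup>2"
      by (simp add: inner_diff_left inner_diff_right inner_commute power2_eq_square algebra_simps)
    then show ?thesis unfolding gauss_eq by simp
  qed
  have k1: "?k x y \<le> 1" for x y :: 'a by simp
  have iy: "integrable lborel (\<lambda>y. g y * ?k x y)" for x
    by (rule Bochner_Integration.integrable_bound[OF g]) (auto simp: abs_mult mult_left_le)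
  have iy': "integrable lborel (\<lambda>y. \<bar>g y\<bar> * ?k x y)" for x
    using integrable_abs[OF iy[of x]] by (simp add: abs_mult)
  have int: "integrable (M \<Otimes>\<^sub>M lborel) (\<lambda>(x, y). g y * ?k x y)"
  proof (rule P.Fubini_integrable)
    show "integrable M (\<lambda>x. \<integral>y. norm (case (x, y) of (x, y) \<Rightarrow> g y * ?k x y) \<partial>lborel)"
    proof (rule M.integrable_bounded[where B = "\<integral>y. \<bar>g y\<bar> \<partial>lborel"])
      fix x
      have "(\<integral>y. norm (case (x, y) of (x, y) \<Rightarrow> g y * ?k x y) \<partial>lborel) \<le> (\<integral>y. \<bar>g y\<bar> \<partial>lborel)"
        using iy' g by (intro Bochner_Integration.integral_mono) (auto simp: abs_mult mult_left_le)
      then show "norm (\<integral>y. norm (case (x, y) of (x, y) \<Rightarrow> g y * ?k x y) \<partial>lborel) \<le> (\<integral>y. \<bar>g y\<bar> \<partial>lborel)"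
        by simp
    qed measurable
  qed (use iy in auto)
  have "(\<integral>x. smooth s g x \<partial>M) = (\<integral>x. (\<integral>y. g y * ?k x y \<partial>lborel) \<partial>M) / (s ^ DIM('a) * sqrt ((2 * pi) ^ DIM('a)))"
    unfolding smooth_eq[OF s \<open>g \<in> borel_measurable borel\<close>] k by (simp add: mult.commute)
  also have "(\<integral>x. (\<integral>y. g y * ?k x y \<partial>lborel) \<partial>M) = (\<integral>y. (\<integral>x. g y * ?k x y \<partial>M) \<partial>lborel)"
    by (rule P.Fubini_integral[OF int, symmetric])
  also have "\<dots> = (\<integral>y. g y * (\<integral>x. ?k x y \<partial>M) \<partial>lborel)" by simp
  finally show ?thesis .
qed

text \<open>
  Convergence for Gaussian kernels passes to their superpositions \<open>smooth s g\<close>, and these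
  approximate \<open>g\<close> uniformly because \<open>g\<close> is uniformly continuous.
\<close>

lemma conv_compact_support:
  fixes g :: "'a \<Rightarrow> real"
  assumes cont: "continuous_on UNIV g" and supp: "\<And>x. norm x \<ge> r \<Longrightarrow> g x = 0"
  shows "(\<lambda>n. \<integral>x. g x \<partial>\<nu> n) \<longlonglongrightarrow> (\<integral>x. g x \<partial>N)"
proof -
  have meas[measurable]: "g \<in> borel_measurable borel" using cont by (rule borel_measurable_continuous_onI)
  have cpt: "compact (g ` cball 0 r)"
    by (intro compact_continuous_image continuous_on_subset[OF cont]) auto
  then obtain B0 where B0: "\<And>y. y \<in> g ` cball 0 r \<Longrightarrow> \<bar>y\<bar> \<le> B0"
    using compact_imp_bounded[OF cpt] unfolding bounded_iff by auto
  define B where "B = max B0 0"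
  have B: "\<bar>g x\<bar> \<le> B" for x
  proof (cases "norm x \<ge> r")
    case True
    then show ?thesis using supp by (simp add: B_def)
  next
    case False
    then have "\<bar>g x\<bar> \<le> B0" by (intro B0) auto
    then show ?thesis by (simp add: B_def)
  qed
  have int: "integrable lborel g"
  proof -
    have "integrable lborel (\<lambda>x. indicator (cball 0 r) x *\<^sub>R g x)"
      by (intro borel_integrable_compact continuous_on_subset[OF cont]) auto
    also have "(\<lambda>x. indicator (cball 0 r) x *\<^sub>R g x) = g"
      using supp by (auto simp: fun_eq_iff indicator_def)
    finally show ?thesis .
  qed
  have uc: "uniformly_continuous_on UNIV g"
    unfolding uniformly_continuous_on_def
  proof (intro allI impI)
    fix e :: real assume e: "e > 0"
    have "uniformly_continuous_on (cball 0 (r + 1)) g"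
      by (intro compact_uniformly_continuous continuous_on_subset[OF cont]) auto
    then obtain d where d: "d > 0" "\<And>x y. x \<in> cball 0 (r + 1) \<Longrightarrow> y \<in> cball 0 (r + 1) \<Longrightarrow> dist y x < d \<Longrightarrow> dist (g y) (g x) < e"
      using e unfolding uniformly_continuous_on_def by metis
    show "\<exists>d>0. \<forall>x\<in>UNIV. \<forall>x'\<in>UNIV. dist x' x < d \<longrightarrow> dist (g x') (g x) < e"
    proof (intro exI[of _ "min d 1"] conjI ballI impI)
      fix x y :: 'a assume xy: "dist y x < min d 1"
      have n: "\<bar>norm y - norm x\<bar> < 1" using xy norm_triangle_ineq3[of y x] by (simp add: dist_norm)
      show "dist (g y) (g x) < e"
      proof (cases "norm x \<le> r + 1 \<and> norm y \<le> r + 1")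
        case True
        then show ?thesis using d(2)[of x y] xy by simp
      next
        case False
        then have "norm x \<ge> r" "norm y \<ge> r" using n by auto
        then show ?thesis using supp e by simp
      qed
    qed (use d in auto)
  qed
  define K where "K s M y = (\<integral>x. exp (- ((x - y) \<bullet> (x - y)) * (1 / s)\<^sup>2 / 2) \<partial>M)" for s and M :: "'a measure" and y
  have smooth_conv: "(\<lambda>n. \<integral>x. smooth s g x \<partial>\<nu> n) \<longlonglongrightarrow> (\<integral>x. smooth s g x \<partial>N)" if s: "s > 0" for s
    unfolding integral_smooth[OF s meas int prob_\<nu> sets_\<nu>] integral_smooth[OF s meas int prob_N sets_N] K_def[symmetric]
  proof (intro tendsto_divide tendsto_const)
    have K: "K s M \<in> borel_measurable borel" "\<And>y. \<bar>K s M y\<bar> \<le> 1"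
      if M: "prob_space M" and [measurable_cong]: "sets M = sets borel" for M :: "'a measure"
    proof -
      interpret M: prob_space M by (rule M)
      show "K s M \<in> borel_measurable borel" unfolding K_def by measurable
      show "\<bar>K s M y\<bar> \<le> 1" for y
      proof -
        have "K s M y \<le> (\<integral>x. 1 \<partial>M)" unfolding K_def
          by (intro Bochner_Integration.integral_mono M.integrable_bounded[where B = 1]) auto
        moreover have "K s M y \<ge> 0" unfolding K_def by (intro Bochner_Integration.integral_nonneg) simp
        ultimately show ?thesis by (simp add: M.prob_space)
      qed
    qed
    note [measurable] = K(1)[OF prob_\<nu> sets_\<nu>] K(1)[OF prob_N sets_N]
    show "(\<lambda>n. \<integral>y. g y * K s (\<nu> n) y \<partial>lborel) \<longlonglongrightarrow> (\<integral>y. g y * K s N y \<partial>lborel)"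
    proof (rule integral_dominated_convergence[where w = "\<lambda>y. \<bar>g y\<bar>"])
      show "AE y in lborel. (\<lambda>n. g y * K s (\<nu> n) y) \<longlonglongrightarrow> g y * K s N y"
        unfolding K_def by (intro AE_I2 tendsto_mult tendsto_const conv_gauss_kernel)
      show "AE y in lborel. norm (g y * K s (\<nu> n) y) \<le> \<bar>g y\<bar>" for n
        using K(2)[OF prob_\<nu> sets_\<nu>] by (intro AE_I2) (simp add: abs_mult mult_left_le)
    qed (use int in auto)
  qed (use s in auto)
  show ?thesis
  proof (rule LIMSEQ_I)
    fix e :: real assume e: "e > 0"
    obtain s where s: "s > 0" "\<And>x. \<bar>smooth s g x - g x\<bar> \<le> e / 3"
      using smooth_close[OF meas uc B, of "e / 3"] e by auto
    have close: "\<bar>(\<integral>x. smooth s g x \<partial>M) - (\<integral>x. g x \<partial>M)\<bar> \<le> e / 3"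
      if M: "prob_space M" and [measurable_cong]: "sets M = sets borel" for M :: "'a measure"
    proof -
      interpret M: prob_space M by (rule M)
      interpret G: prob_space "std_gauss :: 'a measure" by (rule prob_space_std_gauss)
      have sm: "smooth s g \<in> borel_measurable borel" unfolding smooth_def[abs_def] by measurable
      have sb: "\<bar>smooth s g x\<bar> \<le> B + e" for x using s(2)[of x] B[of x] e by linarith
      have i: "integrable M (smooth s g)" "integrable M g"
        using M.integrable_bounded[of "smooth s g" "B + e"] M.integrable_bounded[of g B] sm sb B by auto
      have "\<bar>\<integral>x. smooth s g x - g x \<partial>M\<bar> \<le> (\<integral>x. \<bar>smooth s g x - g x\<bar> \<partial>M)" by (rule integral_abs_bound)
      also have "\<dots> \<le> (\<integral>x. e / 3 \<partial>M)" using i s(2) by (intro Bochner_Integration.integral_mono) auto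
      finally show ?thesis using i by (simp add: M.prob_space)
    qed
    obtain n0 where n0: "\<And>n. n \<ge> n0 \<Longrightarrow> norm ((\<integral>x. smooth s g x \<partial>\<nu> n) - (\<integral>x. smooth s g x \<partial>N)) < e / 3"
      using LIMSEQ_D[OF smooth_conv[OF s(1)], of "e / 3"] e by auto
    show "\<exists>n0. \<forall>n\<ge>n0. norm ((\<integral>x. g x \<partial>\<nu> n) - (\<integral>x. g x \<partial>N)) < e"
    proof (intro exI[of _ n0] allI impI)
      fix n assume n: "n \<ge> n0"
      show "norm ((\<integral>x. g x \<partial>\<nu> n) - (\<integral>x. g x \<partial>N)) < e"
        using n0[OF n] close[OF prob_\<nu> sets_\<nu>, of n] close[OF prob_N sets_N]
        unfolding real_norm_def by linarith
    qed
  qed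
qed

text \<open>
  Tightness is inherited from the limit: for a compactly supported cutoff function \<open>c\<close> close to \<open>1\<close>
  under \<open>N\<close>, the integrals of \<open>c\<close> converge, so that \<open>\<nu> n\<close> eventually has little mass where \<open>c < 1\<close>.
\<close>

theorem levy_continuity:
  fixes g :: "'a \<Rightarrow> real"
  assumes cont: "continuous_on UNIV g" and bdd: "bounded (range g)"
  shows "(\<lambda>n. \<integral>x. g x \<partial>\<nu> n) \<longlonglongrightarrow> (\<integral>x. g x \<partial>N)"
proof (rule LIMSEQ_I)
  fix e :: real assume e: "e > 0"
  have [measurable]: "g \<in> borel_measurable borel" using cont by (rule borel_measurable_continuous_onI)
  obtain B where B: "B > 0" "\<And>x. \<bar>g x\<bar> \<le> B" using bdd unfolding bounded_pos by auto
  define \<eta> where "\<eta> = e / (5 * B)"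
  have \<eta>: "\<eta> > 0" using e B by (simp add: \<eta>_def)
  interpret N: prob_space N by (rule prob_N)
  have spN: "space N = UNIV" using sets_eq_imp_space_eq[OF sets_N] by simp
  obtain r :: nat where r: "measure N {x. norm x > r} < \<eta>" using tail_small[OF prob_N sets_N \<eta>] by blast
  define c where "c x = max 0 (min 1 (real r + 1 - norm x))" for x :: 'a
  have c01: "0 \<le> c x" "c x \<le> 1" for x by (auto simp: c_def)
  have ccont: "continuous_on UNIV c" unfolding c_def by (intro continuous_intros)
  have [measurable]: "c \<in> borel_measurable borel" using ccont by (rule borel_measurable_continuous_onI)
  have csupp: "c x = 0" if "norm x \<ge> real r + 1" for x using that by (simp add: c_def)
  have cutoff: "\<bar>(\<integral>x. g x \<partial>M) - (\<integral>x. g x * c x \<partial>M)\<bar> \<le> B * (1 - (\<integral>x. c x \<partial>M))"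
    if M: "prob_space M" and [measurable_cong]: "sets M = sets borel" for M :: "'a measure"
  proof -
    interpret M: prob_space M by (rule M)
    have gc: "norm (g x * c x) \<le> B * 1" for x
      unfolding real_norm_def abs_mult by (intro mult_mono) (use B c01 in auto)
    have i: "integrable M g" "integrable M c" "integrable M (\<lambda>x. g x * c x)"
    proof -
      show "integrable M g" by (rule M.integrable_bounded[where B = B]) (use B in auto)
      show "integrable M c" by (rule M.integrable_bounded[where B = 1]) (use c01 in auto)
      show "integrable M (\<lambda>x. g x * c x)" by (rule M.integrable_bounded[OF _ gc]) measurable
    qed
    have "(\<integral>x. g x \<partial>M) - (\<integral>x. g x * c x \<partial>M) = (\<integral>x. g x * (1 - c x) \<partial>M)"
      using i by (simp add: right_diff_distrib)
    also have "\<bar>\<dots>\<bar> \<le> (\<integral>x. \<bar>g x * (1 - c x)\<bar> \<partial>M)" by (rule integral_abs_bound)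
    also have "\<dots> \<le> (\<integral>x. B * (1 - c x) \<partial>M)"
    proof (rule Bochner_Integration.integral_mono)
      show "integrable M (\<lambda>x. \<bar>g x * (1 - c x)\<bar>)" using i by (simp add: right_diff_distrib)
      show "\<bar>g x * (1 - c x)\<bar> \<le> B * (1 - c x)" for x
        unfolding abs_mult using B(2)[of x] c01[of x] by (intro mult_mono) auto
    qed (use i in auto)
    also have "\<dots> = B * (1 - (\<integral>x. c x \<partial>M))" using i by (simp add: M.prob_space)
    finally show ?thesis .
  qed
  have cN: "1 - (\<integral>x. c x \<partial>N) \<le> \<eta>"
  proof -
    have ic: "integrable N c" using N.integrable_bounded[of c 1] c01 by auto
    have "1 - (\<integral>x. c x \<partial>N) = (\<integral>x. 1 - c x \<partial>N)" using ic by (simp add: N.prob_space)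
    also have "\<dots> \<le> (\<integral>x. indicator {x. norm x > r} x \<partial>N)"
    proof (rule Bochner_Integration.integral_mono)
      show "1 - c x \<le> indicator {x. norm x > r} x" for x by (auto simp: c_def indicator_def)
      show "integrable N (indicator {x. norm x > real r} :: 'a \<Rightarrow> real)"
        by (rule N.integrable_bounded[where B = 1]) (auto simp: indicator_def)
    qed (use ic in auto)
    also have "\<dots> = measure N {x. norm x > r}" by (simp add: spN)
    finally show ?thesis using r by simp
  qed
  have conv1: "(\<lambda>n. \<integral>x. c x \<partial>\<nu> n) \<longlonglongrightarrow> (\<integral>x. c x \<partial>N)"
    by (rule conv_compact_support[OF ccont csupp])
  obtain n1 where n1: "\<And>n. n \<ge> n1 \<Longrightarrow> norm ((\<integral>x. c x \<partial>\<nu> n) - (\<integral>x. c x \<partial>N)) < \<eta>"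
    using LIMSEQ_D[OF conv1 \<eta>] by blast
  have conv2: "(\<lambda>n. \<integral>x. g x * c x \<partial>\<nu> n) \<longlonglongrightarrow> (\<integral>x. g x * c x \<partial>N)"
    by (rule conv_compact_support[where r = "real r + 1"], rule continuous_on_mult[OF cont ccont]) (simp add: csupp)
  obtain n2 where n2: "\<And>n. n \<ge> n2 \<Longrightarrow> norm ((\<integral>x. g x * c x \<partial>\<nu> n) - (\<integral>x. g x * c x \<partial>N)) < \<eta> * B"
    using LIMSEQ_D[OF conv2 mult_pos_pos[OF \<eta> B(1)]] by blast
  show "\<exists>n0. \<forall>n\<ge>n0. norm ((\<integral>x. g x \<partial>\<nu> n) - (\<integral>x. g x \<partial>N)) < e"
  proof (intro exI[of _ "max n1 n2"] allI impI)
    fix n assume "n \<ge> max n1 n2"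
    then have n12: "n \<ge> n1" "n \<ge> n2" by auto
    have "1 - (\<integral>x. c x \<partial>\<nu> n) \<le> 2 * \<eta>" using n1[OF n12(1)] cN unfolding real_norm_def by linarith
    then have "B * (1 - (\<integral>x. c x \<partial>\<nu> n)) \<le> B * (2 * \<eta>)" using B by (intro mult_left_mono) auto
    moreover have "B * (1 - (\<integral>x. c x \<partial>N)) \<le> B * \<eta>" using B cN by (intro mult_left_mono) auto
    moreover have "norm ((\<integral>x. g x * c x \<partial>\<nu> n) - (\<integral>x. g x * c x \<partial>N)) < \<eta> * B" by (rule n2[OF n12(2)])
    ultimately have "\<bar>(\<integral>x. g x \<partial>\<nu> n) - (\<integral>x. g x \<partial>N)\<bar> < \<eta> * B + B * (2 * \<eta>) + B * \<eta>"
      using cutoff[OF prob_\<nu> sets_\<nu>, of n] cutoff[OF prob_N sets_N] unfolding real_norm_def by linarith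
    also have "\<dots> \<le> e" using B e by (simp add: \<eta>_def)
    finally show "norm ((\<integral>x. g x \<partial>\<nu> n) - (\<integral>x. g x \<partial>N)) < e" by simp
  qed
qed

end

section \<open>Riemann sums for functions with vanishing marginals\<close>

lemma riemann_sum_close:
  fixes g :: "real \<Rightarrow> real"
  assumes cont: "continuous_on {0..1} g" and n: "n \<ge> 1"
    and osc: "\<And>x y. x \<in> {0..1} \<Longrightarrow> y \<in> {0..1} \<Longrightarrow> \<bar>x - y\<bar> \<le> 1 / real n \<Longrightarrow> \<bar>g x - g y\<bar> \<le> e"
  shows "\<bar>(\<Sum>j=1..n. g (real j / real n)) / real n - integral {0..1} g\<bar> \<le> e"
proof -
  have n0: "real n > 0" using n by simp
  have "\<bar>(\<Sum>j=1..m. g (real j / real n)) / real n - integral {0..real m / real n} g\<bar> \<le> e * (real m / real n)" if "m \<le> n" for m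
    using that
  proof (induction m)
    case (Suc m)
    define a where "a = real m / real n"
    define b where "b = real (Suc m) / real n"
    have ab: "0 \<le> a" "a \<le> b" "b \<le> 1" "b - a = 1 / real n"
      using Suc(2) n0 by (auto simp: a_def b_def divide_right_mono diff_divide_distrib[symmetric])
    have sub: "{a..b} \<subseteq> {0..1}" "{0..b} \<subseteq> {0..1}" using ab by auto
    have comb: "integral {0..b} g = integral {0..a} g + integral {a..b} g"
      using ab sub by (intro Henstock_Kurzweil_Integration.integral_combine[symmetric] integrable_continuous_real continuous_on_subset[OF cont]) auto
    have "norm (integral {a..b} (\<lambda>x. g x - g b)) \<le> e * (b - a)"
    proof (rule integral_bound[OF ab(2)])
      show "continuous_on {a..b} (\<lambda>x. g x - g b)"
        by (intro continuous_intros continuous_on_subset[OF cont sub(1)])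
      show "norm (g t - g b) \<le> e" if "t \<in> {a..b}" for t
        unfolding real_norm_def by (rule osc) (use that ab in auto)
    qed
    also have "integral {a..b} (\<lambda>x. g x - g b) = integral {a..b} g - g b / real n"
      using ab by (subst Henstock_Kurzweil_Integration.integral_diff)
        (auto intro!: integrable_continuous_real continuous_on_subset[OF cont sub(1)])
    finally have "\<bar>g b / real n - integral {a..b} g\<bar> \<le> e * (1 / real n)" unfolding ab(4) by simp
    moreover have "\<bar>(\<Sum>j=1..m. g (real j / real n)) / real n - integral {0..a} g\<bar> \<le> e * a"
      using Suc unfolding a_def by simp
    ultimately have "\<bar>(\<Sum>j=1..m. g (real j / real n)) / real n + g b / real n - (integral {0..a} g + integral {a..b} g)\<bar>
        \<le> e * a + e * (1 / real n)"
      by linarith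
    moreover have "(\<Sum>j=1..Suc m. g (real j / real n)) / real n = (\<Sum>j=1..m. g (real j / real n)) / real n + g b / real n"
      by (simp add: add_divide_distrib b_def)
    moreover have "e * b = e * a + e * (1 / real n)" unfolding ab(4)[symmetric] by (simp add: algebra_simps)
    ultimately show ?case unfolding b_def[symmetric] comb by presburger
  qed simp
  from this[of n] show ?thesis using n0 by simp
qed

lemma unit_square_cbox: "unit_square = cbox (0, 0) (1, 1)"
  by (auto simp: unit_square_def cbox_Pair_eq)

lemma grid_in_square: "i \<in> {1..n} \<Longrightarrow> real i / real n \<in> {0..1}"
  by auto

definition riemann_close :: "(real \<times> real \<Rightarrow> real) \<Rightarrow> nat \<Rightarrow> real \<Rightarrow> bool" where
  "riemann_close F n e \<longleftrightarrow> n \<ge> 1 \<and>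
    (\<forall>x\<in>{0..1}. \<bar>(\<Sum>j=1..n. F (x, real j / real n)) / real n - integral {0..1} (\<lambda>z. F (x, z))\<bar> \<le> e) \<and>
    (\<forall>y\<in>{0..1}. \<bar>(\<Sum>i=1..n. F (real i / real n, y)) / real n - integral {0..1} (\<lambda>z. F (z, y))\<bar> \<le> e) \<and>
    \<bar>(\<Sum>i=1..n. \<Sum>j=1..n. F (real i / real n, real j / real n)) / (real n)\<^sup>2 - integral unit_square F\<bar> \<le> 2 * e"

lemma riemann_sums_square:
  fixes F :: "real \<times> real \<Rightarrow> real"
  assumes cont: "continuous_on unit_square F" and e: "e > 0"
  shows "\<exists>n0. \<forall>n\<ge>n0. riemann_close F n e"
proof -
  have "uniformly_continuous_on unit_square F"
    using cont unfolding unit_square_cbox by (intro compact_uniformly_continuous) auto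
  then obtain d where d: "d > 0"
    "\<And>p q. p \<in> unit_square \<Longrightarrow> q \<in> unit_square \<Longrightarrow> dist q p < d \<Longrightarrow> dist (F q) (F p) < e"
    using e unfolding uniformly_continuous_on_def by metis
  obtain n0 where n0: "1 / real (Suc n0) < d" using nat_approx_posE[OF d(1)] by auto
  have "riemann_close F n e"
    if n: "n \<ge> Suc n0" for n
  proof -
    have n1: "n \<ge> 1" "real n > 0" using n by auto
    have nd: "1 / real n < d"
    proof -
      have "1 / real n \<le> 1 / real (Suc n0)" using n by (intro divide_left_mono) auto
      then show ?thesis using n0 by linarith
    qed
    have osc1: "\<bar>F (x, y) - F (x, z)\<bar> \<le> e" "\<bar>F (y, x) - F (z, x)\<bar> \<le> e"
      if "x \<in> {0..1}" "y \<in> {0..1}" "z \<in> {0..1}" "\<bar>y - z\<bar> \<le> 1 / real n" for x y z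
      using d(2)[of "(x, z)" "(x, y)"] d(2)[of "(z, x)" "(y, x)"] that nd
      by (auto simp: unit_square_def dist_Pair_Pair dist_real_def)
    have contx: "continuous_on {0..1} (\<lambda>z. F (x, z))" "continuous_on {0..1} (\<lambda>z. F (z, x))" if "x \<in> {0..1}" for x
      by (rule continuous_on_compose2[OF cont]; use that in \<open>auto intro!: continuous_intros simp: unit_square_def\<close>)+
    have A: "\<bar>(\<Sum>j=1..n. F (x, real j / real n)) / real n - integral {0..1} (\<lambda>z. F (x, z))\<bar> \<le> e" if "x \<in> {0..1}" for x
      by (rule riemann_sum_close[OF contx(1)[OF that] n1(1)]) (use osc1 that in auto)
    have B: "\<bar>(\<Sum>i=1..n. F (real i / real n, y)) / real n - integral {0..1} (\<lambda>z. F (z, y))\<bar> \<le> e" if "y \<in> {0..1}" for y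
      by (rule riemann_sum_close[OF contx(2)[OF that] n1(1)]) (use osc1 that in auto)
    define G where "G x = integral {0..1} (\<lambda>z. F (x, z))" for x
    have I: "integral unit_square F = integral {0..1} G"
      using integral_prod_continuous[of 0 0 1 1 F] cont unfolding unit_square_cbox G_def by simp
    have Gd: "\<bar>G x - G y\<bar> \<le> e'" if xy: "x \<in> {0..1}" "y \<in> {0..1}"
        and le: "\<And>z. z \<in> {0..1} \<Longrightarrow> \<bar>F (x, z) - F (y, z)\<bar> \<le> e'" for x y e'
    proof -
      have "G x - G y = integral {0..1} (\<lambda>z. F (x, z) - F (y, z))"
        unfolding G_def by (rule Henstock_Kurzweil_Integration.integral_diff[symmetric]) (intro integrable_continuous_real contx xy)+
      also have "norm \<dots> \<le> e' * (1 - 0)"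
        by (rule integral_bound) (use le xy in \<open>auto intro!: continuous_intros contx\<close>)
      finally show ?thesis by simp
    qed
    have Gcont: "continuous_on {0..1} G"
      unfolding continuous_on_iff
    proof (intro ballI allI impI)
      fix x \<epsilon> :: real assume x: "x \<in> {0..1}" and \<epsilon>: "\<epsilon> > 0"
      have "uniformly_continuous_on unit_square F"
        using cont unfolding unit_square_cbox by (intro compact_uniformly_continuous) auto
      then obtain \<delta> where \<delta>: "\<delta> > 0"
        "\<And>p q. p \<in> unit_square \<Longrightarrow> q \<in> unit_square \<Longrightarrow> dist q p < \<delta> \<Longrightarrow> dist (F q) (F p) < \<epsilon> / 2"
        using \<epsilon> unfolding uniformly_continuous_on_def by (metis half_gt_zero)
      have "dist (G y) (G x) < \<epsilon>" if y: "y \<in> {0..1}" "dist y x < \<delta>" for y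
      proof -
        have "\<bar>G y - G x\<bar> \<le> \<epsilon> / 2"
        proof (rule Gd[OF y(1) x])
          fix z :: real assume z: "z \<in> {0..1}"
          show "\<bar>F (y, z) - F (x, z)\<bar> \<le> \<epsilon> / 2"
            using \<delta>(2)[of "(x, z)" "(y, z)"] x y z by (simp add: unit_square_def dist_Pair_Pair dist_real_def)
        qed
        then show ?thesis using \<epsilon> by (simp add: dist_real_def)
      qed
      then show "\<exists>\<delta>>0. \<forall>y\<in>{0..1}. dist y x < \<delta> \<longrightarrow> dist (G y) (G x) < \<epsilon>" using \<delta>(1) by blast
    qed
    have C: "\<bar>(\<Sum>i=1..n. G (real i / real n)) / real n - integral {0..1} G\<bar> \<le> e"
      by (rule riemann_sum_close[OF Gcont n1(1)]) (rule Gd, use osc1 in auto)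
    have D: "\<bar>(\<Sum>i=1..n. \<Sum>j=1..n. F (real i / real n, real j / real n)) / (real n)\<^sup>2 - (\<Sum>i=1..n. G (real i / real n)) / real n\<bar> \<le> e"
    proof -
      have "(\<Sum>i=1..n. \<Sum>j=1..n. F (real i / real n, real j / real n)) / (real n)\<^sup>2 - (\<Sum>i=1..n. G (real i / real n)) / real n
          = (\<Sum>i=1..n. (\<Sum>j=1..n. F (real i / real n, real j / real n)) / real n - G (real i / real n)) / real n"
        using n1 by (simp add: sum_subtractf diff_divide_distrib sum_divide_distrib power2_eq_square)
      also have "\<bar>\<dots>\<bar> \<le> (\<Sum>i=1..n. e) / real n"
        unfolding abs_divide abs_of_nat
        by (intro divide_right_mono order_trans[OF sum_abs] sum_mono) (use A grid_in_square in \<open>auto simp: G_def\<close>)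
      also have "\<dots> = e" using n1 by simp
      finally show ?thesis .
    qed
    have tri: "\<bar>x - z\<bar> \<le> 2 * e" if "\<bar>y - z\<bar> \<le> e" "\<bar>x - y\<bar> \<le> e" for x y z :: real
      using that by linarith
    show ?thesis
      unfolding riemann_close_def
    proof (intro conjI ballI n1 A B)
      show "\<bar>(\<Sum>i=1..n. \<Sum>j=1..n. F (real i / real n, real j / real n)) / (real n)\<^sup>2 - integral unit_square F\<bar> \<le> 2 * e"
        unfolding I by (rule tri[OF C D])
    qed
  qed
  then show ?thesis by blast
qed

definition grid_mat :: "(real \<times> real \<Rightarrow> real) \<Rightarrow> nat \<Rightarrow> nat \<Rightarrow> nat \<Rightarrow> real" where
  "grid_mat F n i k = F (real i / real n, real k / real n)"

text \<open>
  The mean of \<open>quad_var\<close> up to normalisation; for \<open>a = b\<close> it is the sum of squares in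
  \<open>lin_stat_variance_lower\<close>.
\<close>

definition xprod :: "nat \<Rightarrow> (nat \<Rightarrow> nat \<Rightarrow> real) \<Rightarrow> (nat \<Rightarrow> nat \<Rightarrow> real) \<Rightarrow> real" where
  "xprod n a b = (\<Sum>i\<in>{1..n}. \<Sum>j\<in>{1..n}. \<Sum>k\<in>{1..n}. \<Sum>l\<in>{1..n}. xdiff a i j k l * xdiff b i j k l)"

text \<open>
  The form matters: row and column sums appear as separate factors, and these are negligible for
  matrices sampled from a function with vanishing marginals.
\<close>

lemma xprod_expand:
  "xprod n a b = 4 * (real n)\<^sup>2 * (\<Sum>i=1..n. \<Sum>k=1..n. a i k * b i k)
    - 4 * real n * (\<Sum>i=1..n. (\<Sum>k=1..n. a i k) * (\<Sum>k=1..n. b i k))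
    - 4 * real n * (\<Sum>k=1..n. (\<Sum>i=1..n. a i k) * (\<Sum>i=1..n. b i k))
    + 4 * (\<Sum>i=1..n. \<Sum>k=1..n. a i k) * (\<Sum>i=1..n. \<Sum>k=1..n. b i k)"
proof -
  let ?I = "{1..n}"
  let ?N = "real n"
  let ?S = "\<lambda>t :: nat \<Rightarrow> nat \<Rightarrow> nat \<Rightarrow> nat \<Rightarrow> real. \<Sum>i\<in>?I. \<Sum>j\<in>?I. \<Sum>k\<in>?I. \<Sum>l\<in>?I. t i j k l"
  define P where "P = (\<Sum>i\<in>?I. \<Sum>k\<in>?I. a i k * b i k)"
  define Q where "Q = (\<Sum>i\<in>?I. (\<Sum>k\<in>?I. a i k) * (\<Sum>k\<in>?I. b i k))"
  define C where "C = (\<Sum>k\<in>?I. (\<Sum>i\<in>?I. a i k) * (\<Sum>i\<in>?I. b i k))"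
  define sa where "sa = (\<Sum>i\<in>?I. \<Sum>k\<in>?I. a i k)"
  define sb where "sb = (\<Sum>i\<in>?I. \<Sum>k\<in>?I. b i k)"
  have sums: "?S (\<lambda>i j k l. a i k * b i k) = ?N\<^sup>2 * P"
    "?S (\<lambda>i j k l. a j l * b j l) = ?N\<^sup>2 * P"
    "?S (\<lambda>i j k l. a i l * b i l) = ?N\<^sup>2 * P"
    "?S (\<lambda>i j k l. a j k * b j k) = ?N\<^sup>2 * P"
    by (simp_all add: P_def sum_distrib_left power2_eq_square mult.assoc)
  have cross: "?S (\<lambda>i j k l. a i k * b j l) = sa * sb"
    "?S (\<lambda>i j k l. a j l * b i k) = sa * sb"
    "?S (\<lambda>i j k l. a i l * b j k) = sa * sb"
    "?S (\<lambda>i j k l. a j k * b i l) = sa * sb"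
  proof -
    have 1: "?S (\<lambda>i j k l. x i k * y j l) = (\<Sum>i\<in>?I. \<Sum>k\<in>?I. x i k) * (\<Sum>i\<in>?I. \<Sum>k\<in>?I. y i k)"
      for x y :: "nat \<Rightarrow> nat \<Rightarrow> real"
      by (simp only: sum_distrib_left[symmetric] sum_distrib_right[symmetric])
    show "?S (\<lambda>i j k l. a i k * b j l) = sa * sb" unfolding sa_def sb_def by (rule 1)
    show "?S (\<lambda>i j k l. a j l * b i k) = sa * sb"
      using 1[of b a] unfolding sa_def sb_def by (simp only: mult.commute)
    have sw: "?S (\<lambda>i j k l. x i l * y j k) = ?S (\<lambda>i j k l. x i k * y j l)"
      for x y :: "nat \<Rightarrow> nat \<Rightarrow> real"
      by (rule sum.cong[OF refl], rule sum.cong[OF refl], rule sum.swap)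
    show "?S (\<lambda>i j k l. a i l * b j k) = sa * sb" unfolding sw 1 sa_def sb_def ..
    show "?S (\<lambda>i j k l. a j k * b i l) = sa * sb"
      using 1[of b a] sw[of b a] unfolding sa_def sb_def by (simp only: mult.commute)
  qed
  have rows: "?S (\<lambda>i j k l. a i k * b i l) = ?N * Q"
    "?S (\<lambda>i j k l. a i l * b i k) = ?N * Q"
    "?S (\<lambda>i j k l. a j l * b j k) = ?N * Q"
    "?S (\<lambda>i j k l. a j k * b j l) = ?N * Q"
  proof -
    have 1: "(\<Sum>k\<in>?I. \<Sum>l\<in>?I. a i k * b i l) = (\<Sum>k\<in>?I. a i k) * (\<Sum>k\<in>?I. b i k)"
      "(\<Sum>k\<in>?I. \<Sum>l\<in>?I. a i l * b i k) = (\<Sum>k\<in>?I. a i k) * (\<Sum>k\<in>?I. b i k)" for i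
      by (simp_all only: sum_distrib_left[symmetric] sum_distrib_right[symmetric])
    show "?S (\<lambda>i j k l. a i k * b i l) = ?N * Q"
      "?S (\<lambda>i j k l. a i l * b i k) = ?N * Q"
      "?S (\<lambda>i j k l. a j l * b j k) = ?N * Q"
      "?S (\<lambda>i j k l. a j k * b j l) = ?N * Q"
      unfolding 1 Q_def by (simp_all add: sum_distrib_left)
  qed
  have cols: "?S (\<lambda>i j k l. a i k * b j k) = ?N * C"
    "?S (\<lambda>i j k l. a j k * b i k) = ?N * C"
    "?S (\<lambda>i j k l. a j l * b i l) = ?N * C"
    "?S (\<lambda>i j k l. a i l * b j l) = ?N * C"
  proof -
    have swp: "(\<Sum>i\<in>?I. \<Sum>j\<in>?I. \<Sum>k\<in>?I. x i j k) = (\<Sum>k\<in>?I. \<Sum>i\<in>?I. \<Sum>j\<in>?I. x i j k)" for x :: "nat \<Rightarrow> nat \<Rightarrow> nat \<Rightarrow> real"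
    proof -
      have "(\<Sum>i\<in>?I. \<Sum>j\<in>?I. \<Sum>k\<in>?I. x i j k) = (\<Sum>i\<in>?I. \<Sum>k\<in>?I. \<Sum>j\<in>?I. x i j k)"
        by (rule sum.cong[OF refl], rule sum.swap)
      also have "\<dots> = (\<Sum>k\<in>?I. \<Sum>i\<in>?I. \<Sum>j\<in>?I. x i j k)" by (rule sum.swap)
      finally show ?thesis .
    qed
    have C1: "(\<Sum>i\<in>?I. \<Sum>j\<in>?I. \<Sum>k\<in>?I. a i k * b j k) = C"
      by (rule trans[OF swp]) (simp only: C_def sum_distrib_left[symmetric] sum_distrib_right[symmetric])
    have C2: "(\<Sum>i\<in>?I. \<Sum>j\<in>?I. \<Sum>k\<in>?I. a j k * b i k) = C"
      by (rule trans[OF swp]) (simp only: C_def sum_distrib_left[symmetric] sum_distrib_right[symmetric])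
    show "?S (\<lambda>i j k l. a i k * b j k) = ?N * C"
      "?S (\<lambda>i j k l. a i l * b j l) = ?N * C"
      unfolding C1[symmetric] by (simp_all add: sum_distrib_left)
    show "?S (\<lambda>i j k l. a j k * b i k) = ?N * C"
      "?S (\<lambda>i j k l. a j l * b i l) = ?N * C"
      unfolding C2[symmetric] by (simp_all add: sum_distrib_left)
  qed
  have "xdiff a i j k l * xdiff b i j k l =
      a i k * b i k + a j l * b j l + a i l * b i l + a j k * b j k
      + a i k * b j l + a j l * b i k + a i l * b j k + a j k * b i l
      - (a i k * b i l + a i l * b i k + a j l * b j k + a j k * b j l)
      - (a i k * b j k + a j k * b i k + a j l * b i l + a i l * b j l)" for i j k l
    by (simp add: xdiff_def algebra_simps)
  then have "xprod n a b = 4 * (?N\<^sup>2 * P) + 4 * (sa * sb) - 4 * (?N * Q) - 4 * (?N * C)"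
    unfolding xprod_def by (simp only: sum.distrib sum_subtractf sums cross rows cols)
  then show ?thesis by (simp add: P_def Q_def C_def sa_def sb_def)
qed

text \<open>
  Row and column sums are Riemann sums of integrals that are \<open>0\<close> in the class, so only the first term
  of \<open>xprod_expand\<close> survives.
\<close>

lemma xprod_limit:
  assumes F: "F \<in> class_C" and G: "G \<in> class_C"
  shows "(\<lambda>n. xprod n (grid_mat F n) (grid_mat G n) / real n ^ 4) \<longlonglongrightarrow> 4 * integral unit_square (\<lambda>z. F z * G z)"
proof (rule LIMSEQ_I)
  fix e0 :: real assume e0: "e0 > 0"
  \<comment> \<open>The total error below is at most \<open>4 * (2 * e) + 12 * e\<^sup>2 \<le> 20 * e\<close>.\<close>
  define e where "e = min 1 (e0 / 30)"
  have e: "e > 0" "e \<le> 1" "30 * e \<le> e0" using e0 by (auto simp: e_def)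
  let ?h = "integral unit_square (\<lambda>z. F z * G z)"
  have contF: "continuous_on unit_square F" and contG: "continuous_on unit_square G"
    using F G by (auto simp: class_C_def)
  have zF: "\<And>x. x \<in> {0..1} \<Longrightarrow> integral {0..1} (\<lambda>z. F (x, z)) = 0" "\<And>y. y \<in> {0..1} \<Longrightarrow> integral {0..1} (\<lambda>z. F (z, y)) = 0"
    and zG: "\<And>x. x \<in> {0..1} \<Longrightarrow> integral {0..1} (\<lambda>z. G (x, z)) = 0" "\<And>y. y \<in> {0..1} \<Longrightarrow> integral {0..1} (\<lambda>z. G (z, y)) = 0"
    using F G by (auto simp: class_C_def)
  have contFG: "continuous_on unit_square (\<lambda>z. F z * G z)" by (intro continuous_intros contF contG)
  obtain n1 where n1: "\<forall>n\<ge>n1. riemann_close F n e"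
    using riemann_sums_square[OF contF e(1)] by blast
  obtain n2 where n2: "\<forall>n\<ge>n2. riemann_close G n e"
    using riemann_sums_square[OF contG e(1)] by blast
  obtain n3 where n3: "\<forall>n\<ge>n3. riemann_close (\<lambda>z. F z * G z) n e"
    using riemann_sums_square[OF contFG e(1)] by blast
  show "\<exists>n0. \<forall>n\<ge>n0. norm (xprod n (grid_mat F n) (grid_mat G n) / real n ^ 4 - 4 * ?h) < e0"
  proof (intro exI[of _ "max n1 (max n2 n3)"] allI impI)
    fix n assume n: "n \<ge> max n1 (max n2 n3)"
    define N where "N = real n"
    have N: "N > 0" using n n1 by (auto simp: N_def riemann_close_def)
    let ?a = "grid_mat F n" and ?b = "grid_mat G n"
    define P where "P = (\<Sum>i=1..n. \<Sum>k=1..n. ?a i k * ?b i k)"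
    define ra rb ca cb where "ra i = (\<Sum>k=1..n. ?a i k)" and "rb i = (\<Sum>k=1..n. ?b i k)"
      and "ca k = (\<Sum>i=1..n. ?a i k)" and "cb k = (\<Sum>i=1..n. ?b i k)" for i k
    have P: "\<bar>P / N\<^sup>2 - ?h\<bar> \<le> 2 * e" using n3 n unfolding riemann_close_def P_def N_def grid_mat_def by simp
    have ra: "\<bar>ra i\<bar> \<le> e * N" and rb: "\<bar>rb i\<bar> \<le> e * N" and ca: "\<bar>ca i\<bar> \<le> e * N" and cb: "\<bar>cb i\<bar> \<le> e * N"
      if i: "i \<in> {1..n}" for i
    proof -
      note g = grid_in_square[OF i]
      have *: "\<bar>x\<bar> \<le> e * N" if "\<bar>x / N - 0\<bar> \<le> e" for x using that N by (simp add: field_simps)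
      have "n1 \<le> n" "n2 \<le> n" using n by auto
      note u1 = n1[rule_format, OF \<open>n1 \<le> n\<close>, unfolded riemann_close_def, THEN conjunct2] and u2 = n2[rule_format, OF \<open>n2 \<le> n\<close>, unfolded riemann_close_def, THEN conjunct2]
      have "\<bar>ra i / N - 0\<bar> \<le> e" "\<bar>ca i / N - 0\<bar> \<le> e" "\<bar>rb i / N - 0\<bar> \<le> e" "\<bar>cb i / N - 0\<bar> \<le> e"
        using u1[THEN conjunct1, THEN bspec, OF g] u1[THEN conjunct2, THEN conjunct1, THEN bspec, OF g]
          u2[THEN conjunct1, THEN bspec, OF g] u2[THEN conjunct2, THEN conjunct1, THEN bspec, OF g]
        unfolding zF[OF g] zG[OF g] ra_def ca_def rb_def cb_def grid_mat_def N_def by blast+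
      then show "\<bar>ra i\<bar> \<le> e * N" "\<bar>rb i\<bar> \<le> e * N" "\<bar>ca i\<bar> \<le> e * N" "\<bar>cb i\<bar> \<le> e * N" by (auto intro: *)
    qed
    have sumb: "\<bar>\<Sum>i=1..n. x i * y i\<bar> \<le> N * (e * N * (e * N))"
      if "\<And>i. i \<in> {1..n} \<Longrightarrow> \<bar>x i\<bar> \<le> e * N" "\<And>i. i \<in> {1..n} \<Longrightarrow> \<bar>y i\<bar> \<le> e * N" for x y
    proof -
      have "\<bar>\<Sum>i=1..n. x i * y i\<bar> \<le> (\<Sum>i=1..n. e * N * (e * N))"
        using that e N by (intro order_trans[OF sum_abs] sum_mono) (auto simp: abs_mult intro!: mult_mono)
      then show ?thesis by (simp add: N_def)
    qed
    have tot: "\<bar>\<Sum>i=1..n. x i\<bar> \<le> N * (e * N)" if "\<And>i. i \<in> {1..n} \<Longrightarrow> \<bar>x i\<bar> \<le> e * N" for x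
    proof -
      have "\<bar>\<Sum>i=1..n. x i\<bar> \<le> (\<Sum>i=1..n. e * N)"
        using that by (intro order_trans[OF sum_abs] sum_mono)
      then show ?thesis by (simp add: N_def)
    qed
    have X: "xprod n ?a ?b = 4 * N\<^sup>2 * P - 4 * N * (\<Sum>i=1..n. ra i * rb i) - 4 * N * (\<Sum>k=1..n. ca k * cb k)
        + 4 * (\<Sum>i=1..n. ra i) * (\<Sum>i=1..n. rb i)"
      unfolding xprod_expand P_def ra_def rb_def ca_def cb_def N_def ..
    define t1 where "t1 = (\<Sum>i=1..n. ra i) * (\<Sum>i=1..n. rb i)"
    define t2 where "t2 = N * (\<Sum>i=1..n. ra i * rb i)"
    define t3 where "t3 = N * (\<Sum>k=1..n. ca k * cb k)"
    define r where "r = 4 * t1 - 4 * t2 - 4 * t3"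
    have "\<bar>t1\<bar> \<le> (N * (e * N)) * (N * (e * N))"
      unfolding t1_def abs_mult using tot[of ra] tot[of rb] ra rb N e by (intro mult_mono) auto
    moreover have "\<bar>t2\<bar> \<le> N * (N * (e * N * (e * N)))" "\<bar>t3\<bar> \<le> N * (N * (e * N * (e * N)))"
      unfolding t2_def t3_def abs_mult using sumb[of ra rb] sumb[of ca cb] ra rb ca cb N by (auto intro!: mult_left_mono)
    moreover have "N * (N * (e * N * (e * N))) = N ^ 4 * e\<^sup>2" "(N * (e * N)) * (N * (e * N)) = N ^ 4 * e\<^sup>2"
      by (simp_all add: eval_nat_numeral)
    ultimately have "\<bar>r\<bar> \<le> 12 * (N ^ 4 * e\<^sup>2)" unfolding r_def by linarith
    then have r: "\<bar>r / N ^ 4\<bar> \<le> 12 * e\<^sup>2" using N by (simp add: field_simps)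
    have "e\<^sup>2 \<le> e" using e by (simp add: power2_eq_square mult_left_le)
    moreover have "xprod n ?a ?b / N ^ 4 - 4 * ?h = 4 * (P / N\<^sup>2 - ?h) + r / N ^ 4"
    proof -
      have "xprod n ?a ?b = 4 * (N\<^sup>2 * P) + r" unfolding X r_def t1_def t2_def t3_def by simp
      moreover have "4 * (N\<^sup>2 * P) / N ^ 4 = 4 * (P / N\<^sup>2)" using N by (simp add: eval_nat_numeral)
      ultimately show ?thesis by (simp add: add_divide_distrib)
    qed
    moreover have "\<bar>x\<bar> \<le> 20 * e" if "E \<le> e" "x = 4 * y + z" "\<bar>y\<bar> \<le> 2 * e" "\<bar>z\<bar> \<le> 12 * E" for x y z E
      using that by linarith
    ultimately have "\<bar>xprod n ?a ?b / N ^ 4 - 4 * ?h\<bar> \<le> 20 * e" using P r by blast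
    also have "\<dots> < e0" using e by linarith
    finally show "norm (xprod n ?a ?b / real n ^ 4 - 4 * ?h) < e0" by (simp add: N_def)
  qed
qed

definition dir_mat :: "(real \<times> real \<Rightarrow> real ^ 'l) \<Rightarrow> nat \<Rightarrow> real ^ 'l \<Rightarrow> nat \<Rightarrow> nat \<Rightarrow> real" where
  "dir_mat f n d i k = d \<bullet> f (real i / real n, real k / real n)"

lemma xdiff_dir_mat:
  "xdiff (dir_mat f n d) i j k l = (\<Sum>p\<in>UNIV. d $ p * xdiff (grid_mat (\<lambda>z. f z $ p) n) i j k l)"
  by (simp add: xdiff_def dir_mat_def grid_mat_def inner_vec_def right_diff_distrib distrib_left sum_subtractf sum.distrib)

lemma xprod_dir_mat:
  "xprod n (dir_mat f n d) (dir_mat f n h) =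
    (\<Sum>p\<in>UNIV. \<Sum>q\<in>UNIV. d $ p * h $ q * xprod n (grid_mat (\<lambda>z. f z $ p) n) (grid_mat (\<lambda>z. f z $ q) n))"
proof -
  have "xdiff (dir_mat f n d) i j k l * xdiff (dir_mat f n h) i j k l =
    (\<Sum>p\<in>UNIV. \<Sum>q\<in>UNIV. d $ p * h $ q * (xdiff (grid_mat (\<lambda>z. f z $ p) n) i j k l * xdiff (grid_mat (\<lambda>z. f z $ q) n) i j k l))" for i j k l
    unfolding xdiff_dir_mat sum_product by (simp add: mult_ac)
  moreover have "(\<Sum>i\<in>A. \<Sum>p\<in>UNIV. \<Sum>q\<in>UNIV. c p q * x i p q) = (\<Sum>p\<in>UNIV. \<Sum>q\<in>UNIV. c p q * (\<Sum>i\<in>A. x i p q))"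
    for A :: "nat set" and c :: "'a \<Rightarrow> 'a \<Rightarrow> real" and x :: "nat \<Rightarrow> 'a \<Rightarrow> 'a \<Rightarrow> real"
    unfolding sum_distrib_left by (subst sum.swap, intro sum.cong refl, subst sum.swap, rule refl)
  ultimately show ?thesis unfolding xprod_def by simp
qed

text \<open>
  The expression is bilinear in \<open>(d, h)\<close>, so finitely many limits give one error sequence for all
  directions.
\<close>

theorem xprod_dir_mat_limit:
  fixes f :: "real \<times> real \<Rightarrow> real ^ 'l"
  assumes f: "\<forall>r. (\<lambda>z. f z $ r) \<in> class_C"
  obtains E where "E \<longlonglongrightarrow> 0" "\<And>n. E n \<ge> 0"
    "\<And>n d h. \<bar>xprod n (dir_mat f n d) (dir_mat f n h) / real n ^ 4 - 4 * (d \<bullet> (Gam f *v h))\<bar> \<le> E n * norm d * norm h"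
proof -
  define X where "X n p q = xprod n (grid_mat (\<lambda>z. f z $ p) n) (grid_mat (\<lambda>z. f z $ q) n) / real n ^ 4" for n p q
  define E where "E n = (\<Sum>p\<in>UNIV. \<Sum>q\<in>UNIV. \<bar>X n p q - 4 * Gam f $ p $ q\<bar>)" for n
  have "(\<lambda>n. X n p q) \<longlonglongrightarrow> 4 * Gam f $ p $ q" for p q
    unfolding X_def Gam_def using xprod_limit[of "\<lambda>z. f z $ p" "\<lambda>z. f z $ q"] f by simp
  then have "(\<lambda>n. \<bar>X n p q - 4 * Gam f $ p $ q\<bar>) \<longlonglongrightarrow> 0" for p q
    by (intro tendsto_rabs_zero) (simp add: LIM_zero)
  then have "E \<longlonglongrightarrow> (\<Sum>p\<in>(UNIV :: 'l set). \<Sum>q\<in>(UNIV :: 'l set). 0)"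
    unfolding E_def by (intro tendsto_sum)
  then have E0: "E \<longlonglongrightarrow> 0" by simp
  have bound: "\<bar>xprod n (dir_mat f n d) (dir_mat f n h) / real n ^ 4 - 4 * (d \<bullet> (Gam f *v h))\<bar> \<le> E n * norm d * norm h" for n d h
  proof -
    have "4 * (d \<bullet> (Gam f *v h)) = (\<Sum>p\<in>UNIV. \<Sum>q\<in>UNIV. d $ p * h $ q * (4 * Gam f $ p $ q))"
      by (simp add: inner_vec_def matrix_vector_mult_def sum_distrib_left mult_ac)
    then have "xprod n (dir_mat f n d) (dir_mat f n h) / real n ^ 4 - 4 * (d \<bullet> (Gam f *v h))
        = (\<Sum>p\<in>UNIV. \<Sum>q\<in>UNIV. d $ p * h $ q * (X n p q - 4 * Gam f $ p $ q))"
      unfolding xprod_dir_mat X_def by (simp add: sum_divide_distrib right_diff_distrib sum_subtractf)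
    also have "\<bar>\<dots>\<bar> \<le> (\<Sum>p\<in>UNIV. \<Sum>q\<in>UNIV. norm d * norm h * \<bar>X n p q - 4 * Gam f $ p $ q\<bar>)"
      by (intro order_trans[OF sum_abs] sum_mono)
         (auto simp: abs_mult component_le_norm_cart intro!: mult_mono mult_nonneg_nonneg)
    also have "\<dots> = E n * norm d * norm h" unfolding E_def by (simp add: sum_distrib_left[symmetric] mult_ac)
    finally show ?thesis .
  qed
  show ?thesis by (rule that[OF E0 _ bound]) (simp add: E_def sum_nonneg)
qed

section \<open>The log-partition function and its gradient\<close>

lemma gderiv_along_line:
  fixes Z :: "'a::real_inner \<Rightarrow> real"
  assumes "\<And>x. GDERIV Z x :> G x"
  shows "((\<lambda>s. Z (x + s *\<^sub>R d)) has_real_derivative G (x + s *\<^sub>R d) \<bullet> d) (at s)"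
proof -
  have "(Z has_derivative (\<lambda>h. h \<bullet> G (x + s *\<^sub>R d))) (at (x + s *\<^sub>R d))"
    using assms by (simp add: gderiv_def)
  moreover have "((\<lambda>s. x + s *\<^sub>R d) has_derivative (\<lambda>h. h *\<^sub>R d)) (at s)"
    by (auto intro!: derivative_eq_intros)
  ultimately have "((\<lambda>s. Z (x + s *\<^sub>R d)) has_derivative (\<lambda>h. (h *\<^sub>R d) \<bullet> G (x + s *\<^sub>R d))) (at s)"
    by (rule has_derivative_compose[rotated])
  then show ?thesis
    by (rule has_derivative_imp_has_field_derivative) (simp add: inner_commute)
qed

locale strictly_convex =
  fixes Z :: "'a::euclidean_space \<Rightarrow> real" and G :: "'a \<Rightarrow> 'a"
  assumes grad: "\<And>x. GDERIV Z x :> G x"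
    and mono: "\<And>x y. x \<noteq> y \<Longrightarrow> (G y - G x) \<bullet> (y - x) > 0"
begin

lemma inj_gradient: "G x = G y \<Longrightarrow> x = y"
  using mono[of x y] by force

lemma root_maximises:
  assumes root: "t = G x" and ne: "y \<noteq> x"
  shows "t \<bullet> y - Z y < t \<bullet> x - Z x"
proof -
  let ?l = "\<lambda>s. t \<bullet> (x + s *\<^sub>R (y - x)) - Z (x + s *\<^sub>R (y - x))"
  have der: "(?l has_real_derivative (t \<bullet> (y - x) - G (x + s *\<^sub>R (y - x)) \<bullet> (y - x))) (at s)" for s
    by (intro DERIV_diff gderiv_along_line[OF grad]) (auto intro!: derivative_eq_intros simp: inner_add_right)
  obtain s where s: "0 < s" "s < 1"
    "?l 1 - ?l 0 = (1 - 0) * (t \<bullet> (y - x) - G (x + s *\<^sub>R (y - x)) \<bullet> (y - x))"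
    using MVT2[of 0 1 ?l "\<lambda>s. t \<bullet> (y - x) - G (x + s *\<^sub>R (y - x)) \<bullet> (y - x)"] der by auto
  let ?z = "x + s *\<^sub>R (y - x)"
  have "(G ?z - G x) \<bullet> (?z - x) > 0" using s ne by (intro mono) auto
  then have "s * ((G ?z - G x) \<bullet> (y - x)) > 0" by simp
  then have "(G ?z - t) \<bullet> (y - x) > 0" using s root by (simp add: zero_less_mult_iff)
  then show ?thesis using s(3) by (simp add: inner_diff_left inner_diff_right)
qed

text \<open>
  The concave function \<open>x \<mapsto> t \<bullet> x - Z x\<close> attains its maximum on the closed ball.  On the sphere it
  strictly increases towards the centre, so the maximum is in the interior and hence critical.
\<close>

lemma root_in_ball:
  assumes r: "r > 0" and sphere: "\<And>x. dist x c = r \<Longrightarrow> (G x - t) \<bullet> (x - c) > 0"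
  obtains x where "t = G x" "dist x c < r"
proof -
  let ?l = "\<lambda>x. t \<bullet> x - Z x"
  have dZ: "(Z has_derivative (\<lambda>h. h \<bullet> G x)) (at x)" for x using grad by (simp add: gderiv_def)
  have cZ: "continuous_on (cball c r) Z"
    by (rule continuous_at_imp_continuous_on) (use dZ has_derivative_continuous in blast)
  have cl: "continuous_on (cball c r) ?l" by (intro continuous_intros cZ)
  have "\<exists>x\<in>cball c r. \<forall>y\<in>cball c r. ?l y \<le> ?l x"
    by (rule continuous_attains_sup[OF compact_cball _ cl]) (use r in auto)
  then obtain x where x: "x \<in> cball c r" "\<And>y. y \<in> cball c r \<Longrightarrow> ?l y \<le> ?l x" by blast
  have "dist x c \<noteq> r"
  proof
    assume d: "dist x c = r"
    let ?p = "\<lambda>s. ?l (x + s *\<^sub>R (c - x))"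
    have "(?p has_real_derivative (t \<bullet> (c - x) - G (x + 0 *\<^sub>R (c - x)) \<bullet> (c - x))) (at 0)"
      by (intro DERIV_diff gderiv_along_line[OF grad]) (auto intro!: derivative_eq_intros simp: inner_add_right)
    moreover have "t \<bullet> (c - x) - G (x + 0 *\<^sub>R (c - x)) \<bullet> (c - x) > 0"
      using sphere[OF d] by (simp add: inner_diff_left inner_diff_right)
    ultimately obtain \<delta> where \<delta>: "\<delta> > 0" "\<And>h. h > 0 \<Longrightarrow> h < \<delta> \<Longrightarrow> ?p 0 < ?p (0 + h)"
      using DERIV_pos_inc_right by blast
    define h where "h = min (\<delta> / 2) 1"
    have h: "h > 0" "h < \<delta>" "h \<le> 1" using \<delta>(1) by (auto simp: h_def)
    have "dist c (x + h *\<^sub>R (c - x)) = (1 - h) * dist c x"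
    proof -
      have "c - (x + h *\<^sub>R (c - x)) = (1 - h) *\<^sub>R (c - x)" by (simp add: algebra_simps)
      then show ?thesis using h by (simp add: dist_norm)
    qed
    also have "\<dots> \<le> 1 * r" using h d by (intro mult_mono) (auto simp: dist_commute)
    finally have "?p h \<le> ?p 0" using x(2) by simp
    then show False using \<delta>(2)[of h] h by simp
  qed
  then have lt: "dist x c < r" using x(1) by (simp add: dist_commute)
  have "(\<lambda>h. t \<bullet> h - h \<bullet> G x) = (\<lambda>h. 0)"
  proof (rule differential_zero_maxmin[of x "ball c r" ?l])
    show "(?l has_derivative (\<lambda>h. t \<bullet> h - h \<bullet> G x)) (at x)"
      by (intro has_derivative_diff dZ bounded_linear_imp_has_derivative bounded_linear_inner_right)
  qed (use lt x(2) in \<open>auto simp: dist_commute\<close>)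
  then have "(t - G x) \<bullet> (t - G x) = 0"
    by (metis inner_commute inner_diff_left)
  then have "t = G x" by simp
  then show ?thesis using that lt by blast
qed

end

lemma lin_stat_dir_mat: "lin_stat {1..n} (dir_mat f n d) \<pi> = d \<bullet> suff_stat f n \<pi>"
  by (simp add: lin_stat_def dir_mat_def suff_stat_def inner_sum_right)

locale perm_model =
  fixes f :: "real \<times> real \<Rightarrow> real ^ 'l"
  assumes indep: "lin_indep f" and class_C: "\<forall>r. (\<lambda>z. f z $ r) \<in> class_C"
begin

lemma fbound_exists: "\<exists>fbound>0. \<forall>z\<in>unit_square. norm (f z) \<le> fbound"
proof -
  have "\<exists>c. \<forall>z\<in>unit_square. \<bar>f z $ r\<bar> \<le> c" for r
  proof -
    have "compact ((\<lambda>z. f z $ r) ` unit_square)"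
      using class_C unfolding unit_square_cbox by (intro compact_continuous_image) (auto simp: class_C_def unit_square_cbox)
    from compact_imp_bounded[OF this] show ?thesis unfolding bounded_iff by auto
  qed
  then obtain c where c: "\<And>r z. z \<in> unit_square \<Longrightarrow> \<bar>f z $ r\<bar> \<le> c r" by metis
  have "norm (f z) \<le> max 1 (\<Sum>r\<in>UNIV. c r)" if "z \<in> unit_square" for z
    using order_trans[OF norm_le_l1_cart sum_mono[of UNIV "\<lambda>r. \<bar>f z $ r\<bar>" c]] c[OF that] by fastforce
  then show ?thesis by (intro exI[of _ "max 1 (\<Sum>r\<in>UNIV. c r)"]) auto
qed

definition fbound :: real where "fbound = (SOME fbound. fbound > 0 \<and> (\<forall>z\<in>unit_square. norm (f z) \<le> fbound))"

lemma fbound: "fbound > 0" "z \<in> unit_square \<Longrightarrow> norm (f z) \<le> fbound"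
  using someI_ex[of "\<lambda>fbound. fbound > 0 \<and> (\<forall>z\<in>unit_square. norm (f z) \<le> fbound)"] fbound_exists
  unfolding fbound_def by auto

lemma Gam_symmetric: "transpose (Gam f) = Gam f"
  by (simp add: transpose_def Gam_def vec_eq_iff mult.commute)

lemma Gam_pos: "d \<noteq> 0 \<Longrightarrow> d \<bullet> (Gam f *v d) > 0"
  by (rule Gam_pos_def[OF indep class_C])

lemma Gam_coercive: "\<exists>coercivity>0. \<forall>d. coercivity * (norm d)\<^sup>2 \<le> d \<bullet> (Gam f *v d)"
proof -
  have cont: "continuous_on (sphere 0 1) (\<lambda>d. d \<bullet> (Gam f *v d))"
    by (intro continuous_intros linear_continuous_on) (simp add: linear_conv_bounded_linear[symmetric])
  have "axis undefined 1 \<in> (sphere 0 1 :: (real ^ 'l) set)" by (simp add: norm_axis_1)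
  then obtain u :: "real ^ 'l" where u: "u \<in> sphere 0 1" "\<And>v. v \<in> sphere 0 1 \<Longrightarrow> u \<bullet> (Gam f *v u) \<le> v \<bullet> (Gam f *v v)"
    using continuous_attains_inf[OF compact_sphere _ cont] by blast
  let ?coercivity = "u \<bullet> (Gam f *v u)"
  have "?coercivity * (norm d)\<^sup>2 \<le> d \<bullet> (Gam f *v d)" for d
  proof (cases "d = 0")
    case False
    have "?coercivity \<le> ((1 / norm d) *\<^sub>R d) \<bullet> (Gam f *v ((1 / norm d) *\<^sub>R d))"
      using False by (intro u(2)) simp
    also have "\<dots> = (d \<bullet> (Gam f *v d)) / (norm d)\<^sup>2"
      by (simp add: matrix_vector_mult_scaleR power2_eq_square)
    finally show ?thesis using False by (simp add: field_simps)
  qed simp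
  moreover have "u \<noteq> 0" using u(1) by auto
  ultimately show ?thesis using Gam_pos by blast
qed

definition coercivity :: real where "coercivity = (SOME coercivity. coercivity > 0 \<and> (\<forall>d. coercivity * (norm d)\<^sup>2 \<le> d \<bullet> (Gam f *v d)))"

lemma coercivity: "coercivity > 0" "coercivity * (norm d)\<^sup>2 \<le> d \<bullet> (Gam f *v d)"
  using someI_ex[of "\<lambda>coercivity. coercivity > 0 \<and> (\<forall>d. coercivity * (norm d)\<^sup>2 \<le> d \<bullet> (Gam f *v d))"] Gam_coercive
  unfolding coercivity_def by auto

text \<open>
  One error sequence for all directions, chosen once so that later estimates can be uniform in the
  parameter.
\<close>

definition riemann_err :: "nat \<Rightarrow> real" where
  "riemann_err = (SOME E. E \<longlonglongrightarrow> 0 \<and> (\<forall>n. E n \<ge> 0) \<and>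
    (\<forall>n d h. \<bar>xprod n (dir_mat f n d) (dir_mat f n h) / real n ^ 4 - 4 * (d \<bullet> (Gam f *v h))\<bar> \<le> E n * norm d * norm h))"

lemma riemann_err: "riemann_err \<longlonglongrightarrow> 0" "riemann_err n \<ge> 0"
    "\<bar>xprod n (dir_mat f n d) (dir_mat f n h) / real n ^ 4 - 4 * (d \<bullet> (Gam f *v h))\<bar> \<le> riemann_err n * norm d * norm h"
proof -
  have "\<exists>E. E \<longlonglongrightarrow> 0 \<and> (\<forall>n. E n \<ge> 0) \<and>
    (\<forall>n d h. \<bar>xprod n (dir_mat f n d) (dir_mat f n h) / real n ^ 4 - 4 * (d \<bullet> (Gam f *v h))\<bar> \<le> E n * norm d * norm h)"
    by (rule xprod_dir_mat_limit[OF class_C]) blast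
  from someI_ex[OF this] show "riemann_err \<longlonglongrightarrow> 0" "riemann_err n \<ge> 0"
    "\<bar>xprod n (dir_mat f n d) (dir_mat f n h) / real n ^ 4 - 4 * (d \<bullet> (Gam f *v h))\<bar> \<le> riemann_err n * norm d * norm h"
    unfolding riemann_err_def by blast+
qed

lemma dir_mat_bound:
  assumes "i \<in> {1..n}" "k \<in> {1..n}"
  shows "\<bar>dir_mat f n d i k\<bar> \<le> fbound * norm d"
proof -
  have "(real i / real n, real k / real n) \<in> unit_square"
    using grid_in_square assms by (simp add: unit_square_def)
  then have "norm d * norm (f (real i / real n, real k / real n)) \<le> norm d * fbound"
    by (intro mult_left_mono fbound) auto
  then show ?thesis unfolding dir_mat_def
    using order_trans[OF Cauchy_Schwarz_ineq2] by (simp add: mult.commute)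
qed

abbreviation tilted_mean :: "nat \<Rightarrow> real ^ 'l \<Rightarrow> ((nat \<Rightarrow> nat) \<Rightarrow> real) \<Rightarrow> real" where
  "tilted_mean n \<theta> \<equiv> perm_weights.expec {1..n} (dir_mat f n \<theta>)"

abbreviation grad_Z :: "nat \<Rightarrow> real ^ 'l \<Rightarrow> real ^ 'l" where
  "grad_Z n \<equiv> gradient (log_partition f n)"

lemma weights:
  assumes "n \<ge> 1" "norm \<theta> \<le> \<rho>"
  shows "perm_weights {1..n} (dir_mat f n \<theta>) (fbound * \<rho>)"
proof
  show "\<bar>dir_mat f n \<theta> i k\<bar> \<le> fbound * \<rho>" if "i \<in> {1..n}" "k \<in> {1..n}" for i k
    using dir_mat_bound[OF that, of \<theta>] assms fbound(1) by (meson mult_left_mono order_trans less_imp_le)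
qed (use assms in auto)

lemma integral_perm_pmf:
  fixes G :: "(nat \<Rightarrow> nat) \<Rightarrow> 'b::{banach, second_countable_topology}"
  shows "(\<integral>\<pi>. G \<pi> \<partial>measure_pmf (perm_pmf f n \<theta>)) =
    (\<Sum>\<pi> | \<pi> permutes {1..n}. exp (\<theta> \<bullet> suff_stat f n \<pi> - log_partition f n \<theta>) *\<^sub>R G \<pi>)"
proof -
  have "(\<integral>\<pi>. G \<pi> \<partial>measure_pmf (perm_pmf f n \<theta>)) =
      (\<Sum>\<pi> | \<pi> permutes {1..n}. pmf (perm_pmf f n \<theta>) \<pi> *\<^sub>R G \<pi>)"
    by (rule integral_measure_pmf) (auto simp: finite_permutations set_pmf_iff pmf_perm_pmf split: if_splits)
  then show ?thesis by (simp add: pmf_perm_pmf)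
qed

lemma integral_perm_pmf_real:
  fixes G :: "(nat \<Rightarrow> nat) \<Rightarrow> real"
  assumes n: "n \<ge> 1"
  shows "(\<integral>\<pi>. G \<pi> \<partial>measure_pmf (perm_pmf f n \<theta>)) = tilted_mean n \<theta> G"
proof -
  interpret W: perm_weights "{1..n}" "dir_mat f n \<theta>" "fbound * norm \<theta>" by (rule weights[OF n order_refl])
  show ?thesis
    unfolding integral_perm_pmf exp_diff log_partition_def exp_ln[OF partition_pos]
      W.expec_def W.mean_def W.W_def W.wt_def W.perms_def lin_stat_dir_mat
    by (simp add: sum_divide_distrib)
qed

lemma prob_perm_pmf:
  "measure_pmf.prob (perm_pmf f n \<theta>) A = (\<integral>\<pi>. indicator A \<pi> \<partial>measure_pmf (perm_pmf f n \<theta>))"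
  by simp

lemma inner_grad_Z:
  assumes n: "n \<ge> 1"
  shows "d \<bullet> grad_Z n \<theta> = tilted_mean n \<theta> (\<lambda>\<pi>. d \<bullet> suff_stat f n \<pi>)"
    and "((\<lambda>s. d \<bullet> grad_Z n (\<theta> + s *\<^sub>R d)) has_real_derivative
      perm_weights.var {1..n} (dir_mat f n (\<theta> + s *\<^sub>R d)) (\<lambda>\<pi>. d \<bullet> suff_stat f n \<pi>)) (at s)"
proof -
  let ?P = "{\<pi>. \<pi> permutes {1..n}}"
  let ?T = "suff_stat f n"
  have ex_eq: "tilted_mean n \<theta> G = (\<Sum>\<pi>\<in>?P. exp (\<theta> \<bullet> ?T \<pi>) * G \<pi>) / (\<Sum>\<pi>\<in>?P. exp (\<theta> \<bullet> ?T \<pi>))" for \<theta> G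
  proof -
    interpret W: perm_weights "{1..n}" "dir_mat f n \<theta>" "fbound * norm \<theta>" by (rule weights[OF n order_refl])
    show ?thesis unfolding W.expec_def W.mean_def W.W_def W.wt_def W.perms_def lin_stat_dir_mat ..
  qed
  have de: "((\<lambda>s. exp ((\<theta> + s *\<^sub>R d) \<bullet> ?T \<pi>)) has_real_derivative exp ((\<theta> + s *\<^sub>R d) \<bullet> ?T \<pi>) * (d \<bullet> ?T \<pi>)) (at s)" for \<theta> s \<pi>
    by (auto intro!: derivative_eq_intros simp: inner_add_left)
  have dW: "((\<lambda>s. \<Sum>\<pi>\<in>?P. exp ((\<theta> + s *\<^sub>R d) \<bullet> ?T \<pi>)) has_real_derivative
      (\<Sum>\<pi>\<in>?P. exp ((\<theta> + s *\<^sub>R d) \<bullet> ?T \<pi>) * (d \<bullet> ?T \<pi>))) (at s)" for \<theta> s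
    by (intro DERIV_sum de)
  have grad: "d \<bullet> grad_Z n \<theta> = tilted_mean n \<theta> (\<lambda>\<pi>. d \<bullet> ?T \<pi>)" for \<theta>
  proof -
    have "((\<lambda>s. log_partition f n (\<theta> + s *\<^sub>R d)) has_real_derivative grad_Z n (\<theta> + 0 *\<^sub>R d) \<bullet> d) (at 0)"
      by (rule gderiv_along_line[OF GDERIV_log_partition])
    moreover have "((\<lambda>s. log_partition f n (\<theta> + s *\<^sub>R d)) has_real_derivative
        inverse (\<Sum>\<pi>\<in>?P. exp ((\<theta> + 0 *\<^sub>R d) \<bullet> ?T \<pi>)) * (\<Sum>\<pi>\<in>?P. exp ((\<theta> + 0 *\<^sub>R d) \<bullet> ?T \<pi>) * (d \<bullet> ?T \<pi>))) (at 0)"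
      unfolding log_partition_def by (rule DERIV_chain2[OF DERIV_ln[OF partition_pos] dW])
    ultimately have "grad_Z n (\<theta> + 0 *\<^sub>R d) \<bullet> d
        = inverse (\<Sum>\<pi>\<in>?P. exp ((\<theta> + 0 *\<^sub>R d) \<bullet> ?T \<pi>)) * (\<Sum>\<pi>\<in>?P. exp ((\<theta> + 0 *\<^sub>R d) \<bullet> ?T \<pi>) * (d \<bullet> ?T \<pi>))"
      by (rule DERIV_unique)
    then show ?thesis unfolding ex_eq by (simp add: inner_commute divide_inverse mult.commute)
  qed
  show "d \<bullet> grad_Z n \<theta> = tilted_mean n \<theta> (\<lambda>\<pi>. d \<bullet> ?T \<pi>)" by (rule grad)
  let ?th = "\<theta> + s *\<^sub>R d"
  define w where "w = (\<Sum>\<pi>\<in>?P. exp (?th \<bullet> ?T \<pi>))"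
  define w1 where "w1 = (\<Sum>\<pi>\<in>?P. exp (?th \<bullet> ?T \<pi>) * (d \<bullet> ?T \<pi>))"
  define w2 where "w2 = (\<Sum>\<pi>\<in>?P. exp (?th \<bullet> ?T \<pi>) * (d \<bullet> ?T \<pi>)\<^sup>2)"
  have w0: "w \<noteq> 0" using partition_pos[of ?th f n] by (simp add: w_def)
  have dW1: "((\<lambda>s. \<Sum>\<pi>\<in>?P. exp ((\<theta> + s *\<^sub>R d) \<bullet> ?T \<pi>) * (d \<bullet> ?T \<pi>)) has_real_derivative w2) (at s)"
    unfolding w2_def
  proof (intro DERIV_sum)
    fix \<pi>
    show "((\<lambda>s. exp ((\<theta> + s *\<^sub>R d) \<bullet> ?T \<pi>) * (d \<bullet> ?T \<pi>)) has_real_derivative exp (?th \<bullet> ?T \<pi>) * (d \<bullet> ?T \<pi>)\<^sup>2) (at s)"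
      using DERIV_cmult_right[OF de[of \<theta> \<pi> s], of "d \<bullet> ?T \<pi>"] by (simp only: power2_eq_square mult.assoc)
  qed
  have "((\<lambda>s. tilted_mean n (\<theta> + s *\<^sub>R d) (\<lambda>\<pi>. d \<bullet> ?T \<pi>)) has_real_derivative (w2 * w - w1 * w1) / (w * w)) (at s)"
    unfolding ex_eq w_def w1_def by (rule DERIV_divide[OF dW1 dW]) (use w0 in \<open>simp only: w_def not_False_eq_True\<close>)
  moreover have "(w2 * w - w1 * w1) / (w * w) = perm_weights.var {1..n} (dir_mat f n ?th) (\<lambda>\<pi>. d \<bullet> ?T \<pi>)"
  proof -
    interpret W: perm_weights "{1..n}" "dir_mat f n ?th" "fbound * norm ?th" by (rule weights[OF n order_refl])
    define m where "m = W.expec (\<lambda>\<pi>. d \<bullet> ?T \<pi>)"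
    have m: "m = w1 / w" unfolding m_def ex_eq w1_def w_def ..
    have "W.var (\<lambda>\<pi>. d \<bullet> ?T \<pi>) = W.expec (\<lambda>\<pi>. (d \<bullet> ?T \<pi>)\<^sup>2 - 2 * m * (d \<bullet> ?T \<pi>) + m\<^sup>2)"
      unfolding W.var_def m_def[symmetric] by (intro W.expec_cong) (simp add: power2_eq_square algebra_simps)
    also have "\<dots> = W.expec (\<lambda>\<pi>. (d \<bullet> ?T \<pi>)\<^sup>2) - 2 * m * m + m\<^sup>2"
      by (simp only: W.expec_linear W.expec_const m_def)
    also have "W.expec (\<lambda>\<pi>. (d \<bullet> ?T \<pi>)\<^sup>2) = w2 / w" unfolding ex_eq w2_def w_def ..
    finally have "W.var (\<lambda>\<pi>. d \<bullet> ?T \<pi>) = w2 / w - m\<^sup>2" by (simp add: power2_eq_square)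
    then show ?thesis unfolding m using w0 by (simp add: field_simps power2_eq_square)
  qed
  ultimately show "((\<lambda>s. d \<bullet> grad_Z n (\<theta> + s *\<^sub>R d)) has_real_derivative
      perm_weights.var {1..n} (dir_mat f n ?th) (\<lambda>\<pi>. d \<bullet> ?T \<pi>)) (at s)"
    unfolding grad by simp
qed

lemma grad_Z_increment:
  assumes n: "n \<ge> 1"
  obtains s where "0 < s" "s < 1"
    "(grad_Z n (\<theta> + d) - grad_Z n \<theta>) \<bullet> d = perm_weights.var {1..n} (dir_mat f n (\<theta> + s *\<^sub>R d)) (\<lambda>\<pi>. d \<bullet> suff_stat f n \<pi>)"
proof -
  let ?g = "\<lambda>s. d \<bullet> grad_Z n (\<theta> + s *\<^sub>R d)"
  obtain s where "0 < s" "s < 1" "?g 1 - ?g 0 = (1 - 0) * perm_weights.var {1..n} (dir_mat f n (\<theta> + s *\<^sub>R d)) (\<lambda>\<pi>. d \<bullet> suff_stat f n \<pi>)"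
    using MVT2[of 0 1 ?g "\<lambda>s. perm_weights.var {1..n} (dir_mat f n (\<theta> + s *\<^sub>R d)) (\<lambda>\<pi>. d \<bullet> suff_stat f n \<pi>)"]
      inner_grad_Z(2)[OF n, where d = d and \<theta> = \<theta>] by auto
  moreover have "(grad_Z n (\<theta> + d) - grad_Z n \<theta>) \<bullet> d = ?g 1 - ?g 0"
    by (simp add: inner_diff_right inner_commute)
  ultimately show ?thesis using that[of s] by simp
qed

definition lower_const :: "real \<Rightarrow> real" where
  "lower_const \<rho> = (3 * coercivity)\<^sup>2 / (4 * (1 + exp (4 * (fbound * \<rho>)))\<^sup>2 * exp (4 * (fbound * \<rho>)) ^ 6 * 32\<^sup>2 * fbound\<^sup>2)"

lemma lower_const_pos: "lower_const \<rho> > 0"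
proof -
  define x where "x = exp (4 * (fbound * \<rho>))"
  have x: "x > 0" "1 + x > 0" using exp_gt_zero[of "4 * (fbound * \<rho>)"] unfolding x_def by linarith+
  show ?thesis unfolding lower_const_def x_def[symmetric]
    by (intro divide_pos_pos mult_pos_pos zero_less_power x fbound(1) coercivity(1)) simp_all
qed

lemma variance_lower:
  assumes n: "n \<ge> 1" and \<rho>: "norm \<theta> \<le> \<rho>" and e: "riemann_err n \<le> coercivity"
  shows "lower_const \<rho> * (norm d)\<^sup>2 * real n \<le> perm_weights.var {1..n} (dir_mat f n \<theta>) (\<lambda>\<pi>. d \<bullet> suff_stat f n \<pi>)"
proof -
  interpret W: perm_weights "{1..n}" "dir_mat f n \<theta>" "fbound * \<rho>" by (rule weights[OF n \<rho>])
  show ?thesis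
  proof (cases "d = 0")
    case True
    have "0 \<le> W.var (\<lambda>\<pi>. d \<bullet> suff_stat f n \<pi>)" unfolding W.var_def by (rule W.expec_nonneg) simp
    then show ?thesis using True by (simp del: One_nat_def)
  next
    case False
    let ?S = "xprod n (dir_mat f n d) (dir_mat f n d) / real n ^ 4"
    have "riemann_err n * norm d * norm d \<le> coercivity * (norm d)\<^sup>2"
      using e by (simp add: power2_eq_square mult.assoc mult_right_mono)
    \<comment> \<open>The Riemann error takes at most one of the four multiples of \<open>coercivity\<close> in the limit.\<close>
    then have S: "3 * coercivity * (norm d)\<^sup>2 \<le> ?S" using riemann_err(3)[of n d d] coercivity(2)[of d] by linarith
    have "(3 * coercivity * (norm d)\<^sup>2)\<^sup>2 \<le> ?S\<^sup>2" using S coercivity(1) by (intro power_mono) auto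
    then have "(3 * coercivity * (norm d)\<^sup>2)\<^sup>2 / (4 * (1 + W.R)\<^sup>2 * W.R ^ 6 * 32\<^sup>2 * (fbound * norm d)\<^sup>2) * real n
        \<le> ?S\<^sup>2 / (4 * (1 + W.R)\<^sup>2 * W.R ^ 6 * 32\<^sup>2 * (fbound * norm d)\<^sup>2) * real n"
      using W.R0 by (intro mult_right_mono divide_right_mono) auto
    also have "\<dots> \<le> W.var (lin_stat {1..n} (dir_mat f n d))"
      using W.lin_stat_variance_lower[of "dir_mat f n d" "fbound * norm d"] dir_mat_bound fbound(1) False
      unfolding xprod_def by (simp add: power2_eq_square)
    also have "lin_stat {1..n} (dir_mat f n d) = (\<lambda>\<pi>. d \<bullet> suff_stat f n \<pi>)"
      by (rule ext) (rule lin_stat_dir_mat)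
    also have "(3 * coercivity * (norm d)\<^sup>2)\<^sup>2 / (4 * (1 + W.R)\<^sup>2 * W.R ^ 6 * 32\<^sup>2 * (fbound * norm d)\<^sup>2) * real n
        = lower_const \<rho> * (norm d)\<^sup>2 * real n"
    proof -
      have "(x * y\<^sup>2)\<^sup>2 / (q * (z * y)\<^sup>2) * m = x\<^sup>2 / (q * z\<^sup>2) * y\<^sup>2 * m" if "y \<noteq> 0" for x y q z m :: real
        using that by (simp add: power_mult_distrib power2_eq_square)
      from this[of "norm d" "3 * coercivity" "4 * (1 + W.R)\<^sup>2 * W.R ^ 6 * 32\<^sup>2" fbound "real n"] show ?thesis
        using False unfolding lower_const_def W.R_def by simp
    qed
    finally show ?thesis .
  qed
qed

lemma grad_Z_strongly_monotone:
  assumes n: "n \<ge> 1" and e: "riemann_err n \<le> coercivity" and \<rho>: "norm \<theta> \<le> \<rho>" "norm \<theta>' \<le> \<rho>"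
  shows "lower_const \<rho> * (norm (\<theta>' - \<theta>))\<^sup>2 * real n \<le> (grad_Z n \<theta>' - grad_Z n \<theta>) \<bullet> (\<theta>' - \<theta>)"
proof -
  obtain s where s: "0 < s" "s < 1"
    "(grad_Z n (\<theta> + (\<theta>' - \<theta>)) - grad_Z n \<theta>) \<bullet> (\<theta>' - \<theta>) = perm_weights.var {1..n} (dir_mat f n (\<theta> + s *\<^sub>R (\<theta>' - \<theta>))) (\<lambda>\<pi>. (\<theta>' - \<theta>) \<bullet> suff_stat f n \<pi>)"
    by (rule grad_Z_increment[OF n])
  have "\<theta> + s *\<^sub>R (\<theta>' - \<theta>) = (1 - s) *\<^sub>R \<theta> + s *\<^sub>R \<theta>'" by (simp add: algebra_simps)
  also have "norm \<dots> \<le> (1 - s) * norm \<theta> + s * norm \<theta>'"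
    using s norm_triangle_ineq[of "(1 - s) *\<^sub>R \<theta>" "s *\<^sub>R \<theta>'"] by simp
  also have "\<dots> \<le> (1 - s) * \<rho> + s * \<rho>" using s \<rho> by (intro add_mono mult_left_mono) auto
  finally have "norm (\<theta> + s *\<^sub>R (\<theta>' - \<theta>)) \<le> \<rho>" by (simp add: algebra_simps)
  from variance_lower[OF n this e] show ?thesis using s(3) by simp
qed

lemma strictly_convex_log_partition:
  assumes n: "n \<ge> 1" and e: "riemann_err n \<le> coercivity"
  shows "strictly_convex (log_partition f n) (grad_Z n)"
proof
  show "GDERIV (log_partition f n) x :> grad_Z n x" for x by (rule GDERIV_log_partition)
  show "(grad_Z n y - grad_Z n x) \<bullet> (y - x) > 0" if "x \<noteq> y" for x y
  proof -
    have "0 < lower_const (max (norm x) (norm y)) * (norm (y - x))\<^sup>2 * real n"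
      using lower_const_pos that n by (intro mult_pos_pos) auto
    also have "\<dots> \<le> (grad_Z n y - grad_Z n x) \<bullet> (y - x)" by (rule grad_Z_strongly_monotone[OF n e]) auto
    finally show ?thesis .
  qed
qed

lemma theta_ML_root:
  assumes n: "n \<ge> 1" and e: "riemann_err n \<le> coercivity" and \<pi>: "\<pi> permutes {1..n}" and root: "suff_stat f n \<pi> = grad_Z n \<theta>"
  shows "theta_ML f n \<pi> = \<theta>"
proof -
  interpret Z: strictly_convex "log_partition f n" "grad_Z n" by (rule strictly_convex_log_partition[OF n e])
  let ?p = "\<lambda>\<theta>. pmf (perm_pmf f n \<theta>) \<pi>"
  have less: "?p \<theta>' < ?p \<theta>" if "\<theta>' \<noteq> \<theta>" for \<theta>'
    using Z.root_maximises[OF root that] \<pi> by (simp add: pmf_perm_pmf inner_commute)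
  have "is_arg_max ?p (\<lambda>_. True) = (\<lambda>\<theta>'. \<theta>' = \<theta>)"
    using less unfolding is_arg_max_def fun_eq_iff by (metis less_asym)
  then show ?thesis unfolding theta_ML_def arg_max_def by simp
qed

text \<open>
  Each coordinate of the sufficient statistic changes by at most \<open>4 * fbound\<close> under a
  transposition, so \<open>variance_bounded_differences\<close> applies to it.
\<close>

lemma second_moment:
  assumes n: "n \<ge> 1"
  shows "(\<integral>\<pi>. (norm (suff_stat f n \<pi> - grad_Z n \<theta>))\<^sup>2 \<partial>measure_pmf (perm_pmf f n \<theta>))
    \<le> real CARD('l) * (exp (4 * (fbound * norm \<theta>)) * (4 * fbound))\<^sup>2 * real n"
proof -
  interpret W: perm_weights "{1..n}" "dir_mat f n \<theta>" "fbound * norm \<theta>" by (rule weights[OF n order_refl])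
  have var: "W.expec (\<lambda>\<pi>. ((suff_stat f n \<pi> - grad_Z n \<theta>) $ r)\<^sup>2) \<le> (exp (4 * (fbound * norm \<theta>)) * (4 * fbound))\<^sup>2 * real n" for r
  proof -
    let ?d = "axis r 1 :: real ^ 'l"
    have lip: "W.lip (\<lambda>\<pi>. ?d \<bullet> suff_stat f n \<pi>) (4 * fbound)"
      unfolding W.lip_def lin_stat_dir_mat[symmetric]
    proof (intro allI impI)
      fix \<pi> i j assume *: "\<pi> permutes {1..n}" "i \<in> {1..n}" "j \<in> {1..n}"
      have pij: "\<pi> i \<in> {1..n}" "\<pi> j \<in> {1..n}" using * permutes_in_image[OF *(1)] by blast+
      have b: "\<bar>dir_mat f n ?d i k\<bar> \<le> fbound" if "i \<in> {1..n}" "k \<in> {1..n}" for i k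
        using dir_mat_bound[OF that, of ?d] unfolding norm_axis_1 by simp
      have "\<bar>xdiff (dir_mat f n ?d) i j (\<pi> i) (\<pi> j)\<bar> \<le> 4 * fbound"
        using b[OF *(2) pij(1)] b[OF *(3) pij(2)] b[OF *(2) pij(2)] b[OF *(3) pij(1)] unfolding xdiff_def by linarith
      then show "\<bar>lin_stat {1..n} (dir_mat f n ?d) (swap i j \<pi>) - lin_stat {1..n} (dir_mat f n ?d) \<pi>\<bar> \<le> 4 * fbound"
        unfolding lin_stat_swap[OF W.fin *(2,3)] by simp
    qed
    have "(suff_stat f n \<pi> - grad_Z n \<theta>) $ r = ?d \<bullet> suff_stat f n \<pi> - W.expec (\<lambda>\<pi>. ?d \<bullet> suff_stat f n \<pi>)" for \<pi>
      unfolding inner_grad_Z(1)[OF n, symmetric] inner_diff_right[symmetric] by (simp add: inner_axis')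
    then have "W.expec (\<lambda>\<pi>. ((suff_stat f n \<pi> - grad_Z n \<theta>) $ r)\<^sup>2) = W.var (\<lambda>\<pi>. ?d \<bullet> suff_stat f n \<pi>)"
      unfolding W.var_def by simp
    also have "\<dots> \<le> real (card {1..n}) * (W.R * (4 * fbound))\<^sup>2" by (rule W.variance_bounded_differences[OF lip])
    finally show ?thesis unfolding W.R_def by (simp add: mult.commute)
  qed
  have "(\<integral>\<pi>. (norm (suff_stat f n \<pi> - grad_Z n \<theta>))\<^sup>2 \<partial>measure_pmf (perm_pmf f n \<theta>))
      = W.expec (\<lambda>\<pi>. \<Sum>r\<in>UNIV. ((suff_stat f n \<pi> - grad_Z n \<theta>) $ r)\<^sup>2)"
    unfolding integral_perm_pmf_real[OF n] by (simp add: norm_vec_def L2_set_def sum_nonneg)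
  also have "\<dots> \<le> (\<Sum>r\<in>(UNIV :: 'l set). (exp (4 * (fbound * norm \<theta>)) * (4 * fbound))\<^sup>2 * real n)"
    unfolding W.expec_linear by (intro sum_mono var)
  finally show ?thesis by (simp add: mult.assoc)
qed

end

section \<open>Consistency\<close>

lemma const_over_sqrt_tendsto_0: "(\<lambda>n. c / sqrt (real n)) \<longlonglongrightarrow> 0"
proof (rule tendsto_divide_0[OF tendsto_const filterlim_at_top_imp_at_infinity])
  show "filterlim (\<lambda>n. sqrt (real n)) at_top sequentially"
    by (rule filterlim_compose[OF sqrt_at_top filterlim_real_sequentially])
qed

lemma const_over_pred_tendsto_0: "(\<lambda>n. c / (real n - 1)) \<longlonglongrightarrow> 0"
proof (rule tendsto_divide_0[OF tendsto_const filterlim_at_top_imp_at_infinity])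
  have "filterlim (\<lambda>n. - 1 + real n) at_top sequentially"
    by (rule filterlim_tendsto_add_at_top[OF tendsto_const filterlim_real_sequentially])
  then show "filterlim (\<lambda>n. real n - 1) at_top sequentially" by simp
qed

lemma (in prob_space) norm_integral_le_off_event:
  fixes Y :: "'a \<Rightarrow> 'b::{banach, second_countable_topology}"
  assumes [measurable]: "Y \<in> borel_measurable M" "A \<in> events"
    and b: "\<And>x. norm (Y x) \<le> b" and c: "c \<ge> 0" "\<And>x. x \<notin> A \<Longrightarrow> norm (Y x) \<le> c"
  shows "norm (\<integral>x. Y x \<partial>M) \<le> c + b * prob A"
proof -
  define Z where "Z x = c + b * indicator A x" for x :: 'a
  have ind: "integrable M (indicator A :: 'a \<Rightarrow> real)"
    by (rule integrable_bounded[where B = 1]) (auto simp: indicator_def)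
  have Z: "integrable M Z" "(\<integral>x. Z x \<partial>M) = c + b * prob A"
    using ind assms(2) by (simp_all add: Z_def[abs_def] prob_space)
  have "norm (\<integral>x. Y x \<partial>M) \<le> (\<integral>x. norm (Y x) \<partial>M)" by (rule integral_norm_bound)
  also have "\<dots> \<le> (\<integral>x. Z x \<partial>M)"
  proof (rule Bochner_Integration.integral_mono[OF _ Z(1)])
    show "integrable M (\<lambda>x. norm (Y x))" by (rule integrable_bounded[where B = b]) (use b in auto)
    fix x
    show "norm (Y x) \<le> Z x"
    proof (cases "x \<in> A")
      case True
      then show ?thesis using b[of x] c(1) by (simp add: Z_def)
    qed (simp add: Z_def c(2))
  qed
  finally show ?thesis unfolding Z(2) .
qed

\<comment> \<open>Keeps the interval \<open>{1..n}\<close> in this form, in which the locale facts about it are instantiated.\<close>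
declare One_nat_def [simp del]

context perm_model
begin

abbreviation law :: "nat \<Rightarrow> real ^ 'l \<Rightarrow> (nat \<Rightarrow> nat) pmf" where "law \<equiv> perm_pmf f"

lemma eventually_riemann_err: "eventually (\<lambda>n. n \<ge> 2 \<and> riemann_err n \<le> coercivity) sequentially"
proof -
  have "eventually (\<lambda>n. riemann_err n < coercivity) sequentially" by (rule order_tendstoD(2)[OF riemann_err(1) coercivity(1)])
  then show ?thesis using eventually_ge_at_top[of 2] by eventually_elim simp
qed

lemma prob_mono:
  assumes n: "n \<ge> 1" and sub: "\<And>\<pi>. \<pi> permutes {1..n} \<Longrightarrow> \<pi> \<in> A \<Longrightarrow> \<pi> \<in> B"
  shows "measure_pmf.prob (law n \<theta>) A \<le> measure_pmf.prob (law n \<theta>) B"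
proof -
  interpret W: perm_weights "{1..n}" "dir_mat f n \<theta>" "fbound * norm \<theta>" by (rule weights[OF n order_refl])
  show ?thesis unfolding prob_perm_pmf integral_perm_pmf_real[OF n]
    by (rule W.expec_mono) (use sub in \<open>auto simp: W.perms_def indicator_def\<close>)
qed

definition dev_const :: "real ^ 'l \<Rightarrow> real" where
  "dev_const \<theta> = real CARD('l) * (exp (4 * (fbound * norm \<theta>)) * (4 * fbound))\<^sup>2"

text \<open>
  Chebyshev's inequality.
\<close>

lemma deviation_prob:
  assumes n: "n \<ge> 1" and t: "t > 0"
  shows "measure_pmf.prob (law n \<theta>) {\<pi>. norm (suff_stat f n \<pi> - grad_Z n \<theta>) \<ge> t} \<le> dev_const \<theta> * real n / t\<^sup>2"
proof -
  interpret W: perm_weights "{1..n}" "dir_mat f n \<theta>" "fbound * norm \<theta>" by (rule weights[OF n order_refl])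
  have "measure_pmf.prob (law n \<theta>) {\<pi>. norm (suff_stat f n \<pi> - grad_Z n \<theta>) \<ge> t}
      \<le> W.expec (\<lambda>\<pi>. 1 / t\<^sup>2 * (norm (suff_stat f n \<pi> - grad_Z n \<theta>))\<^sup>2)"
    unfolding prob_perm_pmf integral_perm_pmf_real[OF n]
  proof (rule W.expec_mono)
    fix \<pi>
    show "indicator {\<pi>. norm (suff_stat f n \<pi> - grad_Z n \<theta>) \<ge> t} \<pi> \<le> 1 / t\<^sup>2 * (norm (suff_stat f n \<pi> - grad_Z n \<theta>))\<^sup>2"
    proof (cases "norm (suff_stat f n \<pi> - grad_Z n \<theta>) \<ge> t")
      case True
      then have "t\<^sup>2 \<le> (norm (suff_stat f n \<pi> - grad_Z n \<theta>))\<^sup>2" using t by (intro power_mono) auto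
      then show ?thesis using True t by simp
    qed simp
  qed
  also have "\<dots> = 1 / t\<^sup>2 * (\<integral>\<pi>. (norm (suff_stat f n \<pi> - grad_Z n \<theta>))\<^sup>2 \<partial>measure_pmf (law n \<theta>))"
    unfolding W.expec_linear integral_perm_pmf_real[OF n] ..
  also have "\<dots> \<le> 1 / t\<^sup>2 * (dev_const \<theta> * real n)"
    unfolding dev_const_def by (intro mult_left_mono second_moment[OF n]) auto
  finally show ?thesis by simp
qed

text \<open>
  On the sphere of radius \<open>\<epsilon>\<close> around \<open>\<theta>\<^sub>0\<close>, strong monotonicity makes the gradient point outwards by
  more than the observed deviation of the sufficient statistic from its mean can compensate, so
  \<open>root_in_ball\<close> provides a root.
\<close>

lemma mle_near:
  assumes n: "n \<ge> 1" and e: "riemann_err n \<le> coercivity" and \<epsilon>: "\<epsilon> > 0" and \<pi>: "\<pi> permutes {1..n}"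
    and dev: "norm (suff_stat f n \<pi> - grad_Z n \<theta>\<^sub>0) < lower_const (norm \<theta>\<^sub>0 + \<epsilon>) * \<epsilon> * real n"
  shows "(\<exists>!\<theta>. suff_stat f n \<pi> = grad_Z n \<theta>) \<and> suff_stat f n \<pi> = grad_Z n (theta_ML f n \<pi>) \<and> dist (theta_ML f n \<pi>) \<theta>\<^sub>0 < \<epsilon>"
proof -
  interpret Z: strictly_convex "log_partition f n" "grad_Z n" by (rule strictly_convex_log_partition[OF n e])
  let ?T = "suff_stat f n \<pi>"
  obtain \<theta> where \<theta>: "?T = grad_Z n \<theta>" "dist \<theta> \<theta>\<^sub>0 < \<epsilon>"
  proof (rule Z.root_in_ball[OF \<epsilon>, of \<theta>\<^sub>0 ?T])
    fix x assume x: "dist x \<theta>\<^sub>0 = \<epsilon>"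
    then have nx: "norm (x - \<theta>\<^sub>0) = \<epsilon>" by (simp add: dist_norm)
    have "norm x \<le> norm \<theta>\<^sub>0 + \<epsilon>" using nx norm_triangle_ineq[of \<theta>\<^sub>0 "x - \<theta>\<^sub>0"] by simp
    then have "lower_const (norm \<theta>\<^sub>0 + \<epsilon>) * \<epsilon>\<^sup>2 * real n \<le> (grad_Z n x - grad_Z n \<theta>\<^sub>0) \<bullet> (x - \<theta>\<^sub>0)"
      using grad_Z_strongly_monotone[OF n e, of \<theta>\<^sub>0 "norm \<theta>\<^sub>0 + \<epsilon>" x] \<epsilon> nx by simp
    moreover have "\<bar>(?T - grad_Z n \<theta>\<^sub>0) \<bullet> (x - \<theta>\<^sub>0)\<bar> \<le> norm (?T - grad_Z n \<theta>\<^sub>0) * \<epsilon>"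
      using Cauchy_Schwarz_ineq2[of "?T - grad_Z n \<theta>\<^sub>0" "x - \<theta>\<^sub>0"] nx by simp
    moreover have "norm (?T - grad_Z n \<theta>\<^sub>0) * \<epsilon> < lower_const (norm \<theta>\<^sub>0 + \<epsilon>) * \<epsilon> * real n * \<epsilon>"
      using dev \<epsilon> by (intro mult_strict_right_mono) auto
    moreover have "lower_const (norm \<theta>\<^sub>0 + \<epsilon>) * \<epsilon> * real n * \<epsilon> = lower_const (norm \<theta>\<^sub>0 + \<epsilon>) * \<epsilon>\<^sup>2 * real n"
      by (simp add: power2_eq_square mult_ac)
    moreover have "(grad_Z n x - ?T) \<bullet> (x - \<theta>\<^sub>0) = (grad_Z n x - grad_Z n \<theta>\<^sub>0) \<bullet> (x - \<theta>\<^sub>0) - (?T - grad_Z n \<theta>\<^sub>0) \<bullet> (x - \<theta>\<^sub>0)"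
      by (simp add: inner_diff_left)
    ultimately show "(grad_Z n x - ?T) \<bullet> (x - \<theta>\<^sub>0) > 0" by linarith
  qed blast
  have "theta_ML f n \<pi> = \<theta>" by (rule theta_ML_root[OF n e \<pi> \<theta>(1)])
  then show ?thesis using \<theta> Z.inj_gradient by metis
qed

definition mle_within :: "real ^ 'l \<Rightarrow> nat \<Rightarrow> real \<Rightarrow> (nat \<Rightarrow> nat) \<Rightarrow> bool" where
  "mle_within \<theta>\<^sub>0 n \<epsilon> \<pi> \<longleftrightarrow> (\<exists>!\<theta>. suff_stat f n \<pi> = grad_Z n \<theta>) \<and>
     suff_stat f n \<pi> = grad_Z n (theta_ML f n \<pi>) \<and> dist (theta_ML f n \<pi>) \<theta>\<^sub>0 < \<epsilon>"

lemma mle_withinD: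
  assumes "mle_within \<theta>\<^sub>0 n \<epsilon> \<pi>"
  shows "(\<exists>!\<theta>. suff_stat f n \<pi> = grad_Z n \<theta>) \<and> suff_stat f n \<pi> = grad_Z n (theta_ML f n \<pi>)"
    and "suff_stat f n \<pi> = grad_Z n (theta_ML f n \<pi>)" and "dist (theta_ML f n \<pi>) \<theta>\<^sub>0 < \<epsilon>"
  using assms unfolding mle_within_def by blast+

text \<open>
  The deviation has to reach order \<open>n\<close>, while its typical size is \<open>sqrt n\<close>.
\<close>

lemma mle_not_within_prob:
  assumes \<epsilon>: "\<epsilon> > 0"
  shows "(\<lambda>n. measure_pmf.prob (law n \<theta>\<^sub>0) {\<pi>. \<not> mle_within \<theta>\<^sub>0 n \<epsilon> \<pi>}) \<longlonglongrightarrow> 0"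
proof -
  let ?c = "lower_const (norm \<theta>\<^sub>0 + \<epsilon>) * \<epsilon>"
  have c: "?c > 0" using lower_const_pos \<epsilon> by simp
  have "eventually (\<lambda>n. measure_pmf.prob (law n \<theta>\<^sub>0) {\<pi>. \<not> mle_within \<theta>\<^sub>0 n \<epsilon> \<pi>} \<le> dev_const \<theta>\<^sub>0 / ?c\<^sup>2 * (1 / real n)) sequentially"
    using eventually_riemann_err
  proof eventually_elim
    case (elim n)
    then have n: "n \<ge> 1" and e: "riemann_err n \<le> coercivity" by auto
    have "measure_pmf.prob (law n \<theta>\<^sub>0) {\<pi>. \<not> mle_within \<theta>\<^sub>0 n \<epsilon> \<pi>}
        \<le> measure_pmf.prob (law n \<theta>\<^sub>0) {\<pi>. norm (suff_stat f n \<pi> - grad_Z n \<theta>\<^sub>0) \<ge> ?c * real n}"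
    proof (rule prob_mono[OF n])
      fix \<pi> assume p: "\<pi> permutes {1..n}" and bad: "\<pi> \<in> {\<pi>. \<not> mle_within \<theta>\<^sub>0 n \<epsilon> \<pi>}"
      show "\<pi> \<in> {\<pi>. norm (suff_stat f n \<pi> - grad_Z n \<theta>\<^sub>0) \<ge> ?c * real n}"
      proof (rule ccontr)
        assume "\<pi> \<notin> {\<pi>. norm (suff_stat f n \<pi> - grad_Z n \<theta>\<^sub>0) \<ge> ?c * real n}"
        then have "norm (suff_stat f n \<pi> - grad_Z n \<theta>\<^sub>0) < ?c * real n" by simp
        from mle_near[OF n e \<epsilon> p this] show False using bad unfolding mle_within_def by blast
      qed
    qed
    also have "\<dots> \<le> dev_const \<theta>\<^sub>0 * real n / (?c * real n)\<^sup>2"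
      using c n by (intro deviation_prob[OF n]) simp
    also have "\<dots> = dev_const \<theta>\<^sub>0 / ?c\<^sup>2 * (1 / real n)"
    proof -
      have "d * m / (x * m)\<^sup>2 = d / x\<^sup>2 * (1 / m)" if "m \<noteq> 0" for d m x :: real
        using that by (simp add: power2_eq_square)
      then show ?thesis using n by simp
    qed
    finally show ?case .
  qed
  then have "eventually (\<lambda>n. norm (measure_pmf.prob (law n \<theta>\<^sub>0) {\<pi>. \<not> mle_within \<theta>\<^sub>0 n \<epsilon> \<pi>}) \<le> dev_const \<theta>\<^sub>0 / ?c\<^sup>2 * (1 / real n)) sequentially"
    by (rule eventually_mono) simp
  moreover have "(\<lambda>n. dev_const \<theta>\<^sub>0 / ?c\<^sup>2 * (1 / real n)) \<longlonglongrightarrow> dev_const \<theta>\<^sub>0 / ?c\<^sup>2 * 0"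
    by (intro tendsto_mult tendsto_const lim_1_over_n)
  ultimately show ?thesis unfolding mult_zero_right by (rule Lim_null_comparison)
qed

theorem consistency:
  "(\<lambda>n. measure_pmf.prob (law n \<theta>\<^sub>0)
      {\<pi>. (\<exists>!\<theta>. suff_stat f n \<pi> = grad_Z n \<theta>) \<and> suff_stat f n \<pi> = grad_Z n (theta_ML f n \<pi>)}) \<longlonglongrightarrow> 1"
  "tendsto_in_prob (\<lambda>n. measure_pmf (law n \<theta>\<^sub>0)) (theta_ML f) \<theta>\<^sub>0"
proof -
  let ?A = "\<lambda>n. {\<pi>. (\<exists>!\<theta>. suff_stat f n \<pi> = grad_Z n \<theta>) \<and> suff_stat f n \<pi> = grad_Z n (theta_ML f n \<pi>)}"
  have "1 - measure_pmf.prob (law n \<theta>\<^sub>0) {\<pi>. \<not> mle_within \<theta>\<^sub>0 n 1 \<pi>} \<le> measure_pmf.prob (law n \<theta>\<^sub>0) (?A n)" for n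
  proof -
    have "1 - measure_pmf.prob (law n \<theta>\<^sub>0) {\<pi>. \<not> mle_within \<theta>\<^sub>0 n 1 \<pi>} = measure_pmf.prob (law n \<theta>\<^sub>0) (UNIV - {\<pi>. \<not> mle_within \<theta>\<^sub>0 n 1 \<pi>})"
      using measure_pmf.prob_compl[of "{\<pi>. \<not> mle_within \<theta>\<^sub>0 n 1 \<pi>}" "law n \<theta>\<^sub>0"] by simp
    also have "\<dots> \<le> measure_pmf.prob (law n \<theta>\<^sub>0) (?A n)"
      by (rule measure_pmf.finite_measure_mono) (use mle_withinD(1) in blast, simp)
    finally show ?thesis .
  qed
  moreover have "(\<lambda>n. 1 - measure_pmf.prob (law n \<theta>\<^sub>0) {\<pi>. \<not> mle_within \<theta>\<^sub>0 n 1 \<pi>}) \<longlonglongrightarrow> 1 - 0"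
    by (intro tendsto_diff tendsto_const mle_not_within_prob) simp
  ultimately show "(\<lambda>n. measure_pmf.prob (law n \<theta>\<^sub>0) (?A n)) \<longlonglongrightarrow> 1"
    using tendsto_sandwich[of "\<lambda>n. 1 - measure_pmf.prob (law n \<theta>\<^sub>0) {\<pi>. \<not> mle_within \<theta>\<^sub>0 n 1 \<pi>}"
        "\<lambda>n. measure_pmf.prob (law n \<theta>\<^sub>0) (?A n)" sequentially "\<lambda>_. 1" 1] by simp
  show "tendsto_in_prob (\<lambda>n. measure_pmf (law n \<theta>\<^sub>0)) (theta_ML f) \<theta>\<^sub>0"
    unfolding tendsto_in_prob_def
  proof (intro allI impI)
    fix \<epsilon> :: real assume \<epsilon>: "\<epsilon> > 0"
    have "measure_pmf.prob (law n \<theta>\<^sub>0) {\<omega> \<in> space (measure_pmf (law n \<theta>\<^sub>0)). dist (theta_ML f n \<omega>) \<theta>\<^sub>0 > \<epsilon>}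
        \<le> measure_pmf.prob (law n \<theta>\<^sub>0) {\<pi>. \<not> mle_within \<theta>\<^sub>0 n \<epsilon> \<pi>}" for n
      by (rule measure_pmf.finite_measure_mono) (auto dest: mle_withinD(3))
    then have "\<forall>n. norm (measure_pmf.prob (law n \<theta>\<^sub>0) {\<omega> \<in> space (measure_pmf (law n \<theta>\<^sub>0)). dist (theta_ML f n \<omega>) \<theta>\<^sub>0 > \<epsilon>})
        \<le> measure_pmf.prob (law n \<theta>\<^sub>0) {\<pi>. \<not> mle_within \<theta>\<^sub>0 n \<epsilon> \<pi>}"
      unfolding real_norm_def abs_of_nonneg[OF measure_nonneg] by blast
    from Lim_null_comparison[OF always_eventually[OF this] mle_not_within_prob[OF \<epsilon>]]
    show "(\<lambda>n. measure_pmf.prob (law n \<theta>\<^sub>0) {\<omega> \<in> space (measure_pmf (law n \<theta>\<^sub>0)). dist (theta_ML f n \<omega>) \<theta>\<^sub>0 > \<epsilon>}) \<longlonglongrightarrow> 0" .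
  qed
qed

section \<open>Central limit theorem for the score\<close>

definition score :: "nat \<Rightarrow> (nat \<Rightarrow> nat) \<Rightarrow> real ^ 'l" where
  "score n \<pi> = (1 / sqrt (real n)) *\<^sub>R (suff_stat f n \<pi> - grad_Z n 0)"

lemma dir_mat_0: "dir_mat f n 0 = (\<lambda>_ _. 0)"
  by (simp add: dir_mat_def fun_eq_iff)

lemma uniform: "n \<ge> 1 \<Longrightarrow> uniform_perms {1..n :: nat}"
  by unfold_locales auto

lemma integral_uniform:
  assumes n: "n \<ge> 1"
  shows "(\<integral>\<pi>. G \<pi> \<partial>measure_pmf (law n 0)) = uniform_perms.cexpec {1..n} G"
proof -
  interpret U: uniform_perms "{1..n}" by (rule uniform[OF n])
  have card: "real (card U.perms) > 0" using U.U.finite_perms U.U.perms_ne by (simp add: card_gt_0_iff)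
  have "log_partition f n 0 = ln (real (card U.perms))"
    unfolding log_partition_def U.U.perms_def by simp
  then have w: "exp (0 \<bullet> suff_stat f n \<pi> - log_partition f n 0) = 1 / real (card U.perms)" for \<pi>
    using card by (simp add: exp_minus divide_inverse)
  show ?thesis
    unfolding integral_perm_pmf w U.cexpec_def U.U.perms_def[symmetric]
    by (simp add: scaleR_conv_of_real sum_divide_distrib)
qed

text \<open>
  The centring of \<open>norm_stat\<close> is the gradient at \<open>0\<close>, because both are the mean of the linear statistic
  under the uniform law.
\<close>

lemma norm_stat_dir_mat:
  assumes n: "n \<ge> 1"
  shows "norm_stat {1..n} (dir_mat f n d) \<pi> = d \<bullet> score n \<pi>"
proof -
  interpret U: uniform_perms "{1..n}" by (rule uniform[OF n])
  let ?t = "(\<Sum>i\<in>{1..n}. \<Sum>k\<in>{1..n}. dir_mat f n d i k) / real (card {1..n})"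
  have gr0: "d \<bullet> grad_Z n 0 = U.expec (\<lambda>\<pi>. d \<bullet> suff_stat f n \<pi>)"
    using inner_grad_Z(1)[OF n, of d 0] unfolding dir_mat_0 .
  have "0 = U.expec (\<lambda>\<pi>. 1 / sqrt (real (card {1..n})) * (d \<bullet> suff_stat f n \<pi> - ?t))"
    using U.expec_norm_stat[of "dir_mat f n d"] unfolding norm_stat_def lin_stat_dir_mat by simp
  also have "\<dots> = 1 / sqrt (real (card {1..n})) * (d \<bullet> grad_Z n 0 - ?t)"
    by (simp only: U.U.expec_linear U.U.expec_const gr0)
  finally have "?t = d \<bullet> grad_Z n 0" using n by simp
  then show ?thesis unfolding norm_stat_def lin_stat_dir_mat score_def by (simp add: inner_diff_right)
qed

lemma dir_mat_bounded_by:
  assumes n: "n \<ge> 1" and d: "norm d \<le> K"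
  shows "uniform_perms.bounded_by {1..n} (fbound * K) (dir_mat f n d)"
proof -
  interpret U: uniform_perms "{1..n}" by (rule uniform[OF n])
  show ?thesis unfolding U.bounded_by_def
    using dir_mat_bound[of _ n _ d] mult_left_mono[OF d less_imp_le[OF fbound(1)]] by (blast intro: order_trans)
qed

definition covar :: "nat \<Rightarrow> real ^ 'l \<Rightarrow> real ^ 'l \<Rightarrow> real" where
  "covar n h d = perm_weights.expec {1..n} (\<lambda>_ _. 0) (uniform_perms.quad_var {1..n} (dir_mat f n h) (dir_mat f n d))"

text \<open>
  Two errors: the one of the Riemann sum, and the one of replacing \<open>n - 1\<close> by \<open>n\<close> in the
  normalisation of \<open>expec_quad_var\<close>.
\<close>

lemma covar_limit:
  assumes n: "n \<ge> 2" and K: "norm h \<le> K" "norm d \<le> K"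
  shows "\<bar>covar n h d - h \<bullet> (Gam f *v d)\<bar> \<le> riemann_err n * K\<^sup>2 / 4 + 4 * (fbound * K)\<^sup>2 / (real n - 1)"
proof -
  have n1: "n \<ge> 1" using n by simp
  interpret U: uniform_perms "{1..n}" by (rule uniform[OF n1])
  have Un: "U.n = real n" by (simp add: U.n_def)
  let ?x = "xprod n (dir_mat f n h) (dir_mat f n d)" and ?N = "real n"
  have N: "?N > 1" using n by simp
  have K0: "K \<ge> 0" using K(1) norm_ge_zero order_trans by blast
  have v: "covar n h d = ?x / (4 * ?N ^ 3 * (?N - 1))"
    unfolding covar_def using U.expec_quad_var[of "dir_mat f n h" "dir_mat f n d"] N unfolding Un xprod_def by simp
  have b: "\<bar>?x\<bar> \<le> ?N ^ 4 * (16 * (fbound * K)\<^sup>2)"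
  proof -
    have t: "\<bar>xdiff (dir_mat f n h) i j k l * xdiff (dir_mat f n d) i j k l\<bar> \<le> 16 * (fbound * K)\<^sup>2"
      if "i \<in> {1..n}" "j \<in> {1..n}" "k \<in> {1..n}" "l \<in> {1..n}" for i j k l
    proof -
      have "\<bar>xdiff (dir_mat f n h) i j k l * xdiff (dir_mat f n d) i j k l\<bar> \<le> (4 * (fbound * K)) * (4 * (fbound * K))"
        unfolding abs_mult
        by (intro mult_mono U.xdiff_le dir_mat_bounded_by n1 K that) (use fbound(1) K0 in auto)
      then show ?thesis by (simp add: power2_eq_square)
    qed
    have "\<bar>?x\<bar> \<le> (\<Sum>i\<in>{1..n}. \<Sum>j\<in>{1..n}. \<Sum>k\<in>{1..n}. \<Sum>l\<in>{1..n}. 16 * (fbound * K)\<^sup>2)"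
      unfolding xprod_def by (intro order_trans[OF sum_abs] sum_mono t)
    then show ?thesis by (simp add: power4_eq_xxxx mult.assoc)
  qed
  have e: "\<bar>?x / ?N ^ 4 / 4 - h \<bullet> (Gam f *v d)\<bar> \<le> riemann_err n * K\<^sup>2 / 4"
  proof -
    have "riemann_err n * norm h * norm d \<le> riemann_err n * K * K"
      using K riemann_err(2) K0 by (intro mult_mono mult_nonneg_nonneg) auto
    moreover have "\<bar>y / 4 - r\<bar> \<le> b / 4" if "a \<le> b" "\<bar>y - 4 * r\<bar> \<le> a" for y r a b :: real
      using that by linarith
    ultimately show ?thesis using riemann_err(3)[of n h d] unfolding power2_eq_square mult.assoc[symmetric] by blast
  qed
  have "covar n h d - ?x / ?N ^ 4 / 4 = ?x / ?N ^ 4 / (4 * (?N - 1))"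
  proof -
    have "x / (4 * m ^ 3 * (m - 1)) - x / m ^ 4 / 4 = x / m ^ 4 / (4 * (m - 1))" if m: "m > 1" for x m :: real
    proof -
      define k where "k = m - 1"
      have k: "m = k + 1" "k > 0" using m by (simp_all add: k_def)
      have "x / (4 * c * k) = x / (c * m) * m / (4 * k)" for c
        using m by simp
      moreover have "m ^ 4 = m ^ 3 * m" by (simp add: power4_eq_xxxx power3_eq_cube)
      ultimately have "x / (4 * m ^ 3 * k) = x / m ^ 4 * m / (4 * k)" by simp
      also have "\<dots> = x / m ^ 4 * (1 / 4 + 1 / (4 * k))"
        using k by (simp add: field_simps)
      finally show ?thesis unfolding k_def[symmetric] by (simp add: algebra_simps)
    qed
    then show ?thesis unfolding v using N by blast
  qed
  also have "\<bar>?x / ?N ^ 4 / (4 * (?N - 1))\<bar> \<le> 16 * (fbound * K)\<^sup>2 / (4 * (?N - 1))"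
  proof -
    have "\<bar>?x / ?N ^ 4\<bar> \<le> 16 * (fbound * K)\<^sup>2" using b N by (simp add: pos_divide_le_eq mult.commute)
    then have "\<bar>?x / ?N ^ 4\<bar> / (4 * (?N - 1)) \<le> 16 * (fbound * K)\<^sup>2 / (4 * (?N - 1))"
      using N by (intro divide_right_mono) auto
    then show ?thesis using N unfolding abs_divide[of "?x / ?N ^ 4"] by simp
  qed
  also have "16 * (fbound * K)\<^sup>2 / (4 * (?N - 1)) = 4 * (fbound * K)\<^sup>2 / (?N - 1)"
  proof -
    have "16 * a / (4 * b) = 4 * a / b" for a b :: real by simp
    then show ?thesis .
  qed
  finally have "\<bar>covar n h d - ?x / ?N ^ 4 / 4\<bar> \<le> 4 * (fbound * K)\<^sup>2 / (?N - 1)" .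
  moreover have "\<bar>a - c\<bar> \<le> x + y" if "\<bar>a - b\<bar> \<le> y" "\<bar>b - c\<bar> \<le> x" for a b c x y :: real
    using that by linarith
  ultimately show ?thesis using e by blast
qed

lemma covar_error_tendsto_0: "(\<lambda>n. riemann_err n * K\<^sup>2 / 4 + 4 * (fbound * K)\<^sup>2 / (real n - 1)) \<longlonglongrightarrow> 0"
proof -
  have "(\<lambda>n. 4 * (fbound * K)\<^sup>2 / (real n - 1)) \<longlonglongrightarrow> 0" by (rule const_over_pred_tendsto_0)
  moreover have "(\<lambda>n. riemann_err n * K\<^sup>2 / 4) \<longlonglongrightarrow> 0 * K\<^sup>2 / 4" by (intro tendsto_intros riemann_err(1)) simp
  ultimately show ?thesis using tendsto_add by fastforce
qed

lemma char_score_limit: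
  "(\<lambda>n. \<integral>\<pi>. cis (d \<bullet> score n \<pi>) \<partial>measure_pmf (law n 0)) \<longlonglongrightarrow> complex_of_real (exp (- (d \<bullet> (Gam f *v d)) / 2))"
proof -
  have "(\<lambda>n. covar n d d - d \<bullet> (Gam f *v d)) \<longlonglongrightarrow> 0"
  proof (rule Lim_null_comparison[OF _ covar_error_tendsto_0[of "norm d"]])
    show "\<forall>\<^sub>F n in sequentially. norm (covar n d d - d \<bullet> (Gam f *v d)) \<le> riemann_err n * (norm d)\<^sup>2 / 4 + 4 * (fbound * norm d)\<^sup>2 / (real n - 1)"
      by (rule eventually_mono[OF eventually_ge_at_top[of 2]]) (use covar_limit in auto)
  qed
  then have "(\<lambda>n. covar n d d) \<longlonglongrightarrow> d \<bullet> (Gam f *v d)" by (rule LIM_zero_cancel)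
  then have lim: "(\<lambda>n. complex_of_real (exp (- covar n d d / 2))) \<longlonglongrightarrow> of_real (exp (- (d \<bullet> (Gam f *v d)) / 2))"
    by (intro tendsto_intros) auto
  have "(\<lambda>n. (\<integral>\<pi>. cis (d \<bullet> score n \<pi>) \<partial>measure_pmf (law n 0)) - of_real (exp (- covar n d d / 2))) \<longlonglongrightarrow> 0"
  proof (rule Lim_null_comparison)
    show "\<forall>\<^sub>F n in sequentially. norm ((\<integral>\<pi>. cis (d \<bullet> score n \<pi>) \<partial>measure_pmf (law n 0)) - of_real (exp (- covar n d d / 2)))
        \<le> stein_const (fbound * norm d) 1 / sqrt (real n)"
    proof (rule eventually_mono[OF eventually_ge_at_top[of 1]])
      fix n :: nat assume n: "n \<ge> 1"
      interpret U: uniform_perms "{1..n}" by (rule uniform[OF n])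
      show "norm ((\<integral>\<pi>. cis (d \<bullet> score n \<pi>) \<partial>measure_pmf (law n 0)) - of_real (exp (- covar n d d / 2)))
          \<le> stein_const (fbound * norm d) 1 / sqrt (real n)"
        using U.char_fun_approx[OF dir_mat_bounded_by[OF n order_refl, of d]]
        unfolding integral_uniform[OF n] norm_stat_dir_mat[OF n] covar_def by (simp add: U.n_def)
    qed
    show "(\<lambda>n. stein_const (fbound * norm d) 1 / sqrt (real n)) \<longlonglongrightarrow> 0" by (rule const_over_sqrt_tendsto_0)
  qed
  from tendsto_add[OF this lim] show ?thesis by simp
qed

lemma distr_convergence:
  fixes S :: "real ^ 'l ^ 'l" and Y :: "nat \<Rightarrow> (nat \<Rightarrow> nat) \<Rightarrow> real ^ 'l"
  assumes sym: "transpose S = S" and pd: "\<And>d. d \<noteq> 0 \<Longrightarrow> d \<bullet> (S *v d) > 0"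
    and char: "\<And>d. (\<lambda>n. \<integral>\<pi>. cis (d \<bullet> Y n \<pi>) \<partial>measure_pmf (law n 0)) \<longlonglongrightarrow> complex_of_real (exp (- (d \<bullet> (S *v d)) / 2))"
  shows "tendsto_in_distr (\<lambda>n. measure_pmf (law n 0)) Y (mv_normal 0 S)"
proof -
  have mv: "(\<integral>x. cis (t \<bullet> x) \<partial>mv_normal 0 S) = complex_of_real (exp (- (t \<bullet> (S *v t)) / 2))" for t
    by (rule mv_normal_char(2)[OF sym]) (rule pd)
  let ?\<nu> = "\<lambda>n. distr (measure_pmf (law n 0)) borel (Y n)"
  interpret char_convergence ?\<nu> "mv_normal 0 S"
  proof (rule char_convergence.intro)
    show "prob_space (?\<nu> n)" for n by (rule measure_pmf.prob_space_distr) simp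
    show "sets (?\<nu> n) = sets borel" for n by simp
    show "prob_space (mv_normal 0 S)" by (rule mv_normal_char(1)[OF sym pd])
    show "sets (mv_normal 0 S) = sets borel" by (simp add: mv_normal_def)
    show "(\<lambda>n. \<integral>x. cis (t \<bullet> x) \<partial>?\<nu> n) \<longlonglongrightarrow> (\<integral>x. cis (t \<bullet> x) \<partial>mv_normal 0 S)" for t
    proof -
      have "(\<integral>x. cis (t \<bullet> x) \<partial>?\<nu> n) = (\<integral>\<pi>. cis (t \<bullet> Y n \<pi>) \<partial>measure_pmf (law n 0))" for n
        by (rule integral_distr) simp_all
      then show ?thesis using char[of t] unfolding mv by simp
    qed
  qed
  show ?thesis unfolding tendsto_in_distr_def
  proof (intro allI impI)
    fix g :: "real ^ 'l \<Rightarrow> real" assume g: "continuous_on UNIV g \<and> bounded (range g)"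
    then have [measurable]: "g \<in> borel_measurable borel" by (auto intro: borel_measurable_continuous_onI)
    show "(\<lambda>n. \<integral>\<pi>. g (Y n \<pi>) \<partial>measure_pmf (law n 0)) \<longlonglongrightarrow> (\<integral>x. g x \<partial>mv_normal 0 S)"
    proof -
      have "(\<integral>x. g x \<partial>?\<nu> n) = (\<integral>\<pi>. g (Y n \<pi>) \<partial>measure_pmf (law n 0))" for n
        by (rule integral_distr) simp_all
      then show ?thesis using levy_continuity[of g] g by simp
    qed
  qed
qed

theorem clt: "tendsto_in_distr (\<lambda>n. measure_pmf (law n 0)) score (mv_normal 0 (Gam f))"
  by (rule distr_convergence[OF Gam_symmetric _ char_score_limit]) (rule Gam_pos)

lemma score_tail:
  assumes n: "n \<ge> 1" and t: "t > 0"
  shows "measure_pmf.prob (law n 0) {\<pi>. norm (score n \<pi>) \<ge> t} \<le> dev_const 0 / t\<^sup>2"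
proof -
  have "measure_pmf.prob (law n 0) {\<pi>. norm (score n \<pi>) \<ge> t}
      = measure_pmf.prob (law n 0) {\<pi>. norm (suff_stat f n \<pi> - grad_Z n 0) \<ge> t * sqrt (real n)}"
    unfolding score_def using n by (simp add: pos_le_divide_eq)
  also have "\<dots> \<le> dev_const 0 * real n / (t * sqrt (real n))\<^sup>2"
    using n t by (intro deviation_prob) auto
  also have "\<dots> = dev_const 0 / t\<^sup>2" using n by (simp add: power_mult_distrib)
  finally show ?thesis .
qed

section \<open>Limit law of the maximum likelihood estimator\<close>

text \<open>
  The weights at the parameter \<open>h / sqrt n\<close> are proportional to \<open>exp (h \<bullet> score)\<close>, so the rescaled
  gradient in direction \<open>d\<close> is the mean of \<open>d \<bullet> score\<close> under this tilt, which Stein's identity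
  with \<open>s = 1\<close> evaluates.
\<close>

lemma rescaled_gradient:
  assumes n: "n \<ge> 2" and K: "norm h \<le> K" "norm d \<le> K"
  shows "\<bar>d \<bullet> ((1 / sqrt (real n)) *\<^sub>R (grad_Z n ((1 / sqrt (real n)) *\<^sub>R h) - grad_Z n 0)) - h \<bullet> (Gam f *v d)\<bar>
    \<le> stein_const (fbound * K) 1 / sqrt (real n) + (riemann_err n * K\<^sup>2 / 4 + 4 * (fbound * K)\<^sup>2 / (real n - 1))"
proof -
  have n1: "n \<ge> 1" using n by simp
  interpret U: uniform_perms "{1..n}" by (rule uniform[OF n1])
  let ?q = "1 / sqrt (real n)"
  let ?th = "?q *\<^sub>R h"
  interpret W: perm_weights "{1..n}" "dir_mat f n ?th" "fbound * norm ?th" by (rule weights[OF n1 order_refl])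
  let ?m = "d \<bullet> (?q *\<^sub>R (grad_Z n ?th - grad_Z n 0))"
  let ?c = "exp (?th \<bullet> grad_Z n 0)"
  have wt: "W.wt \<pi> = ?c * exp (h \<bullet> score n \<pi>)" for \<pi>
    unfolding W.wt_def lin_stat_dir_mat score_def exp_add[symmetric] by (simp add: inner_diff_right right_diff_distrib algebra_simps)
  have "?m = W.expec (\<lambda>\<pi>. ?q * (d \<bullet> suff_stat f n \<pi> - d \<bullet> grad_Z n 0))"
    unfolding W.expec_linear W.expec_const inner_grad_Z(1)[OF n1, of d ?th, symmetric]
    by (simp add: inner_diff_right right_diff_distrib)
  also have "\<dots> = W.expec (\<lambda>\<pi>. d \<bullet> score n \<pi>)" by (simp add: score_def inner_diff_right)
  also have "\<dots> = (\<Sum>\<pi>\<in>U.perms. ?c * (d \<bullet> score n \<pi> * exp (h \<bullet> score n \<pi>))) / (\<Sum>\<pi>\<in>U.perms. ?c * exp (h \<bullet> score n \<pi>))"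
    unfolding W.expec_def W.mean_def W.W_def wt by (simp add: mult_ac)
  also have "\<dots> = (\<Sum>\<pi>\<in>U.perms. d \<bullet> score n \<pi> * exp (h \<bullet> score n \<pi>)) / (\<Sum>\<pi>\<in>U.perms. exp (h \<bullet> score n \<pi>))"
    by (simp add: sum_distrib_left[symmetric])
  also have "\<dots> = U.expec (\<lambda>\<pi>. d \<bullet> score n \<pi> * exp (h \<bullet> score n \<pi>)) / U.expec (\<lambda>\<pi>. exp (h \<bullet> score n \<pi>))"
    unfolding U.expec_eq using U.U.finite_perms U.U.perms_ne by simp
  finally have m: "?m = U.expec (\<lambda>\<pi>. d \<bullet> score n \<pi> * exp (h \<bullet> score n \<pi>)) / U.expec (\<lambda>\<pi>. exp (h \<bullet> score n \<pi>))" .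
  define u where "u = U.expec (\<lambda>\<pi>. exp (h \<bullet> score n \<pi>))"
  have u1: "u \<ge> 1" using U.mgf_ge_1[of "dir_mat f n h"] unfolding norm_stat_dir_mat[OF n1] u_def .
  have "\<bar>U.expec (\<lambda>\<pi>. d \<bullet> score n \<pi> * exp (h \<bullet> score n \<pi>)) - covar n h d * u\<bar> \<le> stein_const (fbound * K) 1 / sqrt (real n)"
    using U.tilted_mean_approx[OF dir_mat_bounded_by[OF n1 K(1)] dir_mat_bounded_by[OF n1 K(2)]]
    unfolding norm_stat_dir_mat[OF n1] covar_def u_def by (simp add: U.n_def)
  moreover have "\<bar>?m - covar n h d\<bar> \<le> \<bar>?m - covar n h d\<bar> * u" using u1 by (simp add: mult_le_cancel_left1)
  moreover have "\<bar>?m - covar n h d\<bar> * u = \<bar>U.expec (\<lambda>\<pi>. d \<bullet> score n \<pi> * exp (h \<bullet> score n \<pi>)) - covar n h d * u\<bar>"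
  proof -
    have "\<bar>a / u - b\<bar> * u = \<bar>a - b * u\<bar>" for a b
    proof -
      have "\<bar>a / u - b\<bar> * u = \<bar>(a / u - b) * u\<bar>" using u1 by (simp add: abs_mult)
      then show ?thesis using u1 by (simp add: left_diff_distrib)
    qed
    then show ?thesis unfolding m u_def[symmetric] .
  qed
  ultimately have "\<bar>?m - covar n h d\<bar> \<le> stein_const (fbound * K) 1 / sqrt (real n)" by linarith
  then show ?thesis using covar_limit[OF n K] by linarith
qed

lemma Gam_inv: "Gam f *v (matrix_inv (Gam f) *v x) = x" "matrix_inv (Gam f) *v (Gam f *v x) = x"
  using matrix_inv_mult[OF invertible_Gam[OF indep class_C]] by (simp_all add: matrix_vector_mul_assoc)

text \<open>
  Suppose the rescaled estimator is farther than \<open>\<delta>\<close> from \<open>x = matrix_inv (Gam f) *v score\<close>, and let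
  \<open>h = x + d\<close> be the point at distance \<open>\<delta>\<close> from \<open>x\<close> on the segment towards it.  The gradient takes
  the value \<open>suff_stat\<close> at the estimator, so by monotonicity its rescaled increment from \<open>0\<close> to
  \<open>h / sqrt n\<close> is less than \<open>score\<close> in direction \<open>d\<close>.  But this increment is almost
  \<open>Gam f *v h = score + Gam f *v d\<close>, which exceeds it by at least \<open>coercivity * \<delta>\<^sup>2\<close>.  The only
  gradients that enter are those at \<open>h / sqrt n\<close> with \<open>norm h \<le> K\<close>, where \<open>rescaled_gradient\<close> is uniform.
\<close>

lemma mle_linearization:
  assumes \<delta>: "\<delta> > 0" and B: "B > 0"
  shows "eventually (\<lambda>n. \<forall>\<pi>. norm (score n \<pi>) \<le> B \<longrightarrow> suff_stat f n \<pi> = grad_Z n (theta_ML f n \<pi>) \<longrightarrow>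
    norm (sqrt (real n) *\<^sub>R theta_ML f n \<pi> - matrix_inv (Gam f) *v score n \<pi>) \<le> \<delta>) sequentially"
proof -
  obtain B1 where B1: "\<And>x. norm (matrix_inv (Gam f) *v x) \<le> B1 * norm x" "B1 > 0"
    using bounded_linear.pos_bounded[OF matrix_vector_mul_bounded_linear[of "matrix_inv (Gam f)"]] by (auto simp: mult.commute)
  define K where "K = B1 * B + \<delta>"
  have K: "K \<ge> \<delta>" using B B1 by (simp add: K_def)
  let ?E = "\<lambda>n. stein_const (fbound * K) 1 / sqrt (real n) + (riemann_err n * K\<^sup>2 / 4 + 4 * (fbound * K)\<^sup>2 / (real n - 1))"
  have "(\<lambda>n. stein_const (fbound * K) 1 / sqrt (real n)) \<longlonglongrightarrow> 0" by (rule const_over_sqrt_tendsto_0)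
  from tendsto_add[OF this covar_error_tendsto_0[of K]] have "?E \<longlonglongrightarrow> 0" by simp
  then have ev: "eventually (\<lambda>n. ?E n < coercivity * \<delta>\<^sup>2) sequentially"
    using coercivity(1) \<delta> by (intro order_tendstoD(2)) auto
  show ?thesis using ev eventually_riemann_err
  proof eventually_elim
    case (elim n)
    then have n: "n \<ge> 2" "n \<ge> 1" and e: "riemann_err n \<le> coercivity" and E: "?E n < coercivity * \<delta>\<^sup>2" by auto
    interpret Z: strictly_convex "log_partition f n" "grad_Z n" by (rule strictly_convex_log_partition[OF n(2) e])
    define q where "q = sqrt (real n)"
    have q: "q > 0" using n by (simp add: q_def)
    show ?case
    proof (intro allI impI, rule ccontr)
      fix \<pi> assume XB: "norm (score n \<pi>) \<le> B" and root: "suff_stat f n \<pi> = grad_Z n (theta_ML f n \<pi>)"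
      let ?th = "theta_ML f n \<pi>"
      define x where "x = matrix_inv (Gam f) *v score n \<pi>"
      assume "\<not> norm (sqrt (real n) *\<^sub>R ?th - matrix_inv (Gam f) *v score n \<pi>) \<le> \<delta>"
      then have far: "norm (q *\<^sub>R ?th - x) > \<delta>" unfolding x_def q_def by simp
      define s where "s = \<delta> / norm (q *\<^sub>R ?th - x)"
      have np: "norm (q *\<^sub>R ?th - x) > 0" using far \<delta> by linarith
      have s: "0 < s" "s < 1" unfolding s_def using np far \<delta> by (simp_all del: zero_less_norm_iff)
      define d where "d = s *\<^sub>R (q *\<^sub>R ?th - x)"
      define h where "h = x + d"
      have nd: "norm d = \<delta>" using np \<delta> by (simp add: d_def s_def)
      have "norm x \<le> B1 * B" unfolding x_def
        using B1 XB by (meson mult_left_mono order_trans less_imp_le)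
      then have nh: "norm h \<le> K" using norm_triangle_ineq[of x d] nd by (simp add: h_def K_def)
      define y where "y = (1 / q) *\<^sub>R h"
      have diff: "q *\<^sub>R (?th - y) = ((1 - s) / s) *\<^sub>R d"
      proof -
        have "q *\<^sub>R (?th - y) = (1 - s) *\<^sub>R (q *\<^sub>R ?th - x)"
          using q by (simp add: y_def h_def d_def scaleR_diff_right algebra_simps)
        then show ?thesis using s by (simp add: d_def)
      qed
      have "?th \<noteq> y"
      proof
        assume "?th = y"
        then have "((1 - s) / s) *\<^sub>R d = 0" using diff by simp
        then show False using s nd \<delta> by auto
      qed
      then have "(grad_Z n ?th - grad_Z n y) \<bullet> (?th - y) > 0" using Z.mono[of y ?th] by simp
      then have "(grad_Z n ?th - grad_Z n y) \<bullet> (q *\<^sub>R (?th - y)) > 0" using q by simp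
      then have "((1 - s) / s) * ((grad_Z n ?th - grad_Z n y) \<bullet> d) > 0" unfolding diff by simp
      moreover have "(1 - s) / s > 0" using s by simp
      ultimately have pos: "(grad_Z n ?th - grad_Z n y) \<bullet> d > 0" by (rule zero_less_mult_pos)
      let ?m = "(1 / q) *\<^sub>R (grad_Z n y - grad_Z n 0)"
      have "(score n \<pi> - ?m) \<bullet> d > 0"
      proof -
        have "score n \<pi> - ?m = (1 / q) *\<^sub>R (grad_Z n ?th - grad_Z n y)"
          unfolding score_def root q_def[symmetric] by (simp add: scaleR_diff_right)
        then show ?thesis using pos q by simp
      qed
      moreover have "\<bar>d \<bullet> ?m - h \<bullet> (Gam f *v d)\<bar> \<le> ?E n"
        using rescaled_gradient[OF n(1) nh, of d] nd K unfolding q_def[symmetric] y_def by simp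
      moreover have "h \<bullet> (Gam f *v d) = score n \<pi> \<bullet> d + d \<bullet> (Gam f *v d)"
      proof -
        have "x \<bullet> (Gam f *v d) = (Gam f *v x) \<bullet> d"
          by (metis Gam_symmetric dot_lmul_matrix inner_commute transpose_matrix_vector)
        then show ?thesis unfolding h_def inner_add_left x_def Gam_inv(1) by simp
      qed
      moreover have "coercivity * \<delta>\<^sup>2 \<le> d \<bullet> (Gam f *v d)" using coercivity(2)[of d] nd by simp
      moreover have "(score n \<pi> - ?m) \<bullet> d = score n \<pi> \<bullet> d - d \<bullet> ?m"
        unfolding inner_diff_left inner_commute[of ?m d] ..
      ultimately show False using E by linarith
    qed
  qed
qed

text \<open>
  The score is bounded in probability, uniformly in \<open>n\<close>, by Chebyshev's inequality.
\<close>

lemma linearization_in_prob: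
  assumes \<delta>: "\<delta> > 0"
  shows "(\<lambda>n. measure_pmf.prob (law n 0)
    {\<pi>. norm (sqrt (real n) *\<^sub>R theta_ML f n \<pi> - matrix_inv (Gam f) *v score n \<pi>) > \<delta>}) \<longlonglongrightarrow> 0"
    (is "(\<lambda>n. ?p n {\<pi>. ?far n \<pi>}) \<longlonglongrightarrow> 0")
proof (rule tendstoI)
  fix \<eta> :: real assume \<eta>: "\<eta> > 0"
  \<comment> \<open>This makes the Chebyshev bound \<open>dev_const 0 / B\<^sup>2\<close> smaller than \<open>\<eta> / 2\<close>; the \<open>+ 1\<close> keeps \<open>B\<close> positive.\<close>
  define B where "B = sqrt (2 * (dev_const 0 + 1) / \<eta>)"
  have dc: "dev_const 0 \<ge> 0" by (simp add: dev_const_def)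
  have B: "B > 0" "B\<^sup>2 = 2 * (dev_const 0 + 1) / \<eta>" using \<eta> dc by (auto simp: B_def)
  have tail: "dev_const 0 / B\<^sup>2 < \<eta> / 2"
    unfolding B(2) using \<eta> dc by (simp add: field_simps)
  have "eventually (\<lambda>n. ?p n {\<pi>. \<not> mle_within 0 n 1 \<pi>} < \<eta> / 2) sequentially"
    using order_tendstoD(2)[OF mle_not_within_prob[of 1 0], of "\<eta> / 2"] \<eta> by simp
  then show "eventually (\<lambda>n. dist (?p n {\<pi>. ?far n \<pi>}) 0 < \<eta>) sequentially"
    using mle_linearization[OF \<delta> B(1)] eventually_ge_at_top[of 1]
  proof eventually_elim
    case (elim n)
    have "?p n {\<pi>. ?far n \<pi>} \<le> ?p n ({\<pi>. \<not> mle_within 0 n 1 \<pi>} \<union> {\<pi>. norm (score n \<pi>) \<ge> B})"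
    proof (intro measure_pmf.finite_measure_mono subsetI)
      fix \<pi> assume far: "\<pi> \<in> {\<pi>. ?far n \<pi>}"
      show "\<pi> \<in> {\<pi>. \<not> mle_within 0 n 1 \<pi>} \<union> {\<pi>. norm (score n \<pi>) \<ge> B}"
      proof (rule ccontr)
        assume "\<pi> \<notin> {\<pi>. \<not> mle_within 0 n 1 \<pi>} \<union> {\<pi>. norm (score n \<pi>) \<ge> B}"
        then have "mle_within 0 n 1 \<pi>" "norm (score n \<pi>) \<le> B" by auto
        then show False using elim(2) mle_withinD(2) far by fastforce
      qed
    qed simp
    also have "\<dots> \<le> ?p n {\<pi>. \<not> mle_within 0 n 1 \<pi>} + ?p n {\<pi>. norm (score n \<pi>) \<ge> B}"
      by (rule measure_Un_le) auto
    also have "\<dots> < \<eta> / 2 + \<eta> / 2"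
      using elim(1) score_tail[OF elim(3) B(1)] tail by linarith
    finally show ?case by simp
  qed
qed

lemma cis_diff_le: "norm (cis a - cis b) \<le> \<bar>a - b\<bar>"
proof -
  have "norm (cis a - cis b) = norm (cis b) * norm (cis (a - b) - 1)"
    unfolding norm_mult[symmetric] right_diff_distrib cis_mult by simp
  also have "\<dots> \<le> \<bar>a - b\<bar>"
    using iexp_approx1[of "a - b" 0] by (simp add: cis_conv_exp)
  finally show ?thesis .
qed

text \<open>
  Slutsky's argument on the level of characteristic functions: the rescaled estimator may be
  replaced by the linear image of the score, whose characteristic function at \<open>d\<close> is that of the score at
  \<open>matrix_inv (Gam f) *v d\<close>.
\<close>

theorem mle_clt: "tendsto_in_distr (\<lambda>n. measure_pmf (law n 0)) (\<lambda>n \<pi>. sqrt (real n) *\<^sub>R theta_ML f n \<pi>) (mv_normal 0 (matrix_inv (Gam f)))"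
proof (rule distr_convergence)
  let ?J = "matrix_inv (Gam f)"
  have J_sym: "a \<bullet> (?J *v b) = (?J *v a) \<bullet> b" for a b
  proof -
    have "a \<bullet> (?J *v b) = (Gam f *v (?J *v a)) \<bullet> (?J *v b)" by (simp only: Gam_inv)
    also have "\<dots> = (?J *v a) \<bullet> (Gam f *v (?J *v b))"
      by (metis Gam_symmetric dot_lmul_matrix inner_commute transpose_matrix_vector)
    finally show ?thesis by (simp only: Gam_inv)
  qed
  show "transpose ?J = ?J"
  proof -
    have "transpose ?J *v x = ?J *v x" for x
    proof -
      have "y \<bullet> (transpose ?J *v x) = y \<bullet> (?J *v x)" for y
        unfolding J_sym by (metis dot_lmul_matrix inner_commute transpose_matrix_vector)
      then show ?thesis by (metis vector_eq_ldot)
    qed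
    then show ?thesis by (simp add: matrix_eq)
  qed
  have JJ: "d \<bullet> (?J *v d) = (?J *v d) \<bullet> (Gam f *v (?J *v d))" for d
    by (simp add: Gam_inv inner_commute)
  show "d \<bullet> (?J *v d) > 0" if "d \<noteq> 0" for d
  proof -
    have "?J *v d \<noteq> 0" using Gam_inv(1)[of d] that by auto
    then show ?thesis unfolding JJ by (rule Gam_pos)
  qed
  fix d :: "real ^ 'l"
  let ?th = "\<lambda>n \<pi>. sqrt (real n) *\<^sub>R theta_ML f n \<pi>"
  let ?D = "\<lambda>n. (\<integral>\<pi>. cis (d \<bullet> ?th n \<pi>) \<partial>measure_pmf (law n 0)) - (\<integral>\<pi>. cis ((?J *v d) \<bullet> score n \<pi>) \<partial>measure_pmf (law n 0))"
  have "?D \<longlonglongrightarrow> 0"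
  proof (rule tendstoI)
    fix \<eta> :: real assume \<eta>: "\<eta> > 0"
    define \<delta> where "\<delta> = \<eta> / (2 * (norm d + 1))"
    have \<delta>: "\<delta> > 0" "norm d * \<delta> \<le> \<eta> / 2"
      using \<eta> by (auto simp: \<delta>_def field_simps add_pos_nonneg intro!: divide_pos_pos)
    let ?far = "\<lambda>n. {\<pi>. norm (?th n \<pi> - ?J *v score n \<pi>) > \<delta>}"
    have "eventually (\<lambda>n. measure_pmf.prob (law n 0) (?far n) < \<eta> / 4) sequentially"
      by (rule order_tendstoD(2)[OF linearization_in_prob[OF \<delta>(1)]]) (use \<eta> in simp)
    then show "eventually (\<lambda>n. dist (?D n) 0 < \<eta>) sequentially"
    proof (rule eventually_mono)
      fix n assume small: "measure_pmf.prob (law n 0) (?far n) < \<eta> / 4"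
      let ?M = "measure_pmf (law n 0)"
      have int: "integrable ?M (\<lambda>\<pi>. cis (t \<pi>))" for t
        by (rule measure_pmf.integrable_const_bound[where B = 1]) auto
      have "?D n = (\<integral>\<pi>. cis (d \<bullet> ?th n \<pi>) - cis ((?J *v d) \<bullet> score n \<pi>) \<partial>?M)"
        by (rule Bochner_Integration.integral_diff[OF int int, symmetric])
      also have "norm \<dots> \<le> \<eta> / 2 + 2 * measure_pmf.prob (law n 0) (?far n)"
      proof (rule measure_pmf.norm_integral_le_off_event)
        show "norm (cis (d \<bullet> ?th n \<pi>) - cis ((?J *v d) \<bullet> score n \<pi>)) \<le> 2" for \<pi>
          using norm_triangle_ineq4[of "cis (d \<bullet> ?th n \<pi>)" "cis ((?J *v d) \<bullet> score n \<pi>)"] by simp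
        show "norm (cis (d \<bullet> ?th n \<pi>) - cis ((?J *v d) \<bullet> score n \<pi>)) \<le> \<eta> / 2" if "\<pi> \<notin> ?far n" for \<pi>
        proof -
          have "norm (cis (d \<bullet> ?th n \<pi>) - cis ((?J *v d) \<bullet> score n \<pi>)) \<le> \<bar>d \<bullet> ?th n \<pi> - (?J *v d) \<bullet> score n \<pi>\<bar>"
            by (rule cis_diff_le)
          also have "\<dots> = \<bar>d \<bullet> (?th n \<pi> - ?J *v score n \<pi>)\<bar>" by (simp only: J_sym[symmetric] inner_diff_right)
          also have "\<dots> \<le> norm d * norm (?th n \<pi> - ?J *v score n \<pi>)" by (rule Cauchy_Schwarz_ineq2)
          also have "\<dots> \<le> norm d * \<delta>" using that by (intro mult_left_mono) auto
          finally show ?thesis using \<delta>(2) by simp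
        qed
      qed (use \<eta> in simp_all)
      also have "\<dots> < \<eta>" using small by simp
      finally show "dist (?D n) 0 < \<eta>" by simp
    qed
  qed
  from tendsto_add[OF this char_score_limit[of "?J *v d"]]
  show "(\<lambda>n. \<integral>\<pi>. cis (d \<bullet> ?th n \<pi>) \<partial>measure_pmf (law n 0)) \<longlonglongrightarrow> complex_of_real (exp (- (d \<bullet> (?J *v d)) / 2))"
    unfolding JJ[of d] by simp
qed

end

theorem theorem1p7:
  fixes f :: "real \<times> real \<Rightarrow> real ^ 'l" and \<theta>\<^sub>0 :: "real ^ 'l"
  assumes "lin_indep f"
    and "\<forall>r. (\<lambda>z. f z $ r) \<in> class_C"
  shows "((\<lambda>n. measure_pmf.prob (perm_pmf f n \<theta>\<^sub>0)
             {\<pi>. (\<exists>!\<theta>. suff_stat f n \<pi> = gradient (log_partition f n) \<theta>) \<and>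
                  suff_stat f n \<pi> = gradient (log_partition f n) (theta_ML f n \<pi>)}) \<longlonglongrightarrow> 1
          \<and> tendsto_in_prob (\<lambda>n. measure_pmf (perm_pmf f n \<theta>\<^sub>0)) (theta_ML f) \<theta>\<^sub>0)
       \<and> (\<theta>\<^sub>0 = 0 \<longrightarrow>
            tendsto_in_distr (\<lambda>n. measure_pmf (perm_pmf f n \<theta>\<^sub>0))
              (\<lambda>n \<pi>. (1 / sqrt (real n)) *\<^sub>R
                      (suff_stat f n \<pi> - gradient (log_partition f n) 0))
              (mv_normal 0 (Gam f)))
       \<and> (\<theta>\<^sub>0 = 0 \<longrightarrow>
            tendsto_in_distr (\<lambda>n. measure_pmf (perm_pmf f n \<theta>\<^sub>0))
              (\<lambda>n \<pi>. sqrt (real n) *\<^sub>R theta_ML f n \<pi>)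
              (mv_normal 0 (matrix_inv (Gam f))))"
proof -
  interpret perm_model f by unfold_locales (fact assms)+
  have "score = (\<lambda>n \<pi>. (1 / sqrt (real n)) *\<^sub>R (suff_stat f n \<pi> - gradient (log_partition f n) 0))"
    by (simp add: score_def fun_eq_iff)
  then show ?thesis using consistency[of \<theta>\<^sub>0] clt mle_clt by simp
qed

end
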